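(* Let $\Omega=(0,1)$, let $X_n=\{x_1,\dots,x_n\}\subset\Omega$ be distinct points, and let $\Phi_N$ be the finite element kernel of degree $p\ge1$ on the uniform mesh of size $1/N$ (defined in the context). Suppose the kernel matrix $K_{\Phi_N}$ is invertible. Let $f\in H^{s_0}(\Omega)$ with $1\le s_0\in\mathbb{N}$. Then there exists $h_0>0$ independent of $N$ and $n$ such that if $h_{n,\Omega}\le h_0$, we have, by setting $\sqrt\lambda\asymp\sqrt{h_{n,\Omega}}$, $$\|f-\mathcal{I}^\lambda_{\Phi_N,X_n}f\|_{L^2(\Omega)}\le C\Big(\sqrt{n\,h_{n,\Omega}}\,N^{-[(p+1)\wedge s_0-\frac12]}+h_{n,\Omega}\Big)\|f\|_{H^{s_0}(\Omega)},$$ $$\|f-\mathcal{I}^\lambda_{\Phi_N,X_n}f\|_{L^\infty(\Omega)}\le C\Big(\sqrt n\,N^{-[(p+1)\wedge s_0-\frac12]}+\sqrt{h_{n,\Omega}}\Big)\|f\|_{H^{s_0}(\Omega)},$$ where $C$ is a constant independent of $N$ and $n$. When $s_0=1$, if the design points are quasi-uniform, setting $N\gtrsim n$ with implied constant large enough that $q_n>N^{-1}$ (which guarantees invertibility of $K_{\Phi_N}$), we have $$\|f-\mathcal{I}^\lambda_{\Phi_N,X_n}f\|_{L^2(\Omega)}\le Cn^{-1}\|f\|_{H^1(\Omega)},\qquad\|f-\mathcal{I}^\lambda_{\Phi_N,X_n}f\|_{L^\infty(\Omega)}\le Cn^{-1/2}\|f\|_{H^1(\Omega)}.$$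
   Context: Finite element kernel: let $\xi_i=i/N$, $i=0,\dots,N$, fix $p\ge1$, and let $V_N=\{\psi\in C^0(\overline\Omega):\psi\text{ is a degree-}p\text{ polynomial (degree at most }p)\text{ on }[\xi_{i-1},\xi_i],\ 1\le i\le N\}\subset H^1(\Omega)$ and $\overline V_N=\{\psi-\int_\Omega\psi\,dx:\psi\in V_N\}$. Let $M=\dim\overline V_N=pN$ and let $\{\psi_{N,i}\}_{i=1}^M$ be an $L^2(\Omega)$-orthonormal basis of $\overline V_N$ with eigenvalues $\lambda_{N,i}$ satisfying $\langle\nabla\psi_{N,i},\nabla\phi\rangle=\lambda_{N,i}\langle\psi_{N,i},\phi\rangle$ for all $\phi\in\overline V_N$ ($\langle\cdot,\cdot\rangle$ the $L^2(\Omega)$ inner product). Set $\lambda_{N,0}=0$, $\psi_{N,0}\equiv1$, so $\{\psi_{N,i}\}_{i=0}^M$ is an orthonormal basis of $V_N$, and $$\Phi_N(x,\tilde x)=\sum_{i=0}^M(1+\lambda_{N,i})^{-1}\psi_{N,i}(x)\psi_{N,i}(\tilde x).$$ (The RKHS of $\Phi_N$ is $V_N$ with the $H^1(\Omega)$ norm.) $K_{\Phi_N}:=[\Phi_N(x_i,x_j)]_{i,j=1}^n$, $k_{\Phi_N}(x):=(\Phi_N(x,x_1),\dots,\Phi_N(x,x_n))^T$, and for $\lambda\ge0$, $\mathcal{I}^\lambda_{\Phi_N,X_n}f(x):=k_{\Phi_N}(x)^T(K_{\Phi_N}+\lambda I)^{-1}Y$ with $Y=(f(x_1),\dots,f(x_n))^T$.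 Fill distance $h_{n,\Omega}:=\sup_{x\in\Omega}\operatorname{dist}(x,X_n)$; separation radius $q_n:=\min_{x\ne z\in X_n}\frac12|x-z|$; design points are quasi-uniform if $h_{n,\Omega}/q_n$ is bounded uniformly in $n$. $a\wedge b=\min(a,b)$; $a\gtrsim b$ means $a\ge cb$ for a constant $c>0$ not depending on $n,N$, and $a\asymp b$ means both $a\lesssim b$ and $b\lesssim a$. *)

theory Defs
  imports
    "HOL-Analysis.Analysis"
    "HOL-Probability.Essential_Supremum"
    "HOL-Computational_Algebra.Polynomial"
    "Jordan_Normal_Form.Gauss_Jordan_Elimination"
begin

abbreviation Omega :: "real set" where
  "Omega \<equiv> {0<..<1}"

subsection \<open>Lebesgue and Sobolev spaces on the unit interval\<close>

definition L2_space :: "(real \<Rightarrow> real) set" where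
  "L2_space = {f \<in> borel_measurable (lebesgue_on Omega).
                 integrable (lebesgue_on Omega) (\<lambda>x. (f x)\<^sup>2)}"

definition L2_inner :: "(real \<Rightarrow> real) \<Rightarrow> (real \<Rightarrow> real) \<Rightarrow> real" where
  "L2_inner f g = (LINT x|lebesgue_on Omega. f x * g x)"

definition L2_norm :: "(real \<Rightarrow> real) \<Rightarrow> real" where
  "L2_norm f = sqrt (L2_inner f f)"

definition Linf_norm :: "(real \<Rightarrow> real) \<Rightarrow> ereal" where
  "Linf_norm f = esssup (lebesgue_on Omega) (\<lambda>x. ereal \<bar>f x\<bar>)"

definition locally_integrable :: "(real \<Rightarrow> real) \<Rightarrow> bool" where
  "locally_integrable f \<longleftrightarrow>
     (\<forall>K. compact K \<and> K \<subseteq> Omega \<longrightarrow> set_integrable lebesgue K f)"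

text \<open>The space of smooth functions with compact support in the open unit interval; the
  support is automatically compact, being closed and bounded.\<close>

definition test_functions :: "(real \<Rightarrow> real) set" where
  "test_functions = {\<phi>. (\<forall>k x. (deriv ^^ k) \<phi> differentiable (at x)) \<and>
                         closure {x. \<phi> x \<noteq> 0} \<subseteq> Omega}"

definition has_weak_deriv :: "nat \<Rightarrow> (real \<Rightarrow> real) \<Rightarrow> (real \<Rightarrow> real) \<Rightarrow> bool" where
  "has_weak_deriv k f g \<longleftrightarrow>
     locally_integrable f \<and> locally_integrable g \<and>
     (\<forall>\<phi>\<in>test_functions. L2_inner f ((deriv ^^ k) \<phi>) = (- 1) ^ k * L2_inner g \<phi>)"

text \<open>A weak derivative is determined up to a null set only, so this is one of its
  representatives. It occurs below only inside integrals over the unit interval.\<close>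

definition weak_deriv :: "nat \<Rightarrow> (real \<Rightarrow> real) \<Rightarrow> real \<Rightarrow> real" where
  "weak_deriv k f = (SOME g. has_weak_deriv k f g)"

definition Sobolev :: "nat \<Rightarrow> (real \<Rightarrow> real) set" where
  "Sobolev s = {f \<in> L2_space. \<forall>k\<le>s. \<exists>g\<in>L2_space. has_weak_deriv k f g}"

definition Sobolev_norm :: "nat \<Rightarrow> (real \<Rightarrow> real) \<Rightarrow> real" where
  "Sobolev_norm s f = sqrt (\<Sum>k\<le>s. (L2_norm (weak_deriv k f))\<^sup>2)"

text \<open>For \<open>s \<ge> 1\<close> every class in the Sobolev space has exactly one representative that is
  continuous on the open interval. Point values of a Sobolev function refer to it.\<close>

definition Sobolev_cont :: "nat \<Rightarrow> (real \<Rightarrow> real) set" where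
  "Sobolev_cont s = {f \<in> Sobolev s. continuous_on Omega f}"

subsection \<open>The finite element kernel\<close>

text \<open>Only the values on the closed unit interval matter for the elements of the finite
  element spaces; the values elsewhere are arbitrary.\<close>

definition fe_space :: "nat \<Rightarrow> nat \<Rightarrow> (real \<Rightarrow> real) set" where
  "fe_space p N = {\<psi>. continuous_on {0..1} \<psi> \<and>
     (\<forall>i\<in>{1..N}. \<exists>P :: real poly. degree P \<le> p \<and>
        (\<forall>x\<in>{(real i - 1) / real N .. real i / real N}. \<psi> x = poly P x))}"

definition fe_space0 :: "nat \<Rightarrow> nat \<Rightarrow> (real \<Rightarrow> real) set" where
  "fe_space0 p N = {\<lambda>x. \<psi> x - (LINT t|lebesgue_on Omega. \<psi> t) | \<psi>. \<psi> \<in> fe_space p N}"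

text \<open>An \<open>L\<^sup>2\<close>-orthonormal eigenbasis \<open>\<psi> 1, \<dots>, \<psi> (p * N)\<close> of \<^term>\<open>fe_space0 p N\<close>,
  together with the constant function \<open>\<psi> 0\<close>.\<close>

definition fe_eigenbasis :: "nat \<Rightarrow> nat \<Rightarrow> (nat \<Rightarrow> real \<Rightarrow> real) \<Rightarrow> (nat \<Rightarrow> real) \<Rightarrow> bool" where
  "fe_eigenbasis p N \<psi> \<mu> \<longleftrightarrow>
     (\<forall>x\<in>{0..1}. \<psi> 0 x = 1) \<and> \<mu> 0 = 0 \<and>
     (\<forall>i\<in>{1..p * N}. \<psi> i \<in> fe_space0 p N) \<and>
     (\<forall>i\<in>{1..p * N}. \<forall>j\<in>{1..p * N}. L2_inner (\<psi> i) (\<psi> j) = (if i = j then 1 else 0)) \<and>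
     (\<forall>\<phi>\<in>fe_space0 p N. \<exists>c. \<forall>x\<in>{0..1}. \<phi> x = (\<Sum>i=1..p * N. c i * \<psi> i x)) \<and>
     (\<forall>i\<in>{1..p * N}. \<forall>\<phi>\<in>fe_space0 p N.
        L2_inner (weak_deriv 1 (\<psi> i)) (weak_deriv 1 \<phi>) = \<mu> i * L2_inner (\<psi> i) \<phi>)"

definition fe_kernel ::
    "nat \<Rightarrow> nat \<Rightarrow> (nat \<Rightarrow> real \<Rightarrow> real) \<Rightarrow> (nat \<Rightarrow> real) \<Rightarrow> real \<Rightarrow> real \<Rightarrow> real" where
  "fe_kernel p N \<psi> \<mu> x y = (\<Sum>i=0..p * N. inverse (1 + \<mu> i) * \<psi> i x * \<psi> i y)"

subsection \<open>Regularized kernel interpolation\<close>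

text \<open>The design points are given as a list \<open>xs\<close>; they are indexed from 0.\<close>

definition design :: "real list \<Rightarrow> bool" where
  "design xs \<longleftrightarrow> xs \<noteq> [] \<and> distinct xs \<and> set xs \<subseteq> Omega"

definition kernel_mat :: "(real \<Rightarrow> real \<Rightarrow> real) \<Rightarrow> real list \<Rightarrow> real mat" where
  "kernel_mat \<Phi> xs = Matrix.mat (length xs) (length xs) (\<lambda>(i, j). \<Phi> (xs ! i) (xs ! j))"

definition kernel_vec :: "(real \<Rightarrow> real \<Rightarrow> real) \<Rightarrow> real list \<Rightarrow> real \<Rightarrow> real Matrix.vec" where
  "kernel_vec \<Phi> xs x = Matrix.vec (length xs) (\<lambda>i. \<Phi> x (xs ! i))"

text \<open>If the regularized matrix is singular, the value is unspecified.\<close>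

definition kernel_interp ::
    "(real \<Rightarrow> real \<Rightarrow> real) \<Rightarrow> real \<Rightarrow> real list \<Rightarrow> (real \<Rightarrow> real) \<Rightarrow> real \<Rightarrow> real" where
  "kernel_interp \<Phi> l xs f x =
     scalar_prod (kernel_vec \<Phi> xs x)
       (the (mat_inverse (kernel_mat \<Phi> xs + l \<cdot>\<^sub>m 1\<^sub>m (length xs))) *\<^sub>v
        Matrix.vec (length xs) (\<lambda>i. f (xs ! i)))"

definition fill_distance :: "real list \<Rightarrow> real" where
  "fill_distance xs = (SUP x\<in>Omega. infdist x (set xs))"

text \<open>Meaningful for at least two points only; for fewer the minimum is over the empty set.\<close>

definition separation_radius :: "real list \<Rightarrow> real" where
  "separation_radius xs =
     Min {\<bar>x - z\<bar> / 2 | x z. x \<in> set xs \<and> z \<in> set xs \<and> x \<noteq> z}"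

definition quasi_uniform :: "real list set \<Rightarrow> bool" where
  "quasi_uniform D \<longleftrightarrow>
     (\<exists>\<rho>. \<forall>xs\<in>D. fill_distance xs / separation_radius xs \<le> \<rho>)"

text \<open>The parameter choice \<open>\<surd>\<lambda> \<asymp> \<surd>h\<close> with explicit constants.\<close>

definition param_choice :: "real \<Rightarrow> real \<Rightarrow> real list \<Rightarrow> real \<Rightarrow> bool" where
  "param_choice c1 c2 xs l \<longleftrightarrow> l \<ge> 0 \<and>
     c1 * sqrt (fill_distance xs) \<le> sqrt l \<and> sqrt l \<le> c2 * sqrt (fill_distance xs)"

end

theory Submission
  imports Defs "Jordan_Normal_Form.Determinant"
begin

text \<open>The regularized interpolant \<open>v\<close> of \<open>f\<close> minimizes the functional
  \<open>\<Sum>\<^sub>j (v(x\<^sub>j) - f(x\<^sub>j))\<^sup>2 + \<lambda> \<parallel>v\<parallel>\<^sup>2\<close>, with the \<open>H\<^sup>1\<close> norm, over the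
  finite element space. Comparing it with a finite element function \<open>w\<close> that approximates \<open>f\<close> on
  the design and satisfies \<open>\<parallel>w\<parallel> \<le> C \<parallel>f\<parallel>\<close> bounds both the residuals of \<open>v\<close> on the design and
  its \<open>H\<^sup>1\<close> norm, because \<open>\<lambda>\<close> is comparable to the fill distance \<open>h\<close>. The one-dimensional
  sampling inequality \<open>\<parallel>e\<parallel>\<^sup>2 \<le> 4 h (\<Sum>\<^sub>j e(x\<^sub>j)\<^sup>2 + h \<parallel>e'\<parallel>\<^sup>2)\<close> in \<open>L\<^sup>2\<close>, and its supremum
  analogue, applied to \<open>e = f - v\<close>, give the rates. In general \<open>w\<close> consists of Taylor polynomials
  with a linear correction on each element. If \<open>1/N\<close> is below the separation radius, \<open>w\<close> can be a
  piecewise linear function that agrees with \<open>f\<close> on the design, which removes the residual term.\<close>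

subsection \<open>Test functions\<close>

text \<open>Taking \<open>l\<close> comparable to the fill distance \<open>h\<close> matches two
  combinations. For \<open>e = F - v\<close>, sampling produces \<open>h * (X + h * Z)\<close>,
  where \<open>X\<close> is the misfit on the design and \<open>Z\<close> the squared norm of
  \<open>e'\<close>; minimality bounds \<open>X + l * V\<close>, where \<open>V\<close> is the
  squared norm of the derivative of \<open>v\<close>. With \<open>l\<close> of order
  \<open>h\<close> the second controls the first. Uniformity in \<open>N\<close> comes from the
  eigenbasis: it diagonalizes both the L^2 product and the Dirichlet form, so the kernel weights
  \<open>inverse (1 + \<mu> i)\<close> invert the H^1 weights exactly, and nothing about the
  eigenvalues enters beyond their sign. The obstacle is that Sobolev functions are given by weak
  derivatives against test functions, whereas sampling and Taylor expansion need point values. The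
  fundamental lemma and the du Bois-Reymond lemma bridge this gap by producing absolutely continuous
  representatives; the predicate \<open>primitive\<close> then carries all estimates, with
  increments of \<open>u\<close> expressed as integrals of a square-integrable
  \<open>g\<close>.\<close>

definition smooth :: "(real \<Rightarrow> real) \<Rightarrow> bool" where
  "smooth \<phi> \<longleftrightarrow> (\<forall>k x. (deriv ^^ k) \<phi> differentiable (at x))"

text \<open>Coinduction: instead of formulas for iterated derivatives, only a class of
  differentiable functions that is closed under \<open>deriv\<close> has to be found.\<close>

lemma smooth_coinduct:
  assumes "A \<phi>" and step: "\<And>f. A f \<Longrightarrow> A (deriv f) \<and> (\<forall>x. f differentiable (at x))"
  shows "smooth \<phi>"
proof -
  have "A ((deriv ^^ k) \<phi>)" for k
    by (induction k) (auto simp: assms)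
  then show ?thesis
    using step by (auto simp: smooth_def)
qed

lemma smooth_differentiable: "smooth f \<Longrightarrow> f differentiable (at x)"
  unfolding smooth_def by (metis funpow_0)

lemma smooth_deriv: "smooth f \<Longrightarrow> smooth (deriv f)"
  unfolding smooth_def by (metis comp_apply funpow_Suc_right)

lemma smooth_DERIV: "smooth f \<Longrightarrow> (f has_real_derivative deriv f x) (at x)"
  using smooth_differentiable DERIV_deriv_iff_real_differentiable by blast

lemma smooth_continuous_on: "smooth f \<Longrightarrow> continuous_on S f"
  by (meson DERIV_isCont continuous_at_imp_continuous_on smooth_DERIV)

lemma smoothI_deriv:
  assumes "\<And>x. (f has_real_derivative f' x) (at x)" "smooth f'"
  shows "smooth f"
proof (rule smooth_coinduct[where A="\<lambda>g. g = f \<or> smooth g"])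
  have "deriv f = f'"
    using assms(1) by (auto intro: DERIV_imp_deriv)
  then show "(deriv g = f \<or> smooth (deriv g)) \<and> (\<forall>x. g differentiable (at x))"
    if "g = f \<or> smooth g" for g
    using that assms smooth_deriv smooth_differentiable real_differentiable_def by blast
qed auto

text \<open>The coinduction invariant for products: the product rule turns one product into a sum of
  two, so products alone are not closed under \<open>deriv\<close>, but their finite sums
  are.\<close>

inductive product_sum :: "(real \<Rightarrow> real) \<Rightarrow> bool" where
  prod: "smooth f \<Longrightarrow> smooth g \<Longrightarrow> product_sum (\<lambda>x. f x * g x)"
| sum: "product_sum f \<Longrightarrow> product_sum g \<Longrightarrow> product_sum (\<lambda>x. f x + g x)"

lemma product_sum_deriv:
  "product_sum f \<Longrightarrow> \<exists>f'. product_sum f' \<and> (\<forall>x. (f has_real_derivative f' x) (at x))"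
proof (induction rule: product_sum.induct)
  case (prod f g)
  have "((\<lambda>x. f x * g x) has_real_derivative (f x * deriv g x + deriv f x * g x)) (at x)" for x
    using DERIV_mult[OF smooth_DERIV[OF prod(1), of x] smooth_DERIV[OF prod(2), of x]]
    by (simp add: algebra_simps)
  moreover have "product_sum (\<lambda>x. f x * deriv g x + deriv f x * g x)"
    by (intro product_sum.intros prod smooth_deriv)
  ultimately show ?case by blast
next
  case (sum f g)
  then obtain f' g' where "product_sum f'" "\<And>x. (f has_real_derivative f' x) (at x)"
    "product_sum g'" "\<And>x. (g has_real_derivative g' x) (at x)"
    by blast
  then show ?case
    by (intro exI[of _ "\<lambda>x. f' x + g' x"]) (auto intro: product_sum.sum DERIV_add)
qed

lemma product_sum_smooth: "product_sum f \<Longrightarrow> smooth f"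
proof (erule smooth_coinduct)
  fix f assume "product_sum f"
  then obtain f' where f': "product_sum f'" "\<And>x. (f has_real_derivative f' x) (at x)"
    using product_sum_deriv by blast
  then have "deriv f = f'"
    by (auto intro: DERIV_imp_deriv)
  then show "product_sum (deriv f) \<and> (\<forall>x. f differentiable (at x))"
    using f' real_differentiable_def by blast
qed

lemma smooth_mult: "smooth f \<Longrightarrow> smooth g \<Longrightarrow> smooth (\<lambda>x. f x * g x)"
  by (rule product_sum_smooth) (rule product_sum.prod)

lemma smooth_const: "smooth (\<lambda>x. c)"
proof (rule smooth_coinduct[where A="\<lambda>f. \<exists>c. f = (\<lambda>x. c)"])
  show "(\<exists>c. deriv f = (\<lambda>x. c)) \<and> (\<forall>x. f differentiable (at x))"
    if "\<exists>c. f = (\<lambda>x::real. c)" for f :: "real \<Rightarrow> real"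
    using that by (auto intro!: exI[of _ 0])
qed auto

lemma smooth_add:
  assumes "smooth f" "smooth g" shows "smooth (\<lambda>x. f x + g x)"
proof -
  have "product_sum (\<lambda>x. f x * 1 + g x * 1)"
    by (intro product_sum.sum product_sum.prod assms smooth_const)
  then show ?thesis using product_sum_smooth by simp
qed

lemma smooth_cmult: "smooth f \<Longrightarrow> smooth (\<lambda>x. c * f x)"
  by (intro smooth_mult smooth_const)

lemma smooth_affine:
  assumes "smooth f" shows "smooth (\<lambda>x. f (a * x + b))"
\<comment> \<open>Each differentiation produces a factor \<open>a\<close> by the chain rule; the
  free scalar \<open>c\<close> in the invariant absorbs it.\<close>
proof (rule smooth_coinduct[where A="\<lambda>g. \<exists>f c. smooth f \<and> g = (\<lambda>x. c * f (a * x + b))"])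
  show "\<exists>f' c. smooth f' \<and> (\<lambda>x. f (a * x + b)) = (\<lambda>x. c * f' (a * x + b))"
    using assms by (intro exI[of _ f] exI[of _ 1]) auto
  fix g assume "\<exists>f c. smooth f \<and> g = (\<lambda>x. c * f (a * x + b))"
  then obtain f c where f: "smooth f" "g = (\<lambda>x. c * f (a * x + b))" by blast
  have D: "(g has_real_derivative c * a * deriv f (a * x + b)) (at x)" for x
    unfolding f(2)
    by (auto intro!: derivative_eq_intros DERIV_chain2[OF smooth_DERIV[OF f(1)]])
  then have "deriv g = (\<lambda>x. c * a * deriv f (a * x + b))"
    by (auto intro: DERIV_imp_deriv)
  then show "(\<exists>f c. smooth f \<and> deriv g = (\<lambda>x. c * f (a * x + b))) \<and> (\<forall>x. g differentiable (at x))"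
    using D smooth_deriv[OF f(1)] real_differentiable_def by blast
qed

section \<open>Bump functions built from exp(-1/x)\<close>

definition flat_exp :: "real poly \<Rightarrow> real \<Rightarrow> real" where
  "flat_exp P x = (if x > 0 then poly P (1 / x) * exp (- (1 / x)) else 0)"

lemma poly_times_exp_minus: "((\<lambda>y::real. poly P y * exp (- y)) \<longlongrightarrow> 0) at_top"
proof -
  have "((\<lambda>y::real. \<Sum>i\<le>degree P. coeff P i * (y ^ i / exp y)) \<longlongrightarrow> (\<Sum>i\<le>degree P. coeff P i * 0)) at_top"
    by (intro tendsto_intros tendsto_power_div_exp_0)
  then show ?thesis
    by (simp add: poly_altdef exp_minus divide_inverse sum_distrib_right mult.assoc)
qed

text \<open>With y = 1/x, differentiation in x is -y^2 times differentiation in y, so P(y) exp(-y)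
  becomes y^2 (P - P')(y) exp(-y); \<open>[:0,0,1:]\<close> is y^2. The polynomial parameter is what
  closes the family under \<open>deriv\<close>.\<close>

lemma DERIV_flat_exp:
  "(flat_exp P has_real_derivative flat_exp ([:0,0,1:] * (P - pderiv P)) x) (at x)"
proof -
  consider "x < 0" | "x = 0" | "x > 0" by linarith
  then show ?thesis
  proof cases
    case 1
    have "((\<lambda>x. 0) has_real_derivative 0) (at x)" by simp
    then have "(flat_exp P has_real_derivative 0) (at x)"
      by (rule has_field_derivative_transform_within_open[of _ _ _ "{..<0}"])
         (use 1 in \<open>auto simp: flat_exp_def\<close>)
    then show ?thesis using 1 by (simp add: flat_exp_def)
  next
    case 3
    have "((\<lambda>x. poly P (1 / x) * exp (- (1 / x))) has_real_derivative
        flat_exp ([:0,0,1:] * (P - pderiv P)) x) (at x)"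
      using 3 by (auto intro!: derivative_eq_intros DERIV_chain2[OF poly_DERIV]
          simp: flat_exp_def field_simps power2_eq_square)
    then show ?thesis
      by (rule has_field_derivative_transform_within_open[of _ _ _ "{0<..}"])
         (use 3 in \<open>auto simp: flat_exp_def\<close>)
  next
    case 2
    have "filterlim (\<lambda>x::real. 1 / x) at_top (at_right 0)"
      using filterlim_inverse_at_top_right by (simp add: inverse_eq_divide)
    \<comment> \<open>At 0 the difference quotient divides by h, that is, it multiplies P by y =
      1/h; the exponential still wins.\<close>
    then have "((\<lambda>h. poly ([:0,1:] * P) (1 / h) * exp (- (1 / h))) \<longlongrightarrow> 0) (at_right 0)"
      using filterlim_compose[OF poly_times_exp_minus] by blast
    then have R: "((\<lambda>h. flat_exp P h / h) \<longlongrightarrow> 0) (at_right 0)"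
      by (rule Lim_transform_eventually)
         (auto simp: flat_exp_def eventually_at_right_field intro!: exI[of _ 1])
    have "((\<lambda>h. 0) \<longlongrightarrow> (0::real)) (at_left 0)" by simp
    then have L: "((\<lambda>h. flat_exp P h / h) \<longlongrightarrow> 0) (at_left 0)"
      by (rule Lim_transform_eventually)
         (auto simp: flat_exp_def eventually_at_left_field intro!: exI[of _ "-1"])
    have "((\<lambda>h. flat_exp P h / h) \<longlongrightarrow> 0) (at 0)"
      using L R filterlim_split_at by blast
    then show ?thesis
      using 2 by (simp add: DERIV_def flat_exp_def)
  qed
qed

lemma smooth_flat_exp: "smooth (flat_exp P)"
proof (rule smooth_coinduct[where A="\<lambda>f. \<exists>P. f = flat_exp P"])
  fix f assume "\<exists>P. f = flat_exp P"
  then obtain P where f: "f = flat_exp P" by blast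
  then have "deriv f = flat_exp ([:0,0,1:] * (P - pderiv P))"
    using DERIV_flat_exp by (auto intro: DERIV_imp_deriv)
  then show "(\<exists>P. deriv f = flat_exp P) \<and> (\<forall>x. f differentiable (at x))"
    using DERIV_flat_exp real_differentiable_def f by blast
qed blast

text \<open>Written with affine arguments, so that smoothness follows by composition.\<close>

definition bump :: "real \<Rightarrow> real \<Rightarrow> nat \<Rightarrow> real \<Rightarrow> real" where
  "bump a b k x = flat_exp 1 (real (Suc k) * x + (- real (Suc k) * a))
     * flat_exp 1 (- real (Suc k) * x + real (Suc k) * b)"

lemma smooth_bump: "smooth (bump a b k)"
  unfolding bump_def by (intro smooth_mult smooth_affine smooth_flat_exp)

lemma bump_altdef:
  "bump a b k x = flat_exp 1 (real (Suc k) * (x - a)) * flat_exp 1 (real (Suc k) * (b - x))"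
proof -
  have "real (Suc k) * x + - real (Suc k) * a = real (Suc k) * (x - a)"
    "- real (Suc k) * x + real (Suc k) * b = real (Suc k) * (b - x)"
    by (simp_all add: algebra_simps)
  then show ?thesis unfolding bump_def by simp
qed

lemma bump_eq_0: "x \<le> a \<or> b \<le> x \<Longrightarrow> bump a b k x = 0"
  by (auto simp: bump_altdef flat_exp_def zero_less_mult_iff simp del: of_nat_Suc)

lemma bump_eq:
  assumes "a < x" "x < b"
  shows "bump a b k x = exp (- (1 / (real (Suc k) * (x - a)))) * exp (- (1 / (real (Suc k) * (b - x))))"
proof -
  have p: "real (Suc k) * (x - a) > 0" "real (Suc k) * (b - x) > 0" using assms by auto
  show ?thesis
    unfolding bump_altdef flat_exp_def using p by (simp del: of_nat_Suc)
qed

lemma bump_nonneg: "0 \<le> bump a b k x"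
  by (auto simp: bump_def flat_exp_def)

lemma bump_le_1: "bump a b k x \<le> 1"
proof -
  have "flat_exp 1 y \<le> 1" "flat_exp 1 y \<ge> 0" for y
    by (auto simp: flat_exp_def)
  then show ?thesis
    unfolding bump_def by (intro mult_le_one) auto
qed

text \<open>The exponents shrink like 1/(k+1), so both factors tend to 1 inside the interval.
  Indicators of open intervals thereby become bounded limits of test functions.\<close>

lemma bump_tendsto: "(\<lambda>k. bump a b k x) \<longlonglongrightarrow> indicator {a<..<b} x"
proof (cases "a < x \<and> x < b")
  case True
  have "(\<lambda>k. exp (- (inverse (real (Suc k)) * inverse (x - a))) * exp (- (inverse (real (Suc k)) * inverse (b - x))))
     \<longlonglongrightarrow> exp (- (0 * inverse (x - a))) * exp (- (0 * inverse (b - x)))"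
    by (intro tendsto_intros LIMSEQ_inverse_real_of_nat)
  with True show ?thesis
    by (simp add: bump_eq divide_inverse del: of_nat_Suc)
next
  case False
  then have "bump a b k x = 0" for k
    by (intro bump_eq_0) auto
  with False show ?thesis by simp
qed

lemma test_functionsI:
  assumes "smooth \<phi>" "0 < a" "b < 1" "\<And>x. x < a \<or> b < x \<Longrightarrow> \<phi> x = 0"
  shows "\<phi> \<in> test_functions"
proof -
  have "closure {x. \<phi> x \<noteq> 0} \<subseteq> {a..b}"
    using assms(4) by (intro closure_minimal) (auto simp: not_less[symmetric])
  then show ?thesis
    using assms by (force simp: test_functions_def smooth_def)
qed

lemma test_functionsE:
  assumes "\<phi> \<in> test_functions"
  obtains a b where "smooth \<phi>" "0 < a" "a < b" "b < 1" "\<And>x. x \<le> a \<or> b \<le> x \<Longrightarrow> \<phi> x = 0"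
proof -
  have s: "smooth \<phi>" and c: "closure {x. \<phi> x \<noteq> 0} \<subseteq> {0<..<1}"
    using assms unfolding test_functions_def smooth_def by simp_all
  let ?K = "closure {x. \<phi> x \<noteq> 0}"
  have "bounded {x. \<phi> x \<noteq> 0}"
    by (rule bounded_subset[OF bounded_box[of 0 "1::real", unfolded box_real] order_trans[OF closure_subset c]])
  then have K: "compact ?K" by (simp add: compact_eq_bounded_closed bounded_closure)
  show ?thesis
  proof (cases "?K = {}")
    case True
    then have "\<phi> x = 0" for x by (simp add: closure_eq_empty)
    then show ?thesis using that[of "1/3" "2/3"] s by auto
  next
    case False
    obtain a where a: "a \<in> ?K" "\<And>x. x \<in> ?K \<Longrightarrow> a \<le> x"
      using compact_attains_inf[OF K False] by auto
    obtain b where b: "b \<in> ?K" "\<And>x. x \<in> ?K \<Longrightarrow> x \<le> b"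
      using compact_attains_sup[OF K False] by auto
    \<comment> \<open>Moving both ends of the support halfway towards 0 and 1 leaves a nondegenerate
      interval that still avoids the boundary, with \<open>\<phi>\<close> zero at its ends as
      well.\<close>
    have "\<phi> x = 0" if "x \<le> a / 2 \<or> (b+1)/2 \<le> x" for x
    proof (rule ccontr)
      assume "\<phi> x \<noteq> 0"
      then have "x \<in> ?K" by (intro subsetD[OF closure_subset]) simp
      then have "a \<le> x" "x \<le> b" "a > 0" "b < 1" using a b subsetD[OF c a(1)] subsetD[OF c b(1)] by simp_all
      with that show False by (auto simp: field_simps)
    qed
    moreover have "0 < a" "a \<le> b" "b < 1" using a(1) b(2)[OF a(1)] subsetD[OF c a(1)] subsetD[OF c b(1)] by simp_all
    ultimately show ?thesis using that[of "a/2" "(b+1)/2"] s by force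
  qed
qed

lemma bump_test: "0 < a \<Longrightarrow> b < 1 \<Longrightarrow> bump a b k \<in> test_functions"
  by (rule test_functionsI[of _ a b]) (auto simp: smooth_bump bump_eq_0)

lemma deriv_test:
  assumes "\<phi> \<in> test_functions" shows "deriv \<phi> \<in> test_functions"
proof -
  obtain a b where ab: "smooth \<phi>" "0 < a" "a < b" "b < 1" and z: "\<And>x. x \<le> a \<or> b \<le> x \<Longrightarrow> \<phi> x = 0"
    using test_functionsE[OF assms] by metis
  have "deriv \<phi> x = 0" if x: "x < a \<or> b < x" for x
  proof -
    have "((\<lambda>x. 0) has_real_derivative 0) (at x)" by simp
    then have "(\<phi> has_real_derivative 0) (at x)"
      by (rule has_field_derivative_transform_within_open[of _ _ _ "{..<a} \<union> {b<..}"])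
         (use x z in auto)
    then show ?thesis by (rule DERIV_imp_deriv)
  qed
  then show ?thesis
    using ab by (intro test_functionsI[of _ a b] smooth_deriv)
qed

subsection \<open>Weak derivatives\<close>

abbreviation "leb \<equiv> lebesgue_on Omega"

text \<open>Passing to the closed interval changes only the null set of its two endpoints; it makes
  the gauge integral on \<open>{0..1}\<close> available for Bochner integrals over
  \<open>leb\<close>.\<close>

lemma leb_integrable_iff:
  fixes g :: "real \<Rightarrow> real"
  shows "integrable leb g \<longleftrightarrow> g absolutely_integrable_on {0..1}"
proof -
  have "g absolutely_integrable_on {0..1} \<longleftrightarrow> g absolutely_integrable_on {0<..<1}"
  proof (rule absolutely_integrable_spike_set_eq)
    show "negligible {x \<in> {0..1} - {0<..<1}. g x \<noteq> 0}"
      by (rule negligible_subset[of "{0,1}"]) auto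
    show "negligible {x \<in> {0<..<1} - {0..1}. g x \<noteq> 0}"
      by (rule negligible_subset[of "{}"]) auto
  qed
  then show ?thesis
    by (simp add: integrable_restrict_space set_integrable_def)
qed

lemma leb_integral_eq:
  fixes g :: "real \<Rightarrow> real"
  assumes "integrable leb g" shows "(LINT x|leb. g x) = integral {0..1} g"
proof -
  have "(LINT x|leb. g x) = integral {0<..<1} g"
    using assms by (intro lebesgue_integral_eq_integral) auto
  then show ?thesis by (simp add: integral_open_interval_real)
qed

lemma leb_integrable_on:
  fixes g :: "real \<Rightarrow> real"
  assumes "integrable leb g" "0 \<le> a" "b \<le> 1"
  shows "g integrable_on {a..b}"
proof -
  have "g integrable_on {0..1}"
    using assms(1) leb_integrable_iff set_lebesgue_integral_eq_integral(1) by blast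
  then show ?thesis
    by (rule integrable_on_subinterval) (use assms in auto)
qed

lemma space_leb [simp]: "space leb = {0<..<1}"
  by (simp add: space_restrict_space)

lemma borel_imp_leb_measurable: "f \<in> borel_measurable borel \<Longrightarrow> f \<in> borel_measurable leb"
  by (intro measurable_restrict_space1 measurable_completion) simp

lemma continuous_imp_leb_measurable:
  fixes f :: "real \<Rightarrow> real"
  assumes "continuous_on Omega f" shows "f \<in> borel_measurable leb"
  using assms by (intro continuous_imp_measurable_on_sets_lebesgue) auto

lemma finite_measure_leb: "finite_measure leb"
  by (intro finite_measure_lebesgue_on) (simp add: bounded_set_imp_lmeasurable)

lemma leb_integrable_bounded:
  fixes f :: "real \<Rightarrow> real"
  assumes "f \<in> borel_measurable leb" "\<And>x. x \<in> Omega \<Longrightarrow> \<bar>f x\<bar> \<le> B"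
  shows "integrable leb f"
  using assms by (intro finite_measure.integrable_const_bound[OF finite_measure_leb, of f B]) auto

lemma leb_indicator_integral:
  fixes g :: "real \<Rightarrow> real"
  assumes "integrable leb g" "0 \<le> a" "b \<le> 1"
  shows "integrable leb (\<lambda>x. indicator {a..b} x * g x)"
    "(LINT x|leb. indicator {a..b} x * g x) = integral {a..b} g"
proof -
  have m: "indicator {a..b} \<in> borel_measurable leb"
    by (intro borel_imp_leb_measurable) simp
  show i: "integrable leb (\<lambda>x. indicator {a..b} x * g x)"
    using m borel_measurable_integrable[OF assms(1)]
  proof (intro Bochner_Integration.integrable_bound[OF assms(1)] borel_measurable_times)
    show "AE x in leb. norm (indicator {a..b} x * g x) \<le> norm (g x)"
      by (intro AE_I2) (simp add: indicator_def)
  qed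
  have "(LINT x|leb. indicator {a..b} x * g x) = integral {0..1} (\<lambda>x. if x \<in> {a..b} then g x else 0)"
    unfolding leb_integral_eq[OF i] by (intro integral_cong) (auto simp: indicator_def)
  also have "\<dots> = integral ({0..1} \<inter> {a..b}) g"
    using integral_restrict_Int[of "{0..1}" "{a..b}" g] by (simp add: Int_commute)
  also have "{0..1} \<inter> {a..b} = {a..b}" using assms by auto
  finally show "(LINT x|leb. indicator {a..b} x * g x) = integral {a..b} g" .
qed

lemma L2_integrable:
  assumes "g \<in> L2_space" shows "integrable leb g"
proof (rule Bochner_Integration.integrable_bound)
  show "integrable leb (\<lambda>x. 1 + (g x)\<^sup>2)"
    using assms by (intro Bochner_Integration.integrable_add finite_measure.integrable_const[OF finite_measure_leb])
      (auto simp: L2_space_def)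
  show "g \<in> borel_measurable leb" using assms by (auto simp: L2_space_def)
  have "\<bar>y\<bar> \<le> 1 + y\<^sup>2" for y :: real
  proof -
    have "0 \<le> (\<bar>y\<bar> - 1/2)\<^sup>2" by simp
    then show ?thesis by (auto simp: power2_eq_square algebra_simps abs_mult_self_eq)
  qed
  then show "AE x in leb. norm (g x) \<le> norm (1 + (g x)\<^sup>2)"
    by (intro AE_I2) (auto intro: order_trans)
qed

lemma L2_mult_integrable:
  assumes "f \<in> L2_space" "g \<in> L2_space" shows "integrable leb (\<lambda>x. f x * g x)"
proof (rule Bochner_Integration.integrable_bound)
  show "integrable leb (\<lambda>x. (f x)\<^sup>2 + (g x)\<^sup>2)"
    using assms by (auto simp: L2_space_def)
  show "(\<lambda>x. f x * g x) \<in> borel_measurable leb" using assms by (auto simp: L2_space_def)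
  have "\<bar>a * b\<bar> \<le> a\<^sup>2 + b\<^sup>2" for a b :: real
  proof -
    have "0 \<le> (\<bar>a\<bar> - \<bar>b\<bar>)\<^sup>2" by simp
    then have "2 * \<bar>a * b\<bar> \<le> a\<^sup>2 + b\<^sup>2"
      by (simp add: power2_eq_square algebra_simps abs_mult)
    then show ?thesis using abs_ge_zero[of "a * b"] by linarith
  qed
  then show "AE x in leb. norm (f x * g x) \<le> norm ((f x)\<^sup>2 + (g x)\<^sup>2)"
    by (intro AE_I2) (auto intro: order_trans)
qed

lemma L2_add:
  assumes "f \<in> L2_space" "g \<in> L2_space" shows "(\<lambda>x. f x + g x) \<in> L2_space"
proof -
  have "integrable leb (\<lambda>x. (f x)\<^sup>2 + (g x)\<^sup>2 + 2 * (f x * g x))"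
    using assms by (intro Bochner_Integration.integrable_add integrable_mult_right L2_mult_integrable)
      (auto simp: L2_space_def)
  then show ?thesis
    using assms by (auto simp: L2_space_def power2_sum algebra_simps)
qed

lemma L2_cmult: "f \<in> L2_space \<Longrightarrow> (\<lambda>x. c * f x) \<in> L2_space"
  by (auto simp: L2_space_def power_mult_distrib)

lemma L2_const: "(\<lambda>x. c) \<in> L2_space"
  using finite_measure.integrable_const[OF finite_measure_leb] by (auto simp: L2_space_def)

lemma L2_diff:
  assumes "f \<in> L2_space" "g \<in> L2_space" shows "(\<lambda>x. f x - g x) \<in> L2_space"
  using L2_add[OF assms(1) L2_cmult[OF assms(2), of "-1"]] by simp

lemma L2_sum:
  assumes "\<And>i. i \<in> I \<Longrightarrow> f i \<in> L2_space" shows "(\<lambda>x. \<Sum>i\<in>I. f i x) \<in> L2_space"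
  using assms
proof (induction I rule: infinite_finite_induct)
  case (insert i I)
  then show ?case using L2_add[of "f i" "\<lambda>x. \<Sum>i\<in>I. f i x"] by simp
qed (use L2_const[of 0] in auto)

section \<open>The fundamental lemma and the du Bois-Reymond lemma\<close>

lemma locally_integrableI:
  assumes "integrable leb g" shows "locally_integrable g"
  unfolding locally_integrable_def
proof clarify
  fix K :: "real set" assume K: "compact K" "K \<subseteq> Omega"
  have "set_integrable lebesgue Omega g"
    using assms by (simp add: integrable_restrict_space set_integrable_def)
  then show "set_integrable lebesgue K g"
    by (rule set_integrable_subset) (use K in \<open>auto simp: compact_imp_closed borel_closed\<close>)
qed

lemma locally_integrable_diff:
  assumes "locally_integrable f" "locally_integrable g"
  shows "locally_integrable (\<lambda>x. f x - g x)"
  using assms unfolding locally_integrable_def by (auto intro: set_integral_diff)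

lemma locally_integrable_on:
  assumes "locally_integrable u" "0 < a" "b < 1"
  shows "set_integrable lebesgue {a..b} u"
proof -
  have "{a..b} \<subseteq> Omega" using assms by (meson atLeastAtMost_iff greaterThanLessThan_iff less_le_trans le_less_trans subsetI)
  then show ?thesis using assms(1) by (simp add: locally_integrable_def)
qed

lemma test_mult_integrable:
  assumes u: "locally_integrable u" and \<phi>: "\<phi> \<in> test_functions"
  shows "integrable leb (\<lambda>x. u x * \<phi> x)"
proof -
  obtain a b where ab: "smooth \<phi>" "0 < a" "a < b" "b < 1" and z: "\<And>x. x \<le> a \<or> b \<le> x \<Longrightarrow> \<phi> x = 0"
    using test_functionsE[OF \<phi>] by metis
  have c: "continuous_on {a..b} \<phi>" using smooth_continuous_on ab by blast
  have "(\<lambda>x. \<phi> x * u x) absolutely_integrable_on {a..b}"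
  proof (rule absolutely_integrable_bounded_measurable_product_real)
    show "\<phi> \<in> borel_measurable (lebesgue_on {a..b})"
      using c by (intro continuous_imp_measurable_on_sets_lebesgue) auto
    show "bounded (\<phi> ` {a..b})"
      using compact_continuous_image[OF c] compact_imp_bounded by auto
    show "set_integrable lebesgue {a..b} u" using locally_integrable_on u ab by blast
  qed auto
  then have "(\<lambda>x. \<phi> x * u x) absolutely_integrable_on {0..1}"
    by (rule absolutely_integrable_spike_set)
       (use ab z in \<open>auto intro!: negligible_subset[of "{}"]\<close>)
  then show ?thesis
    unfolding leb_integrable_iff by (simp add: mult.commute)
qed

lemma L2_inner_test_diff:
  assumes "locally_integrable u" "locally_integrable v" "\<phi> \<in> test_functions"
  shows "L2_inner (\<lambda>x. u x - v x) \<phi> = L2_inner u \<phi> - L2_inner v \<phi>"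
  unfolding L2_inner_def
  using test_mult_integrable[OF assms(1,3)] test_mult_integrable[OF assms(2,3)]
  by (simp add: left_diff_distrib)

text \<open>Bumps converge boundedly to the indicator of the interval, so dominated convergence
  transfers orthogonality from test functions to indicators.\<close>

lemma integral_eq_0_if_orthogonal:
  assumes u: "locally_integrable u" and 0: "\<And>\<phi>. \<phi> \<in> test_functions \<Longrightarrow> L2_inner u \<phi> = 0"
    and ab: "0 < a" "b < 1"
  shows "integral {a..b} u = 0"
proof -
  have si: "set_integrable lebesgue {a..b} u" using locally_integrable_on u ab by blast
  \<comment> \<open>\<open>u\<close> may fail to be integrable up to 0 and 1. Cut off to
    \<open>{a..b}\<close>, where the bumps live anyway, it supplies an integrable dominating
    function.\<close>
  have "integrable lebesgue (\<lambda>x. indicator {a..b} x * u x)"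
    using si by (simp add: set_integrable_def)
  then have iu: "integrable leb (\<lambda>x. indicator {a..b} x * u x)"
    by (subst integrable_restrict_space) (simp, rule integrable_mult_indicator, simp_all)
  have "(\<lambda>k. LINT x|leb. indicator {a..b} x * u x * bump a b k x)
     \<longlonglongrightarrow> (LINT x|leb. indicator {a..b} x * u x * indicator {a<..<b} x)"
  proof (rule integral_dominated_convergence)
    show "integrable leb (\<lambda>x. \<bar>indicator {a..b} x * u x\<bar>)" using iu by (rule integrable_abs)
    show "(\<lambda>x. indicator {a..b} x * u x * indicator {a<..<b} x) \<in> borel_measurable leb"
      by (intro borel_measurable_times borel_measurable_integrable[OF iu] borel_imp_leb_measurable) simp
    show "(\<lambda>x. indicator {a..b} x * u x * bump a b k x) \<in> borel_measurable leb" for k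
      by (intro borel_measurable_times borel_measurable_integrable[OF iu] continuous_imp_leb_measurable
          smooth_continuous_on smooth_bump)
    show "AE x in leb. (\<lambda>k. indicator {a..b} x * u x * bump a b k x)
        \<longlonglongrightarrow> indicator {a..b} x * u x * indicator {a<..<b} x"
      by (intro AE_I2 tendsto_mult tendsto_const bump_tendsto)
    show "AE x in leb. norm (indicator {a..b} x * u x * bump a b k x) \<le> \<bar>indicator {a..b} x * u x\<bar>" for k
      using bump_nonneg bump_le_1 by (intro AE_I2) (auto simp: abs_mult mult_left_le)
  qed
  moreover have "(LINT x|leb. indicator {a..b} x * u x * bump a b k x) = 0" for k
  proof -
    have *: "indicator {a..b} x * u x * bump a b k x = u x * bump a b k x" for x
      using bump_eq_0[of x a b k] by (cases "x \<le> a \<or> b \<le> x") (auto simp: indicator_def)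
    then show ?thesis
      unfolding * using 0[OF bump_test[OF ab]] by (simp only: L2_inner_def)
  qed
  ultimately have L0: "(LINT x|leb. indicator {a..b} x * u x * indicator {a<..<b} x) = 0"
    by (simp add: LIMSEQ_const_iff)
  have "integrable leb (\<lambda>x. indicator {a..b} x * u x * indicator {a<..<b} x)"
    using ab by (intro integrable_real_mult_indicator iu) (auto simp: sets_restrict_space_iff)
  from leb_integral_eq[OF this]
  have z: "integral {0..1} (\<lambda>x. indicator {a..b} x * u x * indicator {a<..<b} x) = 0"
    using L0 by simp
  have "integral {0..1} (\<lambda>x. indicator {a..b} x * u x * indicator {a<..<b} x)
      = integral {0..1} (\<lambda>x. if x \<in> {a<..<b} then u x else 0)"
    by (intro integral_cong) (auto simp: indicator_def)
  also have "\<dots> = integral ({0..1} \<inter> {a<..<b}) u"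
    using integral_restrict_Int[of "{0..1}" "{a<..<b}" u] by (simp add: Int_commute)
  also have "{0..1} \<inter> {a<..<b} = {a<..<b}" using ab by auto
  finally show ?thesis using z by (simp add: integral_open_interval_real)
qed

text \<open>Lebesgue differentiation: almost everywhere \<open>u x\<close> is the limit of its
  averages over \<open>{x..x+h}\<close>, all of which vanish.\<close>

lemma AE_eq_0_if_integral_eq_0:
  fixes u :: "real \<Rightarrow> real"
  assumes ui: "\<And>a b. 0 < a \<Longrightarrow> b < 1 \<Longrightarrow> u integrable_on {a..b}"
    and u0: "\<And>a b. 0 < a \<Longrightarrow> b < 1 \<Longrightarrow> integral {a..b} u = 0"
  shows "AE x in leb. u x = 0"
proof -
  have *: "\<exists>N. negligible N \<and> (\<forall>x\<in>{c<..<d} - N. u x = 0)" if cd: "0 < c" "d < 1" for c d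
  proof -
    define f where "f = (\<lambda>x. if x \<in> {c..d} then u x else 0)"
    have "f integrable_on cbox a b" for a b
      unfolding f_def using ui[OF cd]
      by (metis box_real(2) integrable_on_subcbox integrable_restrict_UNIV subset_UNIV)
    then obtain N where N: "negligible N"
       "\<And>x e. \<lbrakk>x \<notin> N; 0 < e\<rbrakk> \<Longrightarrow> \<exists>\<delta>>0. \<forall>h. 0 < h \<and> h < \<delta> \<longrightarrow>
                         norm(integral (cbox x (x + h *\<^sub>R One)) f /\<^sub>R h ^ DIM(real) - f x) < e"
      using integrable_ccontinuous_explicit[of f] by blast
    have "u x = 0" if x: "c < x" "x < d" "x \<notin> N" for x
    proof (rule ccontr)
      assume "u x \<noteq> 0"
      then obtain \<delta> where \<delta>: "\<delta> > 0" "\<And>h. 0 < h \<and> h < \<delta> \<Longrightarrow>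
          norm(integral (cbox x (x + h *\<^sub>R One)) f /\<^sub>R h ^ DIM(real) - f x) < \<bar>u x\<bar>"
        using N(2)[OF x(3), of "\<bar>u x\<bar>"] by auto
      define h where "h = min (\<delta> / 2) (d - x)"
      have h: "0 < h" "h < \<delta>" "x + h \<le> d" using \<delta> x by (auto simp: h_def)
      have "integral {x..x+h} f = integral {x..x+h} u"
        using h x by (intro integral_cong) (auto simp: f_def)
      also have "\<dots> = 0" using u0 h x cd by auto
      finally show False using \<delta>(2)[of h] h x by (auto simp: f_def)
    qed
    then show ?thesis using N(1) by auto
  qed
  \<comment> \<open>The open unit interval is exhausted by countably many compactly contained
    intervals, so the exceptional sets can be united.\<close>
  have "\<exists>N. negligible N \<and> (\<forall>x\<in>{1 / real (Suc n)<..<1 - 1 / real (Suc n)} - N. u x = 0)" for n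
    by (rule *) (auto simp del: of_nat_Suc)
  then obtain N where N: "\<And>n. negligible (N n)"
    "\<And>n x. x\<in>{1 / real (Suc n)<..<1 - 1 / real (Suc n)} - N n \<Longrightarrow> u x = 0"
    by metis
  have "u x = 0" if "x \<in> Omega" "x \<notin> (\<Union>n. N n)" for x
  proof -
    obtain n where "1 / real (Suc n) < min x (1 - x)"
      using reals_Archimedean[of "min x (1 - x)"] \<open>x \<in> Omega\<close> by (auto simp: inverse_eq_divide)
    then show ?thesis using N(2)[of x n] that by (auto simp del: of_nat_Suc)
  qed
  moreover have "negligible (\<Union>n. N n)"
    using N(1) by (intro negligible_countable_Union) auto
  ultimately show ?thesis
    by (auto simp: AE_restrict_space_iff eventually_ae_filter_negligible intro!: exI[of _ "\<Union>n. N n"])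
qed

lemma fundamental_lemma:
  assumes u: "locally_integrable u" and 0: "\<And>\<phi>. \<phi> \<in> test_functions \<Longrightarrow> L2_inner u \<phi> = 0"
  shows "AE x in leb. u x = 0"
proof (rule AE_eq_0_if_integral_eq_0)
  show "u integrable_on {a..b}" if "0 < a" "b < 1" for a b
    using locally_integrable_on[OF u that] by (rule set_lebesgue_integral_eq_integral(1))
qed (use integral_eq_0_if_orthogonal[OF assms] in blast)

lemma test_cmult: "\<phi> \<in> test_functions \<Longrightarrow> (\<lambda>x. c * \<phi> x) \<in> test_functions"
  by (erule test_functionsE, rule test_functionsI) (auto intro: smooth_cmult)

lemma test_add:
  assumes "\<phi> \<in> test_functions" "\<psi> \<in> test_functions"
  shows "(\<lambda>x. \<phi> x + \<psi> x) \<in> test_functions"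
proof -
  obtain a b where 1: "smooth \<phi>" "0 < a" "a < b" "b < 1" "\<And>x. x \<le> a \<or> b \<le> x \<Longrightarrow> \<phi> x = 0"
    using test_functionsE[OF assms(1)] by metis
  obtain a' b' where 2: "smooth \<psi>" "0 < a'" "a' < b'" "b' < 1" "\<And>x. x \<le> a' \<or> b' \<le> x \<Longrightarrow> \<psi> x = 0"
    using test_functionsE[OF assms(2)] by metis
  show ?thesis
    using 1 2 by (intro test_functionsI[of _ "min a a'" "max b b'"] smooth_add) auto
qed

lemma test_integrable: "\<phi> \<in> test_functions \<Longrightarrow> integrable leb \<phi>"
  using test_mult_integrable[OF locally_integrableI[OF L2_integrable[OF L2_const[of 1]]]] by simp

text \<open>Zero mean is exactly what makes the antiderivative from 0 vanish again to the right of
  the support.\<close>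

lemma test_antiderivative:
  assumes \<psi>: "\<psi> \<in> test_functions" and 0: "(LINT x|leb. \<psi> x) = 0"
  shows "\<exists>\<phi>\<in>test_functions. deriv \<phi> = \<psi>"
proof -
  obtain a b where ab: "smooth \<psi>" "0 < a" "a < b" "b < 1" and z: "\<And>x. x \<le> a \<or> b \<le> x \<Longrightarrow> \<psi> x = 0"
    using test_functionsE[OF \<psi>] by metis
  have c: "continuous_on S \<psi>" for S using smooth_continuous_on ab by blast
  have ii: "\<psi> integrable_on {x..y}" for x y
    using c by (intro integrable_continuous_real)
  have z0: "integral {x..y} \<psi> = 0" if "y \<le> a \<or> b \<le> x" for x y
    using that z by (intro integral_unique has_integral_is_0) auto
  define \<phi> where "\<phi> x = integral {0..x} \<psi>" for x
  have z2: "\<phi> x = 0" if "x \<le> a \<or> b \<le> x" for x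
  proof (cases "x \<le> a")
    case True then show ?thesis using z0 by (simp add: \<phi>_def)
  next
    case False
    then have "b \<le> x" using that by auto
    then have "\<phi> x = integral {0..b} \<psi> + integral {b..x} \<psi>"
      unfolding \<phi>_def using ab ii by (intro Henstock_Kurzweil_Integration.integral_combine[symmetric]) auto
    moreover have "integral {0..1} \<psi> = integral {0..b} \<psi> + integral {b..1} \<psi>"
      using ab ii by (intro Henstock_Kurzweil_Integration.integral_combine[symmetric]) auto
    moreover have "integral {0..1} \<psi> = 0"
      using 0 leb_integral_eq[OF test_integrable[OF \<psi>]] by simp
    ultimately show ?thesis using z0 by simp
  qed
  \<comment> \<open>The integral from 0 is differentiated only at interior points of an interval
    starting at 0; to the left of \<open>a\<close>, negative arguments included,
    \<open>\<phi>\<close> is zero near \<open>x\<close>.\<close>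
  have D: "(\<phi> has_real_derivative \<psi> x) (at x)" for x
  proof (cases "x < a")
    case True
    have "((\<lambda>x. 0) has_real_derivative 0) (at x)" by simp
    then have "(\<phi> has_real_derivative 0) (at x)"
      by (rule has_field_derivative_transform_within_open[of _ _ _ "{..<a}"])
         (use True z2 in auto)
    then show ?thesis using z True by simp
  next
    case False
    have "(\<phi> has_real_derivative \<psi> x) (at x within {0..x+1})"
      using integral_has_real_derivative[OF c, of x 0 "x+1"] False ab unfolding \<phi>_def by auto
    then show ?thesis
      using False ab by (subst (asm) at_within_interior) auto
  qed
  then have "deriv \<phi> = \<psi>" by (auto intro: DERIV_imp_deriv)
  moreover have "\<phi> \<in> test_functions"
    using ab z2 by (intro test_functionsI[of _ a b] smoothI_deriv[OF D]) auto
  ultimately show ?thesis by blast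
qed

text \<open>Otherwise the constant 1 would be orthogonal to all test functions, hence zero almost
  everywhere on a set of measure 1.\<close>

lemma exists_test_integral_ne_0:
  "\<exists>w\<in>test_functions. (LINT x|leb. w x) \<noteq> 0"
proof (rule ccontr)
  assume "\<not> (\<exists>w\<in>test_functions. (LINT x|leb. w x) \<noteq> 0)"
  then have "(LINT x|leb. w x) = 0" if "w \<in> test_functions" for w using that by blast
  then have "AE x in leb. (1::real) = 0"
    by (intro fundamental_lemma[of "\<lambda>x. 1"] locally_integrableI L2_integrable L2_const)
       (simp add: L2_inner_def)
  then have "AE x in leb. False" by simp
  then have "emeasure leb (space leb) = 0"
    unfolding ae_filter_eq_bot_iff[symmetric] eventually_False[symmetric] .
  then show False by (simp add: emeasure_restrict_space)
qed

text \<open>Modulo a multiple of one fixed \<open>w0\<close> with nonzero integral, every test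
  function has mean zero and is therefore the derivative of a test function. Orthogonality to
  derivatives then becomes orthogonality of \<open>u - c\<close> to everything, with
  \<open>c\<close> determined by testing against \<open>w0\<close>.\<close>

lemma du_Bois_Reymond:
  assumes u: "locally_integrable u" and 0: "\<And>\<phi>. \<phi> \<in> test_functions \<Longrightarrow> L2_inner u (deriv \<phi>) = 0"
  shows "\<exists>c. AE x in leb. u x = c"
proof -
  obtain w0 where w0: "w0 \<in> test_functions" "(LINT x|leb. w0 x) \<noteq> 0"
    using exists_test_integral_ne_0 by blast
  define I where "I = (LINT x|leb. w0 x)"
  define c where "c = L2_inner u w0 / I"
  have lc: "locally_integrable (\<lambda>x. c)" by (intro locally_integrableI L2_integrable L2_const)
  have "L2_inner (\<lambda>x. u x - c) w = 0" if w: "w \<in> test_functions" for w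
  proof -
    define d where "d = (LINT x|leb. w x) / I"
    define \<psi> where "\<psi> = (\<lambda>x. w x + (- d) * w0 x)"
    have \<psi>: "\<psi> \<in> test_functions" unfolding \<psi>_def by (intro test_add test_cmult w w0(1))
    have "(LINT x|leb. \<psi> x) = (LINT x|leb. w x) + (- d) * I"
      unfolding \<psi>_def I_def using test_integrable[OF w] test_integrable[OF w0(1)] by simp
    also have "\<dots> = 0" using w0(2) by (simp add: d_def I_def)
    finally obtain \<phi> where "\<phi> \<in> test_functions" "deriv \<phi> = \<psi>"
      using test_antiderivative[OF \<psi>] by blast
    then have "0 = L2_inner u \<psi>" using 0 by metis
    also have "\<dots> = (LINT x|leb. u x * w x + (- d) * (u x * w0 x))"
      unfolding L2_inner_def \<psi>_def by (simp add: algebra_simps)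
    also have "\<dots> = L2_inner u w + (- d) * L2_inner u w0"
      unfolding L2_inner_def using test_mult_integrable[OF u w] test_mult_integrable[OF u w0(1)] by simp
    also have "\<dots> = L2_inner u w - c * (LINT x|leb. w x)"
      by (simp add: c_def d_def)
    also have "\<dots> = L2_inner u w - L2_inner (\<lambda>x. c) w"
      by (simp add: L2_inner_def)
    also have "\<dots> = L2_inner (\<lambda>x. u x - c) w"
      using L2_inner_test_diff[OF u lc w] by simp
    finally show ?thesis by simp
  qed
  then have "AE x in leb. u x - c = 0"
    by (intro fundamental_lemma locally_integrable_diff u lc)
  then show ?thesis by (auto intro!: exI[of _ c])
qed

section \<open>Weak derivatives of indefinite integrals\<close>

lemma integral_continuous_on:
  fixes g :: "real \<Rightarrow> real"
  assumes "integrable leb g"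
  shows "continuous_on {0..1} (\<lambda>x. integral {0..x} g)"
  using leb_integrable_on[OF assms, of 0 1] by (intro indefinite_integral_continuous_1) auto

text \<open>Integration by parts for a merely integrable \<open>g\<close>, done by Fubini on the
  triangle t <= x in place of a pointwise product rule.\<close>

lemma has_weak_deriv_integral:
  assumes g: "integrable leb g"
  shows "has_weak_deriv 1 (\<lambda>x. integral {0..x} g) g"
proof -
  define v where "v = (\<lambda>x. integral {0..x} g)"
  have iv: "integrable leb v"
  proof -
    have "bounded (v ` {0..1})"
      unfolding v_def
      by (intro compact_imp_bounded compact_continuous_image integral_continuous_on[OF g]) simp
    then obtain B where B: "\<forall>y\<in>v ` {0..1}. norm y \<le> B"
      unfolding bounded_iff by blast
    have "v \<in> borel_measurable leb"
      unfolding v_def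
      by (rule continuous_imp_leb_measurable, rule continuous_on_subset[OF integral_continuous_on[OF g]]) auto
    then show ?thesis by (rule leb_integrable_bounded) (use B in force)
  qed
  have "L2_inner v (deriv \<phi>) = - L2_inner g \<phi>" if \<phi>: "\<phi> \<in> test_functions" for \<phi>
  proof -
    obtain a b where ab: "smooth \<phi>" "0 < a" "a < b" "b < 1" and z: "\<And>x. x \<le> a \<or> b \<le> x \<Longrightarrow> \<phi> x = 0"
      using test_functionsE[OF \<phi>] by metis
    have d\<phi>: "integrable leb (deriv \<phi>)" using deriv_test[OF \<phi>] test_integrable by blast
    interpret M: finite_measure leb by (rule finite_measure_leb)
    interpret P: pair_sigma_finite leb leb ..
    \<comment> \<open>Integrating first in \<open>t\<close> gives
      \<open>deriv \<phi> x * v x\<close>; integrating first in \<open>x\<close> gives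
      \<open>- (g t * \<phi> t)\<close>, the boundary term vanishing because
      \<open>\<phi> 1 = 0\<close>.\<close>
    let ?F = "\<lambda>x t. (if t \<le> x then deriv \<phi> x * g t else 0) :: real"
    have [measurable]: "(\<lambda>x. x) \<in> borel_measurable leb" by (rule borel_imp_leb_measurable) simp
    have [measurable]: "deriv \<phi> \<in> borel_measurable leb" "g \<in> borel_measurable leb"
      using d\<phi> g by auto
    have in1: "(LINT t|leb. ?F x t) = deriv \<phi> x * v x" if x: "x \<in> Omega" for x
    proof -
      have "(LINT t|leb. ?F x t) = (LINT t|leb. deriv \<phi> x * (indicator {0..x} t * g t))"
        by (intro Bochner_Integration.integral_cong) auto
      then show ?thesis
        using leb_indicator_integral[OF g, of 0 x] x by (simp add: v_def)
    qed
    have in2: "(LINT x|leb. ?F x t) = - (g t * \<phi> t)" if t: "t \<in> Omega" for t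
    proof -
      have "(deriv \<phi> has_integral (\<phi> 1 - \<phi> t)) {t..1}"
        using t smooth_DERIV[OF ab(1)]
        by (intro fundamental_theorem_of_calculus)
           (auto simp: has_real_derivative_iff_has_vector_derivative[symmetric] intro: has_field_derivative_at_within)
      then have "integral {t..1} (deriv \<phi>) = - \<phi> t" using z[of 1] ab by (simp add: integral_unique)
      moreover have "(LINT x|leb. ?F x t) = (LINT x|leb. g t * (indicator {t..1} x * deriv \<phi> x))"
        by (intro Bochner_Integration.integral_cong) auto
      ultimately show ?thesis
        using leb_indicator_integral[OF d\<phi>, of t 1] t by simp
    qed
    have "integrable (leb \<Otimes>\<^sub>M leb) (\<lambda>(x, t). ?F x t)"
    proof (rule P.Fubini_integrable)
      show [measurable]: "(\<lambda>(x, t). ?F x t) \<in> borel_measurable (leb \<Otimes>\<^sub>M leb)"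
        by measurable
      show "AE x in leb. integrable leb (\<lambda>t. case (x, t) of (x, t) \<Rightarrow> ?F x t)"
      proof (intro AE_I2)
        fix x
        show "integrable leb (\<lambda>t. case (x, t) of (x, t) \<Rightarrow> ?F x t)"
          by (rule Bochner_Integration.integrable_bound[OF integrable_mult_right[OF g, of "deriv \<phi> x"]]) auto
      qed
      show "integrable leb (\<lambda>x. LINT t|leb. norm (case (x, t) of (x, t) \<Rightarrow> ?F x t))"
      proof (rule Bochner_Integration.integrable_bound)
        show "integrable leb (\<lambda>x. (LINT t|leb. \<bar>g t\<bar>) * deriv \<phi> x)" using d\<phi> by simp
        show "(\<lambda>x. LINT t|leb. norm (case (x, t) of (x, t) \<Rightarrow> ?F x t)) \<in> borel_measurable leb"
          by measurable
        have "(LINT t|leb. norm (?F x t)) \<le> \<bar>deriv \<phi> x\<bar> * (LINT t|leb. \<bar>g t\<bar>)" for x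
        proof -
          have "(LINT t|leb. norm (?F x t)) \<le> (LINT t|leb. \<bar>deriv \<phi> x\<bar> * \<bar>g t\<bar>)"
          proof (rule integral_mono)
            show "integrable leb (\<lambda>t. norm (?F x t))"
              by (rule Bochner_Integration.integrable_bound[OF integrable_mult_right[OF g, of "deriv \<phi> x"]]) auto
            show "integrable leb (\<lambda>t. \<bar>deriv \<phi> x\<bar> * \<bar>g t\<bar>)" using g by simp
          qed (auto simp: abs_mult)
          then show ?thesis by simp
        qed
        then show "AE x in leb. norm (LINT t|leb. norm (case (x, t) of (x, t) \<Rightarrow> ?F x t))
           \<le> norm ((LINT t|leb. \<bar>g t\<bar>) * deriv \<phi> x)"
          by (intro AE_I2) (simp add: abs_mult integral_nonneg_AE mult.commute)
      qed
    qed
    then have "(LINT t|leb. LINT x|leb. ?F x t) = (LINT x|leb. LINT t|leb. ?F x t)"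
      by (rule P.Fubini_integral)
    also have "(LINT t|leb. LINT x|leb. ?F x t) = (LINT t|leb. - (g t * \<phi> t))"
      by (intro Bochner_Integration.integral_cong) (auto simp: in2)
    also have "(LINT x|leb. LINT t|leb. ?F x t) = (LINT x|leb. v x * deriv \<phi> x)"
      by (intro Bochner_Integration.integral_cong) (auto simp: in1)
    finally show ?thesis by (simp add: L2_inner_def)
  qed
  then show ?thesis
    using iv g unfolding has_weak_deriv_def v_def by (auto intro: locally_integrableI)
qed

lemma has_weak_deriv_unique:
  assumes "has_weak_deriv k u g" "has_weak_deriv k u h"
  shows "AE x in leb. g x = h x"
proof -
  have l: "locally_integrable g" "locally_integrable h" using assms by (auto simp: has_weak_deriv_def)
  have "L2_inner (\<lambda>x. g x - h x) \<phi> = 0" if "\<phi> \<in> test_functions" for \<phi>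
  proof -
    have "(- 1) ^ k * L2_inner g \<phi> = (- 1) ^ k * L2_inner h \<phi>"
      using assms that unfolding has_weak_deriv_def by metis
    then show ?thesis using L2_inner_test_diff[OF l that] by simp
  qed
  then have "AE x in leb. g x - h x = 0"
    by (intro fundamental_lemma locally_integrable_diff l)
  then show ?thesis by simp
qed

lemma has_weak_deriv_0:
  assumes "locally_integrable u" shows "has_weak_deriv 0 u u"
  using assms by (simp add: has_weak_deriv_def)

text \<open>The Sobolev space supplies only weak derivatives of \<open>u\<close> itself. Testing the
  lower order against derivatives of test functions links consecutive orders to each other.\<close>

lemma has_weak_deriv_step:
  assumes "has_weak_deriv k u g" "has_weak_deriv (Suc k) u h"
  shows "has_weak_deriv 1 g h"
proof -
  have "L2_inner g (deriv \<phi>) = - L2_inner h \<phi>" if \<phi>: "\<phi> \<in> test_functions" for \<phi>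
  proof -
    have "(- 1) ^ k * L2_inner g (deriv \<phi>) = L2_inner u ((deriv ^^ k) (deriv \<phi>))"
      using assms(1) deriv_test[OF \<phi>] by (simp add: has_weak_deriv_def)
    also have "\<dots> = L2_inner u ((deriv ^^ Suc k) \<phi>)"
      by (simp only: funpow_Suc_right comp_apply)
    also have "\<dots> = (- 1) ^ Suc k * L2_inner h \<phi>"
      using assms(2) \<phi> unfolding has_weak_deriv_def by blast
    finally show ?thesis by (cases "even k") auto
  qed
  then show ?thesis using assms by (auto simp: has_weak_deriv_def)
qed

text \<open>The set where two continuous functions differ is open, and a nonempty open set is not
  negligible.\<close>

lemma AE_leb_continuous_eq:
  fixes u v :: "real \<Rightarrow> real"
  assumes "continuous_on Omega u" "continuous_on Omega v" "AE x in leb. u x = v x" "x \<in> Omega"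
  shows "u x = v x"
proof (rule ccontr)
  assume "u x \<noteq> v x"
  define A where "A = {x \<in> Omega. u x - v x \<noteq> 0}"
  have "A = Omega \<inter> (\<lambda>x. u x - v x) -` (- {0})" by (auto simp: A_def)
  then have "open A"
    using continuous_open_preimage[of Omega "\<lambda>x. u x - v x" "- {0}"] assms(1,2)
    by (simp add: continuous_on_diff open_Compl)
  moreover have "A \<noteq> {}" using \<open>u x \<noteq> v x\<close> assms(4) by (auto simp: A_def)
  moreover have "negligible A"
  proof -
    have "AE x in lebesgue. x \<in> Omega \<longrightarrow> u x = v x"
      using assms(3) by (subst (asm) AE_restrict_space_iff) auto
    then obtain N where "negligible N" "{x. \<not> (x \<in> Omega \<longrightarrow> u x = v x)} \<subseteq> N"
      unfolding eventually_ae_filter_negligible by blast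
    then show ?thesis by (elim negligible_subset) (auto simp: A_def)
  qed
  ultimately show False using open_not_negligible by blast
qed

text \<open>\<open>u\<close> and the indefinite integral of \<open>g\<close> share the weak
  derivative \<open>g\<close>, so their difference is orthogonal to all derivatives of test
  functions and hence constant.\<close>

lemma weak_deriv_1_representative:
  assumes "has_weak_deriv 1 u g" "integrable leb g"
  shows "\<exists>c. AE x in leb. u x = c + integral {0..x} g"
proof -
  let ?v = "\<lambda>x. integral {0..x} g"
  have v: "has_weak_deriv 1 ?v g" by (rule has_weak_deriv_integral[OF assms(2)])
  have l: "locally_integrable u" "locally_integrable ?v"
    using assms(1) v by (auto simp: has_weak_deriv_def)
  have "L2_inner (\<lambda>x. u x - ?v x) (deriv \<phi>) = 0" if "\<phi> \<in> test_functions" for \<phi>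
    using assms(1) v that L2_inner_test_diff[OF l deriv_test[OF that]] by (simp add: has_weak_deriv_def)
  then obtain c where "AE x in leb. u x - ?v x = c"
    using du_Bois_Reymond[OF locally_integrable_diff[OF l]] by blast
  then show ?thesis by (intro exI[of _ c]) (auto simp: algebra_simps)
qed

subsection \<open>Absolutely continuous representatives\<close>

abbreviation sq_integral :: "(real \<Rightarrow> real) \<Rightarrow> real" where
  "sq_integral g \<equiv> integral {0..1} (\<lambda>x. (g x)\<^sup>2)"

text \<open>The working form of H^1: \<open>u\<close> is absolutely continuous on the closed
  interval with derivative \<open>g\<close> in L^2. It speaks about point values, and keeps
  \<open>g\<close> as an explicit partner instead of a choice among representatives.\<close>

definition primitive :: "(real \<Rightarrow> real) \<Rightarrow> (real \<Rightarrow> real) \<Rightarrow> bool" where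
  "primitive u g \<longleftrightarrow> g \<in> L2_space \<and> (\<forall>x y. 0 \<le> x \<longrightarrow> x \<le> y \<longrightarrow> y \<le> 1 \<longrightarrow> u y - u x = integral {x..y} g)"

lemma L2_integrable_on:
  assumes "g \<in> L2_space" "0 \<le> a" "b \<le> 1"
  shows "g integrable_on {a..b}" "(\<lambda>x. (g x)\<^sup>2) integrable_on {a..b}"
  using assms leb_integrable_on[OF L2_integrable] leb_integrable_on[of "\<lambda>x. (g x)\<^sup>2"]
  by (auto simp: L2_space_def)

lemma integral_square_nonneg:
  fixes g :: "real \<Rightarrow> real"
  shows "0 \<le> integral S (\<lambda>x. (g x)\<^sup>2)"
  by (cases "(\<lambda>x. (g x)\<^sup>2) integrable_on S")
     (auto intro: Henstock_Kurzweil_Integration.integral_nonneg simp: not_integrable_integral)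

lemma L2_inner_self:
  assumes "g \<in> L2_space" shows "L2_inner g g = sq_integral g"
  using leb_integral_eq[OF L2_mult_integrable[OF assms assms]]
  by (simp add: L2_inner_def power2_eq_square)

lemma continuous_L2:
  assumes "continuous_on {0..1} u" shows "u \<in> L2_space"
proof -
  have m: "u \<in> borel_measurable leb"
    by (rule continuous_imp_leb_measurable, rule continuous_on_subset[OF assms]) auto
  have "bounded (u ` {0..1})"
    by (intro compact_imp_bounded compact_continuous_image assms) simp
  then obtain B where B: "\<forall>y\<in>u ` {0..1}. norm y \<le> B" unfolding bounded_iff by blast
  have "integrable leb (\<lambda>x. (u x)\<^sup>2)"
  proof (rule leb_integrable_bounded)
    show "(\<lambda>x. (u x)\<^sup>2) \<in> borel_measurable leb" using m by measurable
    fix x :: real assume "x \<in> Omega"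
    then have "\<bar>u x\<bar> \<le> B" using B by auto
    then have "\<bar>u x\<bar>\<^sup>2 \<le> B\<^sup>2" by (intro power_mono) auto
    then show "\<bar>(u x)\<^sup>2\<bar> \<le> B\<^sup>2" by simp
  qed
  with m show ?thesis by (simp add: L2_space_def)
qed

text \<open>Read off from the nonnegativity of the variance of \<open>g\<close>.\<close>

lemma integral_square_le:
  assumes g: "g \<in> L2_space" and ab: "0 \<le> a" "a \<le> b" "b \<le> 1"
  shows "(integral {a..b} g)\<^sup>2 \<le> (b - a) * integral {a..b} (\<lambda>x. (g x)\<^sup>2)"
proof (cases "a = b")
  case False
  note i = L2_integrable_on[OF g ab(1) ab(3)]
  define A where "A = integral {a..b} g"
  define c where "c = A / (b - a)"
  have "0 \<le> integral {a..b} (\<lambda>x. (g x - c)\<^sup>2)"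
    by (rule integral_square_nonneg)
  also have "\<dots> = integral {a..b} (\<lambda>x. (g x)\<^sup>2 - 2 * c * g x + c\<^sup>2)"
    by (intro integral_cong) (simp add: power2_eq_square algebra_simps)
  also have "\<dots> = integral {a..b} (\<lambda>x. (g x)\<^sup>2) - 2 * c * A + (b - a) * c\<^sup>2"
  proof (intro integral_unique has_integral_add has_integral_diff has_integral_mult_right)
    show "((\<lambda>x. c\<^sup>2) has_integral (b - a) * c\<^sup>2) {a..b}"
      using has_integral_const_real[of "c\<^sup>2" a b] ab by simp
  qed (use i in \<open>auto simp: A_def\<close>)
  finally have "0 \<le> (b - a) * (integral {a..b} (\<lambda>x. (g x)\<^sup>2) - 2 * c * A + (b - a) * c\<^sup>2)"
    using ab by simp
  also have "\<dots> = (b - a) * integral {a..b} (\<lambda>x. (g x)\<^sup>2) - 2 * ((b - a) * c) * A + ((b - a) * c)\<^sup>2"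
    by (simp add: power2_eq_square algebra_simps)
  also have "(b - a) * c = A" using False by (simp add: c_def)
  finally have "0 \<le> (b - a) * integral {a..b} (\<lambda>x. (g x)\<^sup>2) - A\<^sup>2"
    by (simp add: power2_eq_square)
  then show ?thesis by (simp add: A_def)
qed auto

lemma primitiveD:
  "primitive u g \<Longrightarrow> 0 \<le> x \<Longrightarrow> x \<le> y \<Longrightarrow> y \<le> 1 \<Longrightarrow> u y - u x = integral {x..y} g"
  unfolding primitive_def by blast

lemma primitive_L2: "primitive u g \<Longrightarrow> g \<in> L2_space"
  by (simp add: primitive_def)

lemma primitive_diff_sq_le:
  assumes p: "primitive u g" and "0 \<le> x" "x \<le> y" "y \<le> 1"
  shows "(u y - u x)\<^sup>2 \<le> (y - x) * integral {x..y} (\<lambda>x. (g x)\<^sup>2)"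
  using integral_square_le[OF primitive_L2[OF p], of x y] primitiveD[OF p, of x y] assms by simp

lemma primitive_continuous:
  assumes "primitive u g" shows "continuous_on {0..1} u"
proof -
  have "continuous_on {0..1} (\<lambda>x. u 0 + integral {0..x} g)"
    using assms by (intro continuous_intros integral_continuous_on L2_integrable primitive_L2)
  moreover have "u 0 + integral {0..x} g = u x" if "x \<in> {0..1}" for x
    using primitiveD[OF assms, of 0 x] that by simp
  ultimately show ?thesis by (rule continuous_on_eq)
qed

text \<open>\<open>u\<close> is the indefinite integral of \<open>g\<close> plus the constant
  \<open>u 0\<close>, and constants are orthogonal to derivatives of test functions.\<close>

lemma primitive_has_weak_deriv:
  assumes "primitive u g" shows "has_weak_deriv 1 u g"
proof -
  have g: "integrable leb g" using assms primitive_L2 L2_integrable by blast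
  have v: "has_weak_deriv 1 (\<lambda>x. integral {0..x} g) g" by (rule has_weak_deriv_integral[OF g])
  have w: "L2_inner (\<lambda>x. u 0) (deriv \<phi>) = 0" if \<phi>: "\<phi> \<in> test_functions" for \<phi>
  proof -
    obtain a b where ab: "smooth \<phi>" "0 < a" "a < b" "b < 1" and z: "\<And>x. x \<le> a \<or> b \<le> x \<Longrightarrow> \<phi> x = 0"
      using test_functionsE[OF \<phi>] by metis
    have "(deriv \<phi> has_integral (\<phi> 1 - \<phi> 0)) {0..1}"
      using smooth_DERIV[OF ab(1)]
      by (intro fundamental_theorem_of_calculus)
         (auto simp: has_real_derivative_iff_has_vector_derivative[symmetric] intro: has_field_derivative_at_within)
    then have "integral {0..1} (deriv \<phi>) = 0" using z ab by (simp add: integral_unique)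
    then show ?thesis
      using leb_integral_eq[OF test_integrable[OF deriv_test[OF \<phi>]]] by (simp add: L2_inner_def)
  qed
  have lu: "locally_integrable u"
    by (intro locally_integrableI L2_integrable continuous_L2 primitive_continuous[OF assms])
  have lc: "locally_integrable (\<lambda>x. u 0)" by (intro locally_integrableI L2_integrable L2_const)
  have "L2_inner u (deriv \<phi>) = - L2_inner g \<phi>" if \<phi>: "\<phi> \<in> test_functions" for \<phi>
  proof -
    have "L2_inner u (deriv \<phi>) = L2_inner (\<lambda>x. u x - u 0) (deriv \<phi>)"
      using w[OF \<phi>] L2_inner_test_diff[OF lu lc deriv_test[OF \<phi>]] by simp
    also have "\<dots> = L2_inner (\<lambda>x. integral {0..x} g) (deriv \<phi>)"
      unfolding L2_inner_def using primitiveD[OF assms, of 0]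
      by (intro Bochner_Integration.integral_cong) auto
    also have "\<dots> = - L2_inner g \<phi>" using v \<phi> by (simp add: has_weak_deriv_def)
    finally show ?thesis .
  qed
  then show ?thesis using lu locally_integrableI[OF g] by (simp add: has_weak_deriv_def)
qed

lemma has_weak_deriv_imp_weak_deriv:
  assumes "has_weak_deriv k u g" shows "AE x in leb. weak_deriv k u x = g x"
proof -
  have "has_weak_deriv k u (weak_deriv k u)"
    unfolding weak_deriv_def using assms by (rule someI[of "has_weak_deriv k u"])
  then show ?thesis using has_weak_deriv_unique assms by blast
qed

lemma leb_AE_obtain_negligible:
  assumes "AE x in leb. P x"
  obtains N where "negligible N" "\<And>x. x \<in> {0..1} - N \<Longrightarrow> P x"
proof -
  have "AE x in lebesgue. x \<in> Omega \<longrightarrow> P x"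
    using assms by (subst (asm) AE_restrict_space_iff) auto
  then obtain N where N: "negligible N" "{x. \<not> (x \<in> Omega \<longrightarrow> P x)} \<subseteq> N"
    unfolding eventually_ae_filter_negligible by blast
  then have "negligible (N \<union> {0,1})" by (intro negligible_Un) auto
  moreover have "P x" if "x \<in> {0..1} - (N \<union> {0,1})" for x
  proof -
    have "x \<in> Omega" "x \<notin> N" using that by auto
    then show ?thesis using N(2) by blast
  qed
  ultimately show ?thesis using that by blast
qed

lemma leb_integrable_AE:
  fixes f g :: "real \<Rightarrow> real"
  assumes "integrable leb f" "AE x in leb. g x = f x"
  shows "integrable leb g" "(LINT x|leb. g x) = (LINT x|leb. f x)"
proof -
  obtain N where N: "negligible N" "\<And>x. x \<in> {0..1} - N \<Longrightarrow> g x = f x"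
    using leb_AE_obtain_negligible[OF assms(2)] by metis
  show i: "integrable leb g"
    unfolding leb_integrable_iff
    by (rule absolutely_integrable_spike[OF _ N(1)]) (use N(2) assms(1) in \<open>auto simp: leb_integrable_iff\<close>)
  show "(LINT x|leb. g x) = (LINT x|leb. f x)"
    unfolding leb_integral_eq[OF i] leb_integral_eq[OF assms(1)]
    by (rule integral_spike[OF N(1)]) (use N(2) in auto)
qed

lemma L2_inner_AE_cong:
  assumes "f \<in> L2_space" "g \<in> L2_space" "AE x in leb. f' x = f x" "AE x in leb. g' x = g x"
  shows "L2_inner f' g' = L2_inner f g"
  unfolding L2_inner_def
proof (rule leb_integrable_AE(2)[OF L2_mult_integrable[OF assms(1,2)]])
  show "AE x in leb. f' x * g' x = f x * g x"
    using assms(3,4) by eventually_elim simp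
qed

lemma L2_space_AE:
  assumes "f \<in> L2_space" "AE x in leb. g x = f x"
  shows "g \<in> L2_space"
proof -
  have "integrable leb g" by (rule leb_integrable_AE(1)[OF L2_integrable[OF assms(1)] assms(2)])
  moreover have "integrable leb (\<lambda>x. (g x)\<^sup>2)"
    by (rule leb_integrable_AE(1)[of "\<lambda>x. (f x)\<^sup>2"]) (use assms in \<open>auto simp: L2_space_def\<close>)
  ultimately show ?thesis by (auto simp: L2_space_def)
qed

text \<open>Replaces the weak derivatives of \<open>f\<close> by representatives that are honest
  primitives of one another, which is the form that Taylor expansion and sampling consume.\<close>

lemma Sobolev_cont_chain:
  assumes f: "f \<in> Sobolev_cont s" and m: "1 \<le> m" "m \<le> s"
  obtains F where "\<And>k. k < m \<Longrightarrow> primitive (F k) (F (Suc k))"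
    "\<And>x. x \<in> Omega \<Longrightarrow> F 0 x = f x"
    "\<And>k. k \<le> m \<Longrightarrow> sq_integral (F k) \<le> (Sobolev_norm s f)\<^sup>2"
proof -
  have fL: "f \<in> L2_space" and fc: "continuous_on Omega f"
    using f by (auto simp: Sobolev_cont_def Sobolev_def)
  have "\<forall>k\<in>{..s}. \<exists>g. g \<in> L2_space \<and> has_weak_deriv k f g"
    using f by (auto simp: Sobolev_cont_def Sobolev_def)
  then obtain G0 where G0: "\<And>k. k \<le> s \<Longrightarrow> G0 k \<in> L2_space \<and> has_weak_deriv k f (G0 k)"
    using bchoice[of "{..s}"] by (metis atMost_iff)
  \<comment> \<open>Order 0 uses \<open>f\<close> itself, so that its continuous values and not just
    its class are tied to the chain.\<close>
  define G where "G k = (if k = 0 then f else G0 k)" for k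
  have G: "G k \<in> L2_space" "has_weak_deriv k f (G k)" if "k \<le> s" for k
    using G0[OF that] fL has_weak_deriv_0[OF locally_integrableI[OF L2_integrable[OF fL]]]
    by (auto simp: G_def)
  have "\<exists>c. AE x in leb. G k x = c + integral {0..x} (G (Suc k))" if "k < s" for k
  proof (rule weak_deriv_1_representative)
    show "has_weak_deriv 1 (G k) (G (Suc k))"
      using that by (intro has_weak_deriv_step[of k f] G) auto
    show "integrable leb (G (Suc k))" using that by (intro L2_integrable G) auto
  qed
  then obtain c where c: "\<And>k. k < s \<Longrightarrow> AE x in leb. G k x = c k + integral {0..x} (G (Suc k))"
    by metis
  \<comment> \<open>Below order \<open>m\<close> the absolutely continuous representative is taken;
    the top derivative has none to offer and stays a plain L^2 function.\<close>
  define F where "F k = (if k < m then (\<lambda>x. c k + integral {0..x} (G (Suc k))) else G k)" for k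
  have FG: "AE x in leb. F k x = G k x" if "k \<le> m" for k
  proof (cases "k < m")
    case True
    then show ?thesis using c[of k] m(2) by (auto simp: F_def)
  qed (simp add: F_def)
  have FL: "F k \<in> L2_space" if "k \<le> m" for k
    using L2_space_AE[OF G(1) FG[OF that]] that m by auto
  show ?thesis
  proof (rule that)
    fix k assume k: "k < m"
    show "primitive (F k) (F (Suc k))"
      unfolding primitive_def
    proof (intro conjI allI impI)
      show "F (Suc k) \<in> L2_space" using FL k by auto
      fix x y :: real assume xy: "0 \<le> x" "x \<le> y" "y \<le> 1"
      have i: "G (Suc k) integrable_on {0..y}"
        using k m xy by (intro leb_integrable_on L2_integrable G) auto
      have "F k y - F k x = integral {x..y} (G (Suc k))"
        using k Henstock_Kurzweil_Integration.integral_combine[OF xy(1,2) i] by (simp add: F_def)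
      also have "\<dots> = integral {x..y} (F (Suc k))"
      proof -
        obtain N where N: "negligible N" "\<And>x. x \<in> {0..1} - N \<Longrightarrow> F (Suc k) x = G (Suc k) x"
          using leb_AE_obtain_negligible[OF FG[of "Suc k"]] k by auto
        show ?thesis by (rule integral_spike[OF N(1)]) (use N(2) xy in auto)
      qed
      finally show "F k y - F k x = integral {x..y} (F (Suc k))" .
    qed
  next
    fix x :: real assume x: "x \<in> Omega"
    have g1: "integrable leb (G 1)" using m by (intro L2_integrable G) auto
    \<comment> \<open>Both functions are continuous, so equality almost everywhere improves to
      equality at every point, in particular at the design points.\<close>
    have "continuous_on Omega (F 0)"
      using m(1) unfolding F_def
      by (auto intro!: continuous_intros continuous_on_subset[OF integral_continuous_on[OF g1[unfolded One_nat_def]]])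
    moreover have "AE x in leb. F 0 x = f x" using FG[of 0] by (simp add: G_def)
    ultimately show "F 0 x = f x" using AE_leb_continuous_eq fc x by blast
  next
    fix k assume k: "k \<le> m"
    have "AE x in leb. weak_deriv k f x = G k x"
      using k m by (intro has_weak_deriv_imp_weak_deriv G) auto
    moreover have "AE x in leb. F k x = G k x" by (rule FG[OF k])
    ultimately have "AE x in leb. weak_deriv k f x = F k x" by eventually_elim simp
    then have "L2_inner (weak_deriv k f) (weak_deriv k f) = L2_inner (F k) (F k)"
      using FL[OF k] by (intro L2_inner_AE_cong) auto
    also have "\<dots> = sq_integral (F k)" by (rule L2_inner_self[OF FL[OF k]])
    finally have "sq_integral (F k) = (L2_norm (weak_deriv k f))\<^sup>2"
      unfolding L2_norm_def using integral_square_nonneg[of "{0..1}" "F k"] by simp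
    also have "\<dots> \<le> (\<Sum>k\<le>s. (L2_norm (weak_deriv k f))\<^sup>2)"
      using k m by (intro member_le_sum) auto
    also have "\<dots> = (Sobolev_norm s f)\<^sup>2"
      unfolding Sobolev_norm_def by (simp add: sum_nonneg)
    finally show "sq_integral (F k) \<le> (Sobolev_norm s f)\<^sup>2" .
  qed
qed

lemma Sobolev_norm_nonneg: "0 \<le> Sobolev_norm s f"
  by (simp add: Sobolev_norm_def sum_nonneg)

subsection \<open>Sampling inequalities\<close>

text \<open>Energy of \<open>g\<close> up to \<open>x\<close>, with the argument clamped to the unit
  interval: windows around a point may stick out at the ends and differences of this function still
  measure their energy.\<close>

definition cum_square :: "(real \<Rightarrow> real) \<Rightarrow> real \<Rightarrow> real" where
  "cum_square g x = integral {0..max 0 (min 1 x)} (\<lambda>t. (g t)\<^sup>2)"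

lemma cum_square_diff:
  assumes "g \<in> L2_space" "0 \<le> x" "x \<le> y" "y \<le> 1"
  shows "cum_square g y - cum_square g x = integral {x..y} (\<lambda>t. (g t)\<^sup>2)"
proof -
  have "(\<lambda>t. (g t)\<^sup>2) integrable_on {0..y}" using L2_integrable_on(2)[OF assms(1)] assms by simp
  from Henstock_Kurzweil_Integration.integral_combine[OF assms(2,3) this]
  show ?thesis using assms by (simp add: cum_square_def)
qed

lemma cum_square_clamp: "cum_square g (max 0 (min 1 x)) = cum_square g x"
  by (simp add: cum_square_def)

lemma cum_square_mono:
  assumes "g \<in> L2_space" "x \<le> y"
  shows "cum_square g x \<le> cum_square g y"
proof -
  have "0 \<le> cum_square g (max 0 (min 1 y)) - cum_square g (max 0 (min 1 x))"
    using assms(2) by (subst cum_square_diff[OF assms(1)]) (auto intro: integral_square_nonneg)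
  then show ?thesis by (simp add: cum_square_clamp)
qed

lemma cum_square_nonneg: "0 \<le> cum_square g x"
  by (simp add: cum_square_def integral_square_nonneg)

lemma cum_square_ge_1: "1 \<le> x \<Longrightarrow> cum_square g x = sq_integral g"
  by (simp add: cum_square_def)

lemma cum_square_le: "g \<in> L2_space \<Longrightarrow> cum_square g x \<le> sq_integral g"
  using cum_square_mono[of g x "max 1 x"] cum_square_ge_1[of "max 1 x" g] by simp

lemma cum_square_continuous:
  assumes "g \<in> L2_space" shows "continuous_on S (cum_square g)"
proof -
  have "continuous_on {0..1} (\<lambda>x. integral {0..x} (\<lambda>t. (g t)\<^sup>2))"
    using assms by (intro integral_continuous_on) (auto simp: L2_space_def)
  then show ?thesis
    unfolding cum_square_def[abs_def]
    by (rule continuous_on_compose2) (auto intro!: continuous_intros)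
qed

text \<open>Cauchy-Schwarz with the energy enlarged to any window from \<open>a\<close> to
  \<open>b\<close> containing both points; the window may exceed the unit interval.\<close>

lemma primitive_diff_sq_le_cum:
  assumes p: "primitive u g" and xz: "x \<in> {0..1}" "z \<in> {0..1}"
    and a: "a \<le> x" "a \<le> z" and b: "x \<le> b" "z \<le> b"
  shows "(u x - u z)\<^sup>2 \<le> \<bar>x - z\<bar> * (cum_square g b - cum_square g a)"
proof -
  note g = primitive_L2[OF p]
  have *: "(u x - u z)\<^sup>2 \<le> \<bar>x - z\<bar> * (cum_square g b - cum_square g a)"
    if "x \<in> {0..1}" "z \<in> {0..1}" "z \<le> x" "a \<le> z" "x \<le> b" for x z
  proof -
    have "(u x - u z)\<^sup>2 \<le> (x - z) * (cum_square g x - cum_square g z)"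
      using primitive_diff_sq_le[OF p, of z x] cum_square_diff[OF g, of z x] that by simp
    also have "\<dots> \<le> (x - z) * (cum_square g b - cum_square g a)"
      using cum_square_mono[OF g, of x b] cum_square_mono[OF g, of a z] that by (intro mult_left_mono) auto
    finally show ?thesis using that by simp
  qed
  show ?thesis
  proof (cases "z \<le> x")
    case True then show ?thesis using *[of x z] assms by simp
  next
    case False
    then have "(u z - u x)\<^sup>2 \<le> \<bar>z - x\<bar> * (cum_square g b - cum_square g a)"
      using *[of z x] assms by simp
    then show ?thesis by (simp add: power2_commute abs_minus_commute)
  qed
qed

text \<open>Each point lies in the windows of at most a set of centres of length
  \<open>2 * h\<close>. Since \<open>cum_square\<close> is continuous, this is proved by shifting
  the variable rather than by exchanging integrals.\<close>

lemma integral_cum_square_window: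
  assumes g: "g \<in> L2_space" and h: "0 \<le> h"
  shows "integral {0..1} (\<lambda>x. cum_square g (x + h) - cum_square g (x - h))
    \<le> 2 * h * sq_integral g"
proof -
  let ?G = "cum_square g" let ?T = "sq_integral g"
  have i: "?G integrable_on {a..b}" for a b
    by (intro integrable_continuous_real cum_square_continuous g)
  have c: "continuous_on {0..1} (\<lambda>x. ?G (x + d))" for d
    by (rule continuous_on_compose2[OF cum_square_continuous[OF g, of UNIV]]) (auto intro!: continuous_intros)
  have sh: "integral {0..1} (\<lambda>x. ?G (x + d)) = integral {d..1 + d} ?G" for d
    using integral_shift_real_ivl[where a=d and c=d and b="1 + d" and f="?G"] by simp
  have "integral {0..1} (\<lambda>x. ?G (x + h) - ?G (x + (- h)))
    = integral {0..1} (\<lambda>x. ?G (x + h)) - integral {0..1} (\<lambda>x. ?G (x + (- h)))"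
    by (intro Henstock_Kurzweil_Integration.integral_diff integrable_continuous_real c)
  also have "\<dots> = integral {h..1 + h} ?G - integral {- h..1 - h} ?G"
    unfolding sh by simp
  \<comment> \<open>The common middle range cancels. What remains are two end strips of length
    \<open>2 * h\<close>: on the right one \<open>?G\<close> is at most \<open>?T\<close>, on the
    left one it is nonnegative.\<close>
  also have "\<dots> = integral {1 - h..1 + h} ?G - integral {- h..h} ?G"
  proof -
    have "integral {- h..h} ?G + integral {h..1 + h} ?G = integral {- h..1 + h} ?G"
      using h i by (intro Henstock_Kurzweil_Integration.integral_combine) auto
    moreover have "integral {- h..1 - h} ?G + integral {1 - h..1 + h} ?G = integral {- h..1 + h} ?G"
      using h i by (cases "h \<le> 1") (auto intro!: Henstock_Kurzweil_Integration.integral_combine)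
    ultimately show ?thesis by simp
  qed
  also have "\<dots> \<le> integral {1 - h..1 + h} (\<lambda>x. ?T) - 0"
    using i cum_square_le[OF g] cum_square_nonneg
    by (intro diff_mono integral_le Henstock_Kurzweil_Integration.integral_nonneg) auto
  also have "\<dots> = 2 * h * ?T" using h by simp
  finally show ?thesis by simp
qed

lemma integral_window_le:
  assumes "0 \<le> h"
  shows "integral {0..1} (\<lambda>x. if x \<in> {z - h..z + h} then 1 else 0 :: real) \<le> 2 * h"
    "(\<lambda>x. if x \<in> {z - h..z + h} then 1 else 0 :: real) integrable_on {0..1}"
proof -
  have *: "{z - h..z + h} \<inter> {0..1} = {max 0 (z - h)..min 1 (z + h)}" by auto
  have "integral {0..1} (\<lambda>x. if x \<in> {z - h..z + h} then 1 else 0 :: real)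
      = integral {max 0 (z - h)..min 1 (z + h)} (\<lambda>x. 1)"
    using integral_restrict_Int[of "{0..1}" "{z - h..z + h}" "\<lambda>x. 1::real"] unfolding * by simp
  also have "\<dots> \<le> 2 * h" using assms by (auto simp: content_real_if min_def max_def)
  finally show "integral {0..1} (\<lambda>x. if x \<in> {z - h..z + h} then 1 else 0 :: real) \<le> 2 * h" .
  show "(\<lambda>x. if x \<in> {z - h..z + h} then 1 else 0 :: real) integrable_on {0..1}"
    using integrable_restrict_Int[where f="\<lambda>x. 1::real" and S="{z - h..z + h}" and T="{0..1}"]
      integrable_continuous_real[OF continuous_on_const[of "{max 0 (z - h)..min 1 (z + h)}" "1::real"]]
    unfolding * by simp
qed

lemma design_finite: "design xs \<Longrightarrow> finite (set xs)" "design xs \<Longrightarrow> set xs \<noteq> {}"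
  by (auto simp: design_def)

lemma infdist_le_fill_distance:
  assumes "design xs" "x \<in> Omega"
  shows "infdist x (set xs) \<le> fill_distance xs"
proof -
  obtain z where z: "z \<in> set xs" "z \<in> Omega" using assms(1) by (cases xs) (auto simp: design_def)
  have "infdist y (set xs) \<le> 1" if "y \<in> Omega" for y
    using infdist_le[OF z(1), of y] z(2) that by (auto simp: dist_real_def)
  then have "bdd_above ((\<lambda>x. infdist x (set xs)) ` Omega)"
    by (intro bdd_aboveI2[where M=1])
  then show ?thesis unfolding fill_distance_def using assms(2) by (intro cSUP_upper)
qed

lemma fill_distance_nearest:
  assumes "design xs" "x \<in> Omega"
  obtains z where "z \<in> set xs" "\<bar>x - z\<bar> \<le> fill_distance xs"
proof -
  have "infdist x (set xs) = Min (dist x ` set xs)"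
    using design_finite[OF assms(1)] by (simp add: infdist_notempty cInf_eq_Min)
  also have "\<dots> \<in> dist x ` set xs"
    using design_finite[OF assms(1)] by (intro Min_in) auto
  finally obtain z where "z \<in> set xs" "infdist x (set xs) = dist x z" by blast
  then show ?thesis using infdist_le_fill_distance[OF assms] that by (simp add: dist_real_def)
qed

text \<open>A finite design misses some point of the interval. Positivity of the fill distance is
  what makes the regularization parameter strictly positive.\<close>

lemma fill_distance_pos:
  assumes "design xs" shows "0 < fill_distance xs"
proof -
  have "infinite Omega" by simp
  then have "\<not> Omega \<subseteq> set xs" using finite_subset by blast
  then obtain x where x: "x \<in> Omega" "x \<notin> set xs" by blast
  have "0 < infdist x (set xs)"
    using x finite_imp_closed[of "set xs"] design_finite[OF assms] infdist_pos_not_in_closed by blast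
  then show ?thesis using infdist_le_fill_distance[OF assms x(1)] by linarith
qed

text \<open>Move from \<open>x\<close> to a design point within the fill distance; Cauchy-Schwarz
  prices the increment at that distance times the energy, and splitting the square costs the factors
  2.\<close>

lemma sampling_sup:
  assumes p: "primitive u g" and d: "design xs" and x: "x \<in> Omega"
  shows "(u x)\<^sup>2 \<le> 2 * (\<Sum>z\<in>set xs. (u z)\<^sup>2) + 2 * fill_distance xs * sq_integral g"
proof -
  obtain z where z: "z \<in> set xs" "\<bar>x - z\<bar> \<le> fill_distance xs"
    using fill_distance_nearest[OF d x] .
  have zO: "z \<in> {0<..<1}" using d z by (auto simp: design_def)
  have "(u x - u z)\<^sup>2 \<le> \<bar>x - z\<bar> * (cum_square g 1 - cum_square g 0)"
    using x zO by (intro primitive_diff_sq_le_cum[OF p]) auto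
  also have "\<dots> = \<bar>x - z\<bar> * sq_integral g" by (simp add: cum_square_def)
  also have "\<dots> \<le> fill_distance xs * sq_integral g"
    using z by (intro mult_right_mono integral_square_nonneg)
  finally have 1: "(u x - u z)\<^sup>2 \<le> fill_distance xs * sq_integral g" .
  have 2: "(u z)\<^sup>2 \<le> (\<Sum>z\<in>set xs. (u z)\<^sup>2)"
    using z by (intro member_le_sum) auto
  have "(u x)\<^sup>2 \<le> 2 * (u z)\<^sup>2 + 2 * (u x - u z)\<^sup>2"
    using zero_le_power2[of "u x - 2 * u z"] by (simp add: power2_eq_square algebra_simps)
  with 1 2 show ?thesis by linarith
qed

text \<open>The extra factor \<open>h\<close> over the supremum version comes from localization: a
  design value is charged only to points within \<open>h\<close> of it, and energy only to a window
  of radius \<open>h\<close>. Integration over \<open>x\<close> turns each window into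
  \<open>2 * h\<close>, and splitting the square doubles this.\<close>

lemma sampling_L2:
  assumes p: "primitive u g" and d: "design xs" and h: "h = fill_distance xs"
  shows "sq_integral u
    \<le> 4 * h * (\<Sum>z\<in>set xs. (u z)\<^sup>2) + 4 * h\<^sup>2 * sq_integral g"
proof -
  let ?G = "cum_square g"
  note g = primitive_L2[OF p]
  have h0: "0 \<le> h" using fill_distance_pos[OF d] h by simp
  define W where "W z x = (if x \<in> {z - h..z + h} then 1 else 0 :: real)" for z x
  define R where "R x = 2 * (\<Sum>z\<in>set xs. (u z)\<^sup>2 * W z x) + 2 * h * (?G (x + h) - ?G (x - h))" for x
  have c: "continuous_on {0..1} (\<lambda>x. ?G (x + d))" for d
    by (rule continuous_on_compose2[OF cum_square_continuous[OF g, of UNIV]]) (auto intro!: continuous_intros)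
  have iG: "(\<lambda>x. ?G (x + h) - ?G (x - h)) integrable_on {0..1}"
    using c[of h] c[of "- h"] by (intro integrable_diff integrable_continuous_real) auto
  have iW: "W z integrable_on {0..1}" for z unfolding W_def by (rule integral_window_le[OF h0])
  have iS: "(\<lambda>x. \<Sum>z\<in>set xs. (u z)\<^sup>2 * W z x) integrable_on {0..1}"
    by (intro integrable_sum integrable_on_mult_right iW) simp
  have iR: "R integrable_on {0..1}"
    unfolding R_def by (intro integrable_add integrable_on_mult_right iS iG)
  have le: "(u x)\<^sup>2 \<le> R x" if x: "x \<in> {0<..<1}" for x
  proof -
    obtain z where z: "z \<in> set xs" "\<bar>x - z\<bar> \<le> h"
      using fill_distance_nearest[OF d x] h by metis
    have zO: "z \<in> {0<..<1}" using d z by (auto simp: design_def)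
    have "(u x - u z)\<^sup>2 \<le> \<bar>x - z\<bar> * (?G (x + h) - ?G (x - h))"
      using x zO z by (intro primitive_diff_sq_le_cum[OF p]) auto
    also have "\<dots> \<le> h * (?G (x + h) - ?G (x - h))"
      using z cum_square_mono[OF g, of "x - h" "x + h"] h0 by (intro mult_right_mono) auto
    finally have 1: "(u x - u z)\<^sup>2 \<le> h * (?G (x + h) - ?G (x - h))" .
    \<comment> \<open>Summing over all design points whose window contains \<open>x\<close> avoids a
      measurable choice of a nearest point.\<close>
    have "(u z)\<^sup>2 = (u z)\<^sup>2 * W z x" using z by (auto simp: W_def)
    also have "\<dots> \<le> (\<Sum>z\<in>set xs. (u z)\<^sup>2 * W z x)"
      using z by (intro member_le_sum) (auto simp: W_def)
    finally have 2: "(u z)\<^sup>2 \<le> (\<Sum>z\<in>set xs. (u z)\<^sup>2 * W z x)" .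
    have "(u x)\<^sup>2 \<le> 2 * (u z)\<^sup>2 + 2 * (u x - u z)\<^sup>2"
      using zero_le_power2[of "u x - 2 * u z"] by (simp add: power2_eq_square algebra_simps)
    with 1 2 show ?thesis unfolding R_def by linarith
  qed
  have "sq_integral u = integral {0<..<1} (\<lambda>x. (u x)\<^sup>2)"
    by (simp add: integral_open_interval_real)
  also have "\<dots> \<le> integral {0<..<1} R"
  proof (rule integral_le)
    have "(\<lambda>x. (u x)\<^sup>2) integrable_on {0..1}"
      by (intro integrable_continuous_real continuous_intros primitive_continuous[OF p])
    then show "(\<lambda>x. (u x)\<^sup>2) integrable_on {0<..<1}"
      by (simp add: integrable_on_open_interval_real)
    show "R integrable_on {0<..<1}" using iR by (simp add: integrable_on_open_interval_real)
  qed (rule le)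
  also have "\<dots> = integral {0..1} R" by (simp add: integral_open_interval_real)
  also have "\<dots> = 2 * (\<Sum>z\<in>set xs. (u z)\<^sup>2 * integral {0..1} (W z))
      + 2 * h * integral {0..1} (\<lambda>x. ?G (x + h) - ?G (x - h))"
    unfolding R_def
    by (intro integral_unique has_integral_add has_integral_mult_right has_integral_sum integrable_integral iW iG) auto
  also have "\<dots> \<le> 2 * (\<Sum>z\<in>set xs. (u z)\<^sup>2 * (2 * h)) + 2 * h * (2 * h * sq_integral g)"
    using h0 integral_window_le(1)[OF h0] unfolding W_def
    by (intro add_mono mult_left_mono sum_mono integral_cum_square_window g) auto
  also have "\<dots> = 4 * h * (\<Sum>z\<in>set xs. (u z)\<^sup>2) + 4 * h\<^sup>2 * sq_integral g"
    by (simp add: sum_distrib_left sum_distrib_right power2_eq_square algebra_simps)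
  finally show ?thesis .
qed

subsection \<open>Finite element approximation\<close>

lemma poly_antiderivative:
  fixes P :: "real poly"
  obtains Q where "pderiv Q = P" "degree Q \<le> Suc (degree P)"
proof -
  define q where "q i = monom (coeff P i / real (Suc i)) (Suc i)" for i
  have "pderiv (sum q A) = (\<Sum>i\<in>A. pderiv (q i))" for A
    using higher_pderiv_sum[of 1 q A] by simp
  then have "pderiv (\<Sum>i\<le>degree P. q i) = (\<Sum>i\<le>degree P. monom (coeff P i) i)"
    by (simp add: q_def pderiv_monom del: of_nat_Suc)
  also have "\<dots> = P" by (rule poly_as_sum_of_monoms)
  finally have "pderiv (\<Sum>i\<le>degree P. q i) = P" .
  moreover have "degree (\<Sum>i\<le>degree P. q i) \<le> Suc (degree P)"
    unfolding q_def by (intro degree_sum_le) (auto intro: order_trans[OF degree_monom_le])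
  ultimately show ?thesis using that by blast
qed

lemma poly_diff_integral:
  fixes P :: "real poly"
  assumes "a \<le> b"
  shows "poly P b - poly P a = integral {a..b} (poly (pderiv P))"
proof -
  have "(poly (pderiv P) has_integral (poly P b - poly P a)) {a..b}"
    by (intro fundamental_theorem_of_calculus assms)
       (simp add: has_real_derivative_iff_has_vector_derivative[symmetric] has_field_derivative_at_within)
  then show ?thesis by (simp add: integral_unique)
qed

lemma poly_L2: "poly P \<in> L2_space"
  by (intro continuous_L2 continuous_intros)

lemma abs_le_iff_power2_le: "0 \<le> B \<Longrightarrow> \<bar>x::real\<bar> \<le> B \<longleftrightarrow> x\<^sup>2 \<le> B\<^sup>2"
  by (metis abs_le_square_iff abs_of_nonneg)

text \<open>The induction integrates the polynomial obtained for \<open>F 1\<close>, so no explicit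
  Taylor formula appears and each integration gains a factor \<open>b - a\<close>. Cauchy-Schwarz in
  the base case is the source of \<open>sqrt (b - a)\<close>. The derivative is measured in mean
  square because for \<open>m = 0\<close> it has no pointwise bound.\<close>

lemma taylor_local:
  fixes F :: "nat \<Rightarrow> real \<Rightarrow> real"
  assumes ab: "0 \<le> a" "a \<le> b" "b \<le> 1"
    and F: "\<And>k. k \<le> m \<Longrightarrow> primitive (F k) (F (Suc k))"
    and G: "G = sqrt (integral {a..b} (\<lambda>x. (F (Suc m) x)\<^sup>2))"
  shows "\<exists>T. degree T \<le> m \<and> poly T a = F 0 a \<and>
    (\<forall>x\<in>{a..b}. \<bar>F 0 x - poly T x\<bar> \<le> (b - a) ^ m * sqrt (b - a) * G) \<and>
    integral {a..b} (\<lambda>x. (F 1 x - poly (pderiv T) x)\<^sup>2) \<le> ((b - a) ^ m * G)\<^sup>2"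
  using F G
proof (induction m arbitrary: F)
  case 0
  have p: "primitive (F 0) (F 1)" using 0 by simp
  have G2: "G\<^sup>2 = integral {a..b} (\<lambda>x. (F 1 x)\<^sup>2)"
    using 0 integral_square_nonneg[of "{a..b}" "F 1"] by simp
  have G0: "0 \<le> G" using 0 integral_square_nonneg by simp
  have "\<bar>F 0 x - F 0 a\<bar> \<le> sqrt (b - a) * G" if x: "x \<in> {a..b}" for x
  proof -
    have "(F 0 x - F 0 a)\<^sup>2 \<le> \<bar>x - a\<bar> * (cum_square (F 1) b - cum_square (F 1) a)"
      using x ab by (intro primitive_diff_sq_le_cum[OF p]) auto
    also have "\<dots> = \<bar>x - a\<bar> * G\<^sup>2"
      using cum_square_diff[OF primitive_L2[OF p] ab] G2 by simp
    also have "\<dots> \<le> (b - a) * G\<^sup>2" using x by (intro mult_right_mono) auto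
    also have "\<dots> = (sqrt (b - a) * G)\<^sup>2" using ab by (simp add: power_mult_distrib)
    finally show ?thesis using ab G0 by (subst abs_le_iff_power2_le) auto
  qed
  then show ?case using G2 by (intro exI[of _ "[:F 0 a:]"]) auto
next
  case (Suc m)
  \<comment> \<open>The induction hypothesis bounds the derivative error pointwise by
    \<open>B\<close>; integrating it, or its square, yields both new estimates.\<close>
  define B where "B = (b - a) ^ m * sqrt (b - a) * G"
  have "\<exists>T. degree T \<le> m \<and> poly T a = F (Suc 0) a \<and>
    (\<forall>x\<in>{a..b}. \<bar>F (Suc 0) x - poly T x\<bar> \<le> (b - a) ^ m * sqrt (b - a) * G) \<and>
    integral {a..b} (\<lambda>x. (F (Suc 1) x - poly (pderiv T) x)\<^sup>2) \<le> ((b - a) ^ m * G)\<^sup>2"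
    by (rule Suc.IH[of "\<lambda>k. F (Suc k)"]) (use Suc.prems in auto)
  then obtain T1 where T1: "degree T1 \<le> m" "\<And>x. x \<in> {a..b} \<Longrightarrow> \<bar>F 1 x - poly T1 x\<bar> \<le> B"
    unfolding B_def by auto
  have B0: "0 \<le> B" using T1(2)[of a] ab by (meson abs_ge_zero atLeastAtMost_iff order_refl order_trans)
  obtain Q where Q: "pderiv Q = T1" "degree Q \<le> Suc (degree T1)" using poly_antiderivative .
  define T where "T = Q + [:F 0 a - poly Q a:]"
  have p0: "primitive (F 0) (F 1)" using Suc.prems(1)[of 0] by simp
  have p1: "primitive (F 1) (F 2)" using Suc.prems(1)[of 1] by (simp add: numeral_2_eq_2)
  have c: "continuous_on {x..y} (\<lambda>x. F 1 x - poly T1 x)" if "0 \<le> x" "y \<le> 1" for x y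
    by (intro continuous_intros continuous_on_subset[OF primitive_continuous[OF p1]]) (use that in auto)
  have T': "pderiv T = T1" by (simp add: T_def pderiv_add Q pderiv_pCons)
  have "degree T \<le> Suc m"
    unfolding T_def using Q T1(1) by (intro degree_add_le) auto
  moreover have "\<bar>F 0 x - poly T x\<bar> \<le> (b - a) ^ Suc m * sqrt (b - a) * G" if x: "x \<in> {a..b}" for x
  proof -
    have i1: "F 1 integrable_on {a..x}"
      using x ab by (intro L2_integrable_on primitive_L2[OF p0]) auto
    have i2: "poly T1 integrable_on {a..x}" by (intro integrable_continuous_real continuous_intros)
    have "F 0 x - poly T x = (F 0 x - F 0 a) - (poly T x - poly T a)" by (simp add: T_def)
    also have "\<dots> = integral {a..x} (F 1) - integral {a..x} (poly T1)"
      using primitiveD[OF p0, of a x] poly_diff_integral[of a x T] x ab T' by simp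
    also have "\<dots> = integral {a..x} (\<lambda>x. F 1 x - poly T1 x)"
      using i1 i2 by (rule Henstock_Kurzweil_Integration.integral_diff[symmetric])
    finally have "\<bar>F 0 x - poly T x\<bar> = norm (integral {a..x} (\<lambda>x. F 1 x - poly T1 x))" by simp
    also have "\<dots> \<le> B * (x - a)"
      using x ab T1(2) by (intro integral_bound c) auto
    also have "\<dots> \<le> B * (b - a)" using x B0 by (intro mult_left_mono) auto
    finally show ?thesis by (simp add: B_def algebra_simps)
  qed
  moreover have "integral {a..b} (\<lambda>x. (F 1 x - poly (pderiv T) x)\<^sup>2) \<le> ((b - a) ^ Suc m * G)\<^sup>2"
  proof -
    have "integral {a..b} (\<lambda>x. (F 1 x - poly T1 x)\<^sup>2) \<le> integral {a..b} (\<lambda>x. B\<^sup>2)"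
      using T1(2) B0 ab by (intro integral_le integrable_continuous_real continuous_intros c)
        (auto simp: abs_le_iff_power2_le[symmetric])
    also have "\<dots> = (b - a) * B\<^sup>2" using ab by simp
    also have "\<dots> = ((b - a) ^ Suc m * G)\<^sup>2"
      using ab by (simp add: B_def power_mult_distrib power2_eq_square)
    finally show ?thesis by (simp add: T')
  qed
  ultimately show ?case using T1 by (intro exI[of _ T]) (auto simp: T_def)
qed

lemma sq_sum3_le: "((x::real) + y + z)\<^sup>2 \<le> 3 * x\<^sup>2 + 3 * y\<^sup>2 + 3 * z\<^sup>2"
proof -
  have "0 \<le> (x - y)\<^sup>2 + (y - z)\<^sup>2 + (x - z)\<^sup>2" by simp
  then show ?thesis by (simp add: power2_eq_square algebra_simps)
qed

text \<open>A Taylor polynomial matches \<open>F 0\<close> only at the left node, so neighbouring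
  ones would not join. A linear correction repairs the right node at a cost not exceeding the Taylor
  error, and respects the degree because \<open>p\<close> is at least 1. In the energy, three terms
  cost a factor 3, and two of them are bounded by the same square, whence 6.\<close>

lemma taylor_two_point:
  fixes F :: "nat \<Rightarrow> real \<Rightarrow> real"
  assumes ab: "0 \<le> a" "a < b" "b \<le> 1" and mp: "m \<le> p" "1 \<le> p"
    and F: "\<And>k. k \<le> m \<Longrightarrow> primitive (F k) (F (Suc k))"
    and G: "G = sqrt (integral {a..b} (\<lambda>x. (F (Suc m) x)\<^sup>2))"
  shows "\<exists>P. degree P \<le> p \<and> poly P a = F 0 a \<and> poly P b = F 0 b \<and>
    (\<forall>x\<in>{a..b}. \<bar>F 0 x - poly P x\<bar> \<le> 2 * ((b - a) ^ m * sqrt (b - a) * G)) \<and>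
    integral {a..b} (\<lambda>x. (poly (pderiv P) x)\<^sup>2) \<le> 3 * integral {a..b} (\<lambda>x. (F 1 x)\<^sup>2) + 6 * ((b - a) ^ m * G)\<^sup>2"
proof -
  define d where "d = b - a"
  define B where "B = d ^ m * sqrt d * G"
  have d0: "0 < d" using ab by (simp add: d_def)
  obtain T where T: "degree T \<le> m" "poly T a = F 0 a"
    "\<And>x. x \<in> {a..b} \<Longrightarrow> \<bar>F 0 x - poly T x\<bar> \<le> B"
    "integral {a..b} (\<lambda>x. (F 1 x - poly (pderiv T) x)\<^sup>2) \<le> (d ^ m * G)\<^sup>2"
    using taylor_local[of a b m F G] ab F G unfolding B_def d_def by auto
  define s where "s = (F 0 b - poly T b) / d"
  define P where "P = T + [:- s * a, s:]"
  have Px: "poly P x = poly T x + s * (x - a)" for x by (simp add: P_def algebra_simps)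
  have P': "poly (pderiv P) x = poly (pderiv T) x + s" for x
    by (simp add: P_def pderiv_add pderiv_pCons)
  have s: "\<bar>s\<bar> * d \<le> B" using T(3)[of b] ab d0 by (simp add: s_def abs_mult)
  have FL: "F 1 \<in> L2_space" using F[of 0] primitive_L2 by auto
  have i1: "(\<lambda>x. (F 1 x)\<^sup>2) integrable_on {a..b}" using FL ab by (intro L2_integrable_on(2)) auto
  have i2: "(\<lambda>x. (F 1 x - poly (pderiv T) x)\<^sup>2) integrable_on {a..b}"
    using ab by (intro L2_integrable_on(2) L2_diff FL poly_L2) auto
  have "degree P \<le> p"
    unfolding P_def using T(1) mp by (intro degree_add_le) (auto intro: order_trans[OF degree_pCons_le])
  moreover have "poly P a = F 0 a" "poly P b = F 0 b"
    using T(2) d0 by (simp_all add: Px s_def d_def)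
  moreover have "\<bar>F 0 x - poly P x\<bar> \<le> 2 * B" if x: "x \<in> {a..b}" for x
  proof -
    have "\<bar>s * (x - a)\<bar> \<le> \<bar>s\<bar> * d"
      using x by (auto simp: abs_mult d_def intro!: mult_left_mono)
    then show ?thesis using T(3)[OF x] s unfolding Px by linarith
  qed
  moreover have "integral {a..b} (\<lambda>x. (poly (pderiv P) x)\<^sup>2)
      \<le> 3 * integral {a..b} (\<lambda>x. (F 1 x)\<^sup>2) + 6 * (d ^ m * G)\<^sup>2"
  proof -
    let ?R = "\<lambda>x. 3 * (F 1 x)\<^sup>2 + 3 * (F 1 x - poly (pderiv T) x)\<^sup>2 + 3 * s\<^sup>2"
    have cs: "((\<lambda>x. 3 * s\<^sup>2) has_integral (d * (3 * s\<^sup>2))) {a..b}"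
      using has_integral_const_real[of "3 * s\<^sup>2" a b] ab by (simp add: d_def)
    have R: "(?R has_integral (3 * integral {a..b} (\<lambda>x. (F 1 x)\<^sup>2)
        + 3 * integral {a..b} (\<lambda>x. (F 1 x - poly (pderiv T) x)\<^sup>2) + d * (3 * s\<^sup>2))) {a..b}"
      by (intro has_integral_add has_integral_mult_right integrable_integral i1 i2 cs)
    have "(poly (pderiv P) x)\<^sup>2 \<le> ?R x" for x
      using sq_sum3_le[of "F 1 x" "poly (pderiv T) x - F 1 x" s] unfolding P'
      by (simp add: power2_commute[of "F (Suc 0) x"])
    then have "integral {a..b} (\<lambda>x. (poly (pderiv P) x)\<^sup>2) \<le> integral {a..b} ?R"
    proof (intro integral_le)
      show "(\<lambda>x. (poly (pderiv P) x)\<^sup>2) integrable_on {a..b}"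
        by (intro integrable_continuous_real continuous_intros)
      show "?R integrable_on {a..b}" using R by blast
    qed auto
    also have "\<dots> = 3 * integral {a..b} (\<lambda>x. (F 1 x)\<^sup>2)
        + 3 * integral {a..b} (\<lambda>x. (F 1 x - poly (pderiv T) x)\<^sup>2) + 3 * (d * s\<^sup>2)"
      using R by (simp add: integral_unique)
    finally have *: "integral {a..b} (\<lambda>x. (poly (pderiv P) x)\<^sup>2) \<le> 3 * integral {a..b} (\<lambda>x. (F 1 x)\<^sup>2)
        + 3 * integral {a..b} (\<lambda>x. (F 1 x - poly (pderiv T) x)\<^sup>2) + 3 * (d * s\<^sup>2)" .
    \<comment> \<open>An extra factor \<open>d\<close> makes
      \<open>\<bar>s\<bar> * d \<le> B\<close> applicable after squaring; it cancels against the
      square of \<open>sqrt d\<close> in \<open>B\<close>.\<close>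
    have "d * (d * s\<^sup>2) = (\<bar>s\<bar> * d)\<^sup>2" by (simp add: power2_eq_square)
    also have "\<dots> \<le> B\<^sup>2" using s d0 by (intro power_mono) auto
    also have "\<dots> = d * (d ^ m * G)\<^sup>2" using d0 by (simp add: B_def power_mult_distrib)
    finally have "d * s\<^sup>2 \<le> (d ^ m * G)\<^sup>2" using d0 by simp
    with * T(4) show ?thesis by linarith
  qed
  ultimately show ?thesis unfolding B_def d_def by blast
qed

abbreviation cell :: "nat \<Rightarrow> nat \<Rightarrow> real set" where
  "cell N i \<equiv> {(real i - 1) / real N .. real i / real N}"

text \<open>The cells are taken open so that at most one summand is nonzero; the nodes get the value
  0, which no integral sees.\<close>

definition piecewise_deriv :: "nat \<Rightarrow> (nat \<Rightarrow> real poly) \<Rightarrow> real \<Rightarrow> real" where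
  "piecewise_deriv N P x =
     (\<Sum>i=1..N. if x \<in> {(real i - 1) / real N <..< real i / real N} then poly (pderiv (P i)) x else 0)"

lemma in_cell_iff:
  assumes "1 \<le> N"
  shows "x \<in> cell N i \<longleftrightarrow> real i - 1 \<le> real N * x \<and> real N * x \<le> real i"
  using assms by (auto simp: field_simps)

lemma in_open_cell_iff:
  assumes "1 \<le> N"
  shows "x \<in> {(real i - 1) / real N <..< real i / real N} \<longleftrightarrow> real i - 1 < real N * x \<and> real N * x < real i"
  using assms by (auto simp: field_simps)

lemma cell_cover:
  assumes N: "1 \<le> N" and x: "x \<in> {0..1}"
  obtains i where "i \<in> {1..N}" "x \<in> cell N i" "i = max 1 (nat \<lceil>real N * x\<rceil>)"
proof -
  \<comment> \<open>At \<open>x = 0\<close> the ceiling is 0, which the maximum sends to the first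
    cell.\<close>
  define i where "i = max 1 (nat \<lceil>real N * x\<rceil>)"
  have Nx: "0 \<le> real N * x" "real N * x \<le> real N" using x by (auto intro: mult_left_le)
  then have "\<lceil>real N * x\<rceil> \<le> int N" by (simp add: ceiling_le_iff)
  then have "nat \<lceil>real N * x\<rceil> \<le> N" by (simp only: nat_le_iff)
  then have "i \<in> {1..N}" unfolding i_def using N by simp
  moreover have "real i - 1 \<le> real N * x \<and> real N * x \<le> real i"
  proof (cases "real N * x = 0")
    case True
    then have "i = 1" by (simp only: i_def) simp
    then show ?thesis unfolding True by simp
  next
    case False
    then have "0 < \<lceil>real N * x\<rceil>" using Nx(1) unfolding zero_less_ceiling by linarith
    then have "1 \<le> nat \<lceil>real N * x\<rceil>" by linarith
    then have "i = nat \<lceil>real N * x\<rceil>" unfolding i_def by (simp only: max.absorb2)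
    then have "real i = of_int \<lceil>real N * x\<rceil>" using \<open>0 < \<lceil>real N * x\<rceil>\<close> by linarith
    then show ?thesis by linarith
  qed
  ultimately show ?thesis using that in_cell_iff[OF N] i_def by blast
qed

lemma cell_subset:
  assumes "1 \<le> N" "i \<in> {1..N}" shows "cell N i \<subseteq> {0..1}"
proof
  fix x assume x: "x \<in> cell N i"
  have "0 \<le> (real i - 1) / real N" "real i / real N \<le> 1" using assms by auto
  with x show "x \<in> {0..1}" by auto
qed

lemma piecewise_deriv_eq:
  assumes N: "1 \<le> N" and i: "i \<in> {1..N}" and x: "x \<in> {(real i - 1) / real N <..< real i / real N}"
  shows "piecewise_deriv N P x = poly (pderiv (P i)) x"
proof -
  have "(x \<in> {(real j - 1) / real N <..< real j / real N}) \<longleftrightarrow> j = i" for j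
    using x unfolding in_open_cell_iff[OF N] by (auto simp: of_nat_less_iff[symmetric, where 'a=real])
  then show ?thesis
    unfolding piecewise_deriv_def using i by (simp add: if_distrib[of "\<lambda>g. g x"] sum.delta cong: if_cong)
qed

lemma L2_restrict_interval:
  assumes "f \<in> L2_space" shows "(\<lambda>x. if x \<in> {a<..<b} then f x else 0) \<in> L2_space"
proof -
  have *: "(\<lambda>x. if x \<in> {a<..<b} then f x else 0) = (\<lambda>x. indicator {a<..<b} x * f x)" by auto
  have m: "indicator {a<..<b} \<in> borel_measurable leb"
    by (intro borel_imp_leb_measurable) simp
  have "integrable leb (\<lambda>x. (indicator {a<..<b} x * f x)\<^sup>2)"
  proof (rule Bochner_Integration.integrable_bound)
    show "integrable leb (\<lambda>x. (f x)\<^sup>2)" using assms by (simp add: L2_space_def)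
    show "(\<lambda>x. (indicator {a<..<b} x * f x)\<^sup>2) \<in> borel_measurable leb"
      using assms m by (intro borel_measurable_power borel_measurable_times) (auto simp: L2_space_def)
  qed (auto intro!: AE_I2 simp: indicator_def)
  then show ?thesis
    unfolding * using assms m by (auto simp: L2_space_def intro!: borel_measurable_times)
qed

lemma piecewise_deriv_L2: "piecewise_deriv N P \<in> L2_space"
  unfolding piecewise_deriv_def[abs_def] by (intro L2_sum L2_restrict_interval poly_L2)

text \<open>The fundamental theorem with the finitely many nodes as exceptional set; continuity of
  \<open>u\<close> prevents jumps there.\<close>

lemma primitive_piecewise_deriv:
  assumes N: "1 \<le> N" and c: "continuous_on {0..1} u"
    and u: "\<And>i x. i \<in> {1..N} \<Longrightarrow> x \<in> cell N i \<Longrightarrow> u x = poly (P i) x"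
  shows "primitive u (piecewise_deriv N P)"
  unfolding primitive_def
proof (intro conjI allI impI)
  fix x y :: real assume xy: "0 \<le> x" "x \<le> y" "y \<le> 1"
  have "(piecewise_deriv N P has_integral (u y - u x)) {x..y}"
  proof (rule fundamental_theorem_of_calculus_interior_strong)
    show "finite ((\<lambda>i. real i / real N) ` {0..N})" by simp
    show "continuous_on {x..y} u" by (rule continuous_on_subset[OF c]) (use xy in auto)
    fix t assume t: "t \<in> {x<..<y} - (\<lambda>i. real i / real N) ` {0..N}"
    then have "t \<in> {0..1}" using xy by auto
    then obtain i where i: "i \<in> {1..N}" "t \<in> cell N i" using cell_cover[OF N] by metis
    have "t \<noteq> real i / real N" using t i(1) by auto
    moreover have "t \<noteq> (real i - 1) / real N"
    proof
      assume "t = (real i - 1) / real N"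
      then have "t = real (i - 1) / real N" using i(1) by simp
      moreover have "i - 1 \<in> {0..N}" using i(1) by auto
      ultimately show False using t by blast
    qed
    ultimately have ti: "t \<in> {(real i - 1) / real N <..< real i / real N}" using i(2) by auto
    have "(poly (P i) has_real_derivative piecewise_deriv N P t) (at t)"
      unfolding piecewise_deriv_eq[OF N i(1) ti] by (rule poly_DERIV)
    then have "(u has_real_derivative piecewise_deriv N P t) (at t)"
      by (rule has_field_derivative_transform_within_open[OF _ open_greaterThanLessThan ti])
         (use u[OF i(1)] in auto)
    then show "(u has_vector_derivative piecewise_deriv N P t) (at t)"
      by (simp add: has_real_derivative_iff_has_vector_derivative)
  qed (use xy in simp)
  then show "u y - u x = integral {x..y} (piecewise_deriv N P)" by (simp add: integral_unique)
qed (rule piecewise_deriv_L2)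

lemma integral_cells:
  fixes h :: "real \<Rightarrow> real"
  assumes N: "1 \<le> N" and h: "h integrable_on {0..1}"
  shows "integral {0..1} h = (\<Sum>i=1..N. integral (cell N i) h)"
proof -
  have "n \<le> N \<Longrightarrow> integral {0..real n / real N} h = (\<Sum>i=1..n. integral (cell N i) h)" for n
  proof (induction n)
    case (Suc n)
    have "h integrable_on {0..real (Suc n) / real N}"
      by (rule integrable_on_subinterval[OF h]) (use Suc.prems N in auto)
    then have "integral {0..real (Suc n) / real N} h
        = integral {0..real n / real N} h + integral {real n / real N..real (Suc n) / real N} h"
      by (intro Henstock_Kurzweil_Integration.integral_combine[symmetric]) (auto simp: divide_right_mono)
    then show ?case using Suc by simp
  qed simp
  from this[of N] show ?thesis using N by simp
qed

lemma integral_piecewise_deriv_sq: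
  assumes N: "1 \<le> N"
  shows "sq_integral (piecewise_deriv N P)
    = (\<Sum>i=1..N. integral (cell N i) (\<lambda>x. (poly (pderiv (P i)) x)\<^sup>2))"
proof -
  have "(\<lambda>x. (piecewise_deriv N P x)\<^sup>2) integrable_on {0..1}"
    by (intro L2_integrable_on(2) piecewise_deriv_L2) auto
  then have "sq_integral (piecewise_deriv N P)
      = (\<Sum>i=1..N. integral (cell N i) (\<lambda>x. (piecewise_deriv N P x)\<^sup>2))"
    by (rule integral_cells[OF N])
  also have "\<dots> = (\<Sum>i=1..N. integral (cell N i) (\<lambda>x. (poly (pderiv (P i)) x)\<^sup>2))"
  proof (rule sum.cong[OF refl])
    fix i assume i: "i \<in> {1..N}"
    show "integral (cell N i) (\<lambda>x. (piecewise_deriv N P x)\<^sup>2) = integral (cell N i) (\<lambda>x. (poly (pderiv (P i)) x)\<^sup>2)"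
    proof (rule integral_spike[of "{(real i - 1) / real N, real i / real N}"])
      fix x assume "x \<in> cell N i - {(real i - 1) / real N, real i / real N}"
      then have "x \<in> {(real i - 1) / real N <..< real i / real N}" by auto
      then show "(poly (pderiv (P i)) x)\<^sup>2 = (piecewise_deriv N P x)\<^sup>2"
        using piecewise_deriv_eq[OF N i] by metis
    qed simp
  qed
  finally show ?thesis .
qed

lemma continuous_on_finite_closed_UN:
  fixes f :: "'a::topological_space \<Rightarrow> 'b::topological_space"
  assumes "finite I" "\<And>i. i \<in> I \<Longrightarrow> closed (U i)" "\<And>i. i \<in> I \<Longrightarrow> continuous_on (U i) f"
  shows "continuous_on (\<Union>i\<in>I. U i) f"
  using assms
proof (induction I rule: finite_induct)
  case (insert i I)
  then show ?case by (auto intro!: continuous_on_closed_Un closed_UN)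
qed simp

text \<open>Both competitors are built from local polynomials; agreement at the inner nodes is all
  that membership in the finite element space still requires.\<close>

lemma fe_glue:
  assumes N: "1 \<le> N" and deg: "\<And>i. i \<in> {1..N} \<Longrightarrow> degree (P i) \<le> p"
    and match: "\<And>i. 1 \<le> i \<Longrightarrow> i < N \<Longrightarrow> poly (P i) (real i / real N) = poly (P (Suc i)) (real i / real N)"
  obtains w where "w \<in> fe_space p N" "primitive w (piecewise_deriv N P)"
    "\<And>i x. i \<in> {1..N} \<Longrightarrow> x \<in> cell N i \<Longrightarrow> w x = poly (P i) x"
proof -
  \<comment> \<open>The ceiling assigns an inner node to the cell on its left. At the left end of a
    later cell the value therefore comes from the preceding polynomial, and \<open>match\<close>
    identifies the two.\<close>
  define w where "w x = poly (P (max 1 (nat \<lceil>real N * x\<rceil>))) x" for x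
  have w: "w x = poly (P i) x" if i: "i \<in> {1..N}" and x: "x \<in> cell N i" for i x
  proof -
    have x': "real i - 1 \<le> real N * x" "real N * x \<le> real i" using x unfolding in_cell_iff[OF N] by auto
    show ?thesis
    proof (cases "real i - 1 = real N * x")
      case False
      then have "\<lceil>real N * x\<rceil> = int i" using x' by (intro ceiling_unique) auto
      then show ?thesis using i by (simp add: w_def max_def)
    next
      case True
      then have ce: "\<lceil>real N * x\<rceil> = int i - 1" by (metis ceiling_of_int of_int_1 of_int_diff of_int_of_nat_eq)
      show ?thesis
      proof (cases "i = 1")
        case True then show ?thesis using ce by (simp add: w_def)
      next
        case False
        then have i2: "1 \<le> i - 1" "i - 1 < N" "Suc (i - 1) = i" using i by auto
        have "x = real (i - 1) / real N" using True N i by (simp add: field_simps)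
        moreover have "max 1 (nat \<lceil>real N * x\<rceil>) = i - 1" using ce i2 by (simp add: max_def nat_diff_distrib)
        ultimately show ?thesis using match[OF i2(1,2)] i2(3) by (simp add: w_def)
      qed
    qed
  qed
  have "continuous_on (\<Union>i\<in>{1..N}. cell N i) w"
  proof (rule continuous_on_finite_closed_UN)
    fix i assume i: "i \<in> {1..N}"
    have "continuous_on (cell N i) (poly (P i))" by (intro continuous_intros)
    then show "continuous_on (cell N i) w" by (rule continuous_on_eq) (use w[OF i] in auto)
  qed auto
  then have c: "continuous_on {0..1} w"
  proof (rule continuous_on_subset)
    show "{0..1} \<subseteq> (\<Union>i\<in>{1..N}. cell N i)"
    proof
      fix x :: real assume "x \<in> {0..1}"
      then obtain i where "i \<in> {1..N}" "x \<in> cell N i" using cell_cover[OF N] by metis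
      then show "x \<in> (\<Union>i\<in>{1..N}. cell N i)" by (rule UN_I)
    qed
  qed
  have "w \<in> fe_space p N"
    unfolding fe_space_def using c w deg by blast
  moreover have "primitive w (piecewise_deriv N P)"
    using c w by (intro primitive_piecewise_deriv N)
  ultimately show ?thesis using w by (rule that)
qed

text \<open>Squaring the local error of order m + 1/2 gives the exponent 2 m + 1. The cell energies
  \<open>J i\<close> add up to the full energy, and cell lengths are at most 1, so the derivative
  bound does not depend on \<open>N\<close>.\<close>

lemma fe_taylor_approx:
  fixes F :: "nat \<Rightarrow> real \<Rightarrow> real"
  assumes N: "1 \<le> N" and mp: "m \<le> p" "1 \<le> p"
    and F: "\<And>k. k \<le> m \<Longrightarrow> primitive (F k) (F (Suc k))"
  obtains w g where "w \<in> fe_space p N" "primitive w g"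
    "\<And>x. x \<in> {0..1} \<Longrightarrow> (F 0 x - w x)\<^sup>2 \<le> 4 * (1 / real N) ^ (2 * m + 1) * sq_integral (F (Suc m))"
    "sq_integral g \<le> 3 * sq_integral (F 1) + 6 * sq_integral (F (Suc m))"
proof -
  let ?d = "1 / real N"
  define J where "J i = integral (cell N i) (\<lambda>x. (F (Suc m) x)\<^sup>2)" for i
  have J0: "0 \<le> J i" for i unfolding J_def by (rule integral_square_nonneg)
  have d1: "?d \<le> 1" "0 < ?d" using N by auto
  have FL: "F (Suc m) \<in> L2_space" "F 1 \<in> L2_space"
    using F[of m] F[of 0] primitive_L2 by auto
  have JN: "(\<Sum>i=1..N. J i) = sq_integral (F (Suc m))"
    unfolding J_def by (rule integral_cells[symmetric, OF N]) (intro L2_integrable_on(2) FL, auto)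
  define Q where "Q i P \<longleftrightarrow> degree P \<le> p \<and> poly P ((real i - 1) / real N) = F 0 ((real i - 1) / real N)
      \<and> poly P (real i / real N) = F 0 (real i / real N) \<and>
    (\<forall>x\<in>cell N i. \<bar>F 0 x - poly P x\<bar> \<le> 2 * (?d ^ m * sqrt ?d * sqrt (J i))) \<and>
    integral (cell N i) (\<lambda>x. (poly (pderiv P) x)\<^sup>2) \<le> 3 * integral (cell N i) (\<lambda>x. (F 1 x)\<^sup>2) + 6 * (?d ^ m * sqrt (J i))\<^sup>2"
    for i P
  have "\<exists>P. Q i P"
    if i: "i \<in> {1..N}" for i
  proof -
    have e: "real i / real N - (real i - 1) / real N = ?d" by (simp add: diff_divide_distrib)
    have "0 \<le> (real i - 1) / real N" "(real i - 1) / real N < real i / real N" "real i / real N \<le> 1"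
      using i N by (auto simp: divide_strict_right_mono)
    from taylor_two_point[where F=F, OF this mp F refl] show ?thesis
      unfolding e J_def Q_def .
  qed
  then obtain P where "\<And>i. i \<in> {1..N} \<Longrightarrow> Q i (P i)" by metis
  then have P: "\<And>i. i \<in> {1..N} \<Longrightarrow> degree (P i) \<le> p"
    "\<And>i. i \<in> {1..N} \<Longrightarrow> poly (P i) ((real i - 1) / real N) = F 0 ((real i - 1) / real N)"
    "\<And>i. i \<in> {1..N} \<Longrightarrow> poly (P i) (real i / real N) = F 0 (real i / real N)"
    "\<And>i x. i \<in> {1..N} \<Longrightarrow> x \<in> cell N i \<Longrightarrow> \<bar>F 0 x - poly (P i) x\<bar> \<le> 2 * (?d ^ m * sqrt ?d * sqrt (J i))"
    "\<And>i. i \<in> {1..N} \<Longrightarrow> integral (cell N i) (\<lambda>x. (poly (pderiv (P i)) x)\<^sup>2)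
       \<le> 3 * integral (cell N i) (\<lambda>x. (F 1 x)\<^sup>2) + 6 * (?d ^ m * sqrt (J i))\<^sup>2"
    unfolding Q_def by blast+
  have match: "poly (P i) (real i / real N) = poly (P (Suc i)) (real i / real N)" if "1 \<le> i" "i < N" for i
    using P(3)[of i] P(2)[of "Suc i"] that by simp
  obtain w where w: "w \<in> fe_space p N" "primitive w (piecewise_deriv N P)"
    "\<And>i x. i \<in> {1..N} \<Longrightarrow> x \<in> cell N i \<Longrightarrow> w x = poly (P i) x"
    using fe_glue[OF N P(1) match] by metis
  have err: "(F 0 x - w x)\<^sup>2 \<le> 4 * ?d ^ (2 * m + 1) * sq_integral (F (Suc m))" if x: "x \<in> {0..1}" for x
  proof -
    obtain i where i: "i \<in> {1..N}" "x \<in> cell N i" using cell_cover[OF N x] by metis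
    have "\<bar>F 0 x - w x\<bar> \<le> 2 * (?d ^ m * sqrt ?d * sqrt (J i))" using P(4)[OF i] w(3)[OF i] by simp
    then have "(F 0 x - w x)\<^sup>2 \<le> (2 * (?d ^ m * sqrt ?d * sqrt (J i)))\<^sup>2"
      using d1 J0 by (subst (asm) abs_le_iff_power2_le) auto
    also have "\<dots> = 4 * ((?d ^ m)\<^sup>2 * ?d) * J i"
      unfolding power_mult_distrib using d1 J0[of i] by simp
    also have "(?d ^ m)\<^sup>2 * ?d = ?d ^ (2 * m + 1)"
      unfolding power_add power_even_eq by simp
    \<comment> \<open>A point sees only the energy of its own cell, here simply bounded by the
      total.\<close>
    also have "4 * ?d ^ (2 * m + 1) * J i \<le> 4 * ?d ^ (2 * m + 1) * (\<Sum>i=1..N. J i)"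
      using i J0 d1 by (intro mult_left_mono member_le_sum) auto
    finally show ?thesis unfolding JN .
  qed
  have "sq_integral (piecewise_deriv N P)
      \<le> (\<Sum>i=1..N. 3 * integral (cell N i) (\<lambda>x. (F 1 x)\<^sup>2) + 6 * J i)"
    unfolding integral_piecewise_deriv_sq[OF N]
  proof (rule sum_mono)
    fix i assume i: "i \<in> {1..N}"
    have "(?d ^ m * sqrt (J i))\<^sup>2 = (?d ^ m)\<^sup>2 * J i" using J0[of i] by (simp add: power_mult_distrib)
    also have "\<dots> \<le> 1 * J i" using d1 J0[of i] by (intro mult_right_mono power_le_one) auto
    finally show "integral (cell N i) (\<lambda>x. (poly (pderiv (P i)) x)\<^sup>2) \<le> 3 * integral (cell N i) (\<lambda>x. (F 1 x)\<^sup>2) + 6 * J i"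
      using P(5)[OF i] by linarith
  qed
  also have "\<dots> = 3 * (\<Sum>i=1..N. integral (cell N i) (\<lambda>x. (F 1 x)\<^sup>2)) + 6 * (\<Sum>i=1..N. J i)"
    by (simp add: sum.distrib sum_distrib_left)
  also have "(\<Sum>i=1..N. integral (cell N i) (\<lambda>x. (F 1 x)\<^sup>2)) = sq_integral (F 1)"
    by (rule integral_cells[symmetric, OF N]) (intro L2_integrable_on(2) FL, auto)
  finally have "sq_integral (piecewise_deriv N P)
      \<le> 3 * sq_integral (F 1) + 6 * sq_integral (F (Suc m))"
    unfolding JN .
  with w(1,2) err show ?thesis by (rule that)
qed

text \<open>The shift \<open>c\<close> is for windows of several cells: an increment over three
  cells splits into three shifted families, each of which telescopes.\<close>

lemma sum_telescope_le:
  fixes G :: "real \<Rightarrow> real"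
  assumes "\<And>x. 0 \<le> G x" "\<And>x. G x \<le> T"
  shows "(\<Sum>i=1..N. G ((real i + c) / real N) - G ((real i - 1 + c) / real N)) \<le> T"
proof -
  have "(\<Sum>i=1..n. G ((real i + c) / real N) - G ((real i - 1 + c) / real N)) = G ((real n + c) / real N) - G (c / real N)" for n
    by (induction n) (auto simp: algebra_simps)
  then show ?thesis using assms(1)[of "c / real N"] assms(2)[of "(real N + c) / real N"] by simp
qed

text \<open>Quasi-interpolation: the nodal value at \<open>k / N\<close> is sampled at a nearby point \<open>t k\<close>, which
  may be chosen as a design point.\<close>

lemma fe_quasi_interpolant:
  assumes N: "1 \<le> N" and p1: "1 \<le> p" and u: "primitive u u'"
    and t: "\<And>k. k \<le> N \<Longrightarrow> t k \<in> {0..1}" "\<And>k. k \<le> N \<Longrightarrow> \<bar>t k - real k / real N\<bar> \<le> 1 / real N"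
  obtains w g where "w \<in> fe_space p N" "primitive w g"
    "\<And>i x. i \<in> {1..N} \<Longrightarrow> x \<in> cell N i \<Longrightarrow> t (i - 1) = t i \<Longrightarrow> w x = u (t i)"
    "w 0 = u (t 0)"
    "sq_integral g \<le> 9 * sq_integral u'"
proof -
  note L = primitive_L2[OF u]
  define s where "s i = real N * (u (t i) - u (t (i - 1)))" for i
  define P where "P i = [: u (t (i - 1)) - s i * ((real i - 1) / real N), s i :]" for i
  have P: "poly (P i) x = u (t (i - 1)) + s i * (x - (real i - 1) / real N)" for i x
    by (simp add: P_def algebra_simps)
  have P': "poly (pderiv (P i)) x = s i" for i x by (simp add: P_def pderiv_pCons)
  have Pend: "poly (P i) (real i / real N) = u (t i)" "poly (P i) ((real i - 1) / real N) = u (t (i - 1))" for i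
    using N by (simp_all add: P s_def field_simps)
  have deg: "degree (P i) \<le> p" for i unfolding P_def using p1 by simp
  have match: "poly (P i) (real i / real N) = poly (P (Suc i)) (real i / real N)" for i
    using Pend(1)[of i] Pend(2)[of "Suc i"] by simp
  obtain w where w: "w \<in> fe_space p N" "primitive w (piecewise_deriv N P)"
    "\<And>i x. i \<in> {1..N} \<Longrightarrow> x \<in> cell N i \<Longrightarrow> w x = poly (P i) x"
    using fe_glue[OF N deg match] by metis
  let ?G = "cum_square u'" let ?T = "sq_integral u'"
  define D where "D c = (\<Sum>i=1..N. ?G ((real i + c) / real N) - ?G ((real i - 1 + c) / real N))" for c :: real
  have D: "D c \<le> ?T" for c
    unfolding D_def by (intro sum_telescope_le cum_square_nonneg cum_square_le L)
  \<comment> \<open>Both sample points \<open>t (i - 1)\<close> and \<open>t i\<close> lie between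
    (i - 2) / N and (i + 1) / N, so their increment is controlled by the energy on three cells. At
    the ends this window leaves the unit interval, where the clamping in \<open>cum_square\<close>
    takes effect.\<close>
  have "sq_integral (piecewise_deriv N P)
     \<le> (\<Sum>i=1..N. 3 * (?G ((real i + 1) / real N) - ?G ((real i - 2) / real N)))"
    unfolding integral_piecewise_deriv_sq[OF N]
  proof (rule sum_mono)
    fix i assume i: "i \<in> {1..N}"
    then have ri: "real (i - 1) = real i - 1" by auto
    define A d where "A = real i / real N" and "d = 1 / real N"
    have d0: "0 < d" using N by (simp add: d_def)
    have e: "(real i - 1) / real N = A - d" "(real i + 1) / real N = A + d" "(real i - 2) / real N = A - 2 * d"
      by (simp_all add: A_def d_def add_divide_distrib diff_divide_distrib)
    have ti: "\<bar>t i - A\<bar> \<le> d" "\<bar>t (i - 1) - (A - d)\<bar> \<le> d"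
    proof -
      show "\<bar>t i - A\<bar> \<le> d" using t(2)[of i] i by (simp add: A_def d_def)
      have "i - 1 \<le> N" using i by auto
      from t(2)[OF this, folded d_def] show "\<bar>t (i - 1) - (A - d)\<bar> \<le> d" unfolding ri e .
    qed
    define K where "K = ?G ((real i + 1) / real N) - ?G ((real i - 2) / real N)"
    have "(real i - 2) / real N \<le> (real i + 1) / real N" unfolding e using d0 by simp
    then have K0: "0 \<le> K" using cum_square_mono[OF L] by (simp add: K_def)
    have "(u (t i) - u (t (i - 1)))\<^sup>2 \<le> \<bar>t i - t (i - 1)\<bar> * K"
      unfolding K_def e
    proof (rule primitive_diff_sq_le_cum[OF u])
      show "t i \<in> {0..1}" "t (i - 1) \<in> {0..1}" using t(1) i by auto
    qed (use ti d0 in linarith)+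
    also have "\<dots> \<le> (3 * d) * K"
      using ti K0 by (intro mult_right_mono) linarith+
    finally have *: "(u (t i) - u (t (i - 1)))\<^sup>2 \<le> (3 / real N) * K" by (simp add: d_def)
    have "integral (cell N i) (\<lambda>x. (poly (pderiv (P i)) x)\<^sup>2) = (s i)\<^sup>2 / real N"
      unfolding P' using N by (simp add: divide_right_mono diff_divide_distrib)
    also have "\<dots> = real N * (u (t i) - u (t (i - 1)))\<^sup>2"
      using N by (simp add: s_def power2_eq_square)
    also have "\<dots> \<le> real N * ((3 / real N) * K)" using * by (intro mult_left_mono) auto
    also have "\<dots> = 3 * K" using N by simp
    finally show "integral (cell N i) (\<lambda>x. (poly (pderiv (P i)) x)\<^sup>2) \<le> 3 * (?G ((real i + 1) / real N) - ?G ((real i - 2) / real N))"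
      by (simp add: K_def)
  qed
  \<comment> \<open>The overlap of the windows is resolved by the shifts 1, 0 and -1, each
    contributing at most \<open>?T\<close>. With the factor 3 from the window length this gives
    9.\<close>
  also have "\<dots> = 3 * (D 1 + D 0 + D (- 1))"
    unfolding D_def sum_distrib_left sum.distrib[symmetric] by (intro sum.cong) (auto simp: algebra_simps)
  also have "\<dots> \<le> 3 * (?T + ?T + ?T)" by (intro mult_left_mono add_mono D) simp
  also have "\<dots> = 9 * ?T" by simp
  finally have 9: "sq_integral (piecewise_deriv N P) \<le> 9 * ?T" .
  show ?thesis
  proof (rule that[OF w(1,2) _ _ 9])
    fix i x assume "i \<in> {1..N}" "x \<in> cell N i" "t (i - 1) = t i"
    then show "w x = u (t i)" using w(3) by (simp add: P s_def)
  next
    show "w 0 = u (t 0)" using w(3)[of 1 0] N by (simp add: P)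
  qed
qed

section \<open>Linear structure of the finite element space\<close>

lemma fe_space_primitive:
  assumes N: "1 \<le> N" and \<psi>: "\<psi> \<in> fe_space p N"
  obtains g where "primitive \<psi> g"
proof -
  have "\<forall>i\<in>{1..N}. \<exists>P. \<forall>x\<in>cell N i. \<psi> x = poly P x" using \<psi> unfolding fe_space_def by blast
  then obtain P where "\<And>i x. i \<in> {1..N} \<Longrightarrow> x \<in> cell N i \<Longrightarrow> \<psi> x = poly (P i) x" by metis
  moreover have "continuous_on {0..1} \<psi>" using \<psi> by (simp add: fe_space_def)
  ultimately have "primitive \<psi> (piecewise_deriv N P)" by (intro primitive_piecewise_deriv N)
  then show ?thesis by (rule that)
qed

lemma fe_space_cong:
  assumes N: "1 \<le> N" and \<psi>: "\<psi> \<in> fe_space p N" and eq: "\<And>x. x \<in> {0..1} \<Longrightarrow> \<phi> x = \<psi> x"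
  shows "\<phi> \<in> fe_space p N"
  unfolding fe_space_def
proof (intro CollectI conjI ballI)
  show "continuous_on {0..1} \<phi>"
    by (rule continuous_on_eq[of _ \<psi>]) (use \<psi> eq in \<open>auto simp: fe_space_def\<close>)
  fix i assume i: "i \<in> {1..N}"
  then obtain P :: "real poly" where "degree P \<le> p" "\<forall>x\<in>cell N i. \<psi> x = poly P x"
    using \<psi> unfolding fe_space_def by blast
  then show "\<exists>P. degree P \<le> p \<and> (\<forall>x\<in>cell N i. \<phi> x = poly P x)"
    using eq cell_subset[OF N i] by (metis subsetD)
qed

lemma fe_space_const: "(\<lambda>x. c) \<in> fe_space p N"
  unfolding fe_space_def by (auto intro!: exI[of _ "[:c:]"])

lemma fe_space_add:
  assumes "\<phi> \<in> fe_space p N" "\<psi> \<in> fe_space p N"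
  shows "(\<lambda>x. \<phi> x + \<psi> x) \<in> fe_space p N"
  unfolding fe_space_def
proof (intro CollectI conjI ballI)
  show "continuous_on {0..1} (\<lambda>x. \<phi> x + \<psi> x)"
    using assms by (intro continuous_intros) (auto simp: fe_space_def)
  fix i assume i: "i \<in> {1..N}"
  obtain P where P: "degree P \<le> p" "\<forall>x\<in>cell N i. \<phi> x = poly P x"
    using assms(1) i unfolding fe_space_def by blast
  obtain Q where Q: "degree Q \<le> p" "\<forall>x\<in>cell N i. \<psi> x = poly Q x"
    using assms(2) i unfolding fe_space_def by blast
  show "\<exists>P. degree P \<le> p \<and> (\<forall>x\<in>cell N i. \<phi> x + \<psi> x = poly P x)"
  proof (intro exI conjI)
    show "degree (P + Q) \<le> p" using P(1) Q(1) by (rule degree_add_le)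
    show "\<forall>x\<in>cell N i. \<phi> x + \<psi> x = poly (P + Q) x" using P(2) Q(2) by simp
  qed
qed

lemma fe_space_cmult:
  assumes "\<phi> \<in> fe_space p N" shows "(\<lambda>x. c * \<phi> x) \<in> fe_space p N"
  unfolding fe_space_def
proof (intro CollectI conjI ballI)
  show "continuous_on {0..1} (\<lambda>x. c * \<phi> x)"
    using assms by (intro continuous_intros) (auto simp: fe_space_def)
  fix i assume i: "i \<in> {1..N}"
  obtain P where P: "degree P \<le> p" "\<forall>x\<in>cell N i. \<phi> x = poly P x"
    using assms(1) i unfolding fe_space_def by blast
  show "\<exists>P. degree P \<le> p \<and> (\<forall>x\<in>cell N i. c * \<phi> x = poly P x)"
  proof (intro exI conjI)
    show "degree (Polynomial.smult c P) \<le> p" using degree_smult_le[of c P] P(1) by linarith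
    show "\<forall>x\<in>cell N i. c * \<phi> x = poly (Polynomial.smult c P) x" using P(2) by simp
  qed
qed

lemma fe_space_sum:
  assumes "\<And>i. i \<in> I \<Longrightarrow> \<psi> i \<in> fe_space p N"
  shows "(\<lambda>x. \<Sum>i\<in>I. c i * \<psi> i x) \<in> fe_space p N"
  using assms
proof (induction I rule: infinite_finite_induct)
  case (insert i I)
  then show ?case
    using fe_space_add[OF fe_space_cmult[of "\<psi> i" p N "c i"], of "\<lambda>x. \<Sum>i\<in>I. c i * \<psi> i x"] by simp
qed (use fe_space_const[of 0] in auto)

lemma fe_space_L2:
  assumes "\<psi> \<in> fe_space p N" shows "\<psi> \<in> L2_space"
  using assms by (intro continuous_L2) (simp add: fe_space_def)

lemma L2_inner_sum_left:
  assumes "\<And>i. i \<in> I \<Longrightarrow> f i \<in> L2_space" "g \<in> L2_space"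
  shows "L2_inner (\<lambda>x. \<Sum>i\<in>I. c i * f i x) g = (\<Sum>i\<in>I. c i * L2_inner (f i) g)"
proof -
  have "L2_inner (\<lambda>x. \<Sum>i\<in>I. c i * f i x) g = (LINT x|leb. (\<Sum>i\<in>I. c i * (f i x * g x)))"
    unfolding L2_inner_def by (simp add: sum_distrib_right mult.assoc)
  also have "\<dots> = (\<Sum>i\<in>I. LINT x|leb. c i * (f i x * g x))"
    by (intro Bochner_Integration.integral_sum integrable_mult_right L2_mult_integrable assms)
  finally show ?thesis by (simp add: L2_inner_def)
qed

lemma L2_inner_cong:
  assumes "\<And>x. x \<in> Omega \<Longrightarrow> f x = f' x" "\<And>x. x \<in> Omega \<Longrightarrow> g x = g' x"
  shows "L2_inner f g = L2_inner f' g'"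
  unfolding L2_inner_def using assms by (intro Bochner_Integration.integral_cong) auto

lemma L2_inner_commute: "L2_inner f g = L2_inner g f"
  by (simp add: L2_inner_def mult.commute)

lemma primitive_sum:
  assumes "\<And>i. i \<in> I \<Longrightarrow> primitive (u i) (g i)"
  shows "primitive (\<lambda>x. \<Sum>i\<in>I. c i * u i x) (\<lambda>x. \<Sum>i\<in>I. c i * g i x)"
  unfolding primitive_def
proof (intro conjI allI impI)
  show "(\<lambda>x. \<Sum>i\<in>I. c i * g i x) \<in> L2_space"
    by (intro L2_sum L2_cmult primitive_L2[OF assms])
  fix x y :: real assume xy: "0 \<le> x" "x \<le> y" "y \<le> 1"
  have i: "(g i has_integral (u i y - u i x)) {x..y}" if "i \<in> I" for i
    using L2_integrable_on(1)[OF primitive_L2[OF assms[OF that]] xy(1,3)] primitiveD[OF assms[OF that] xy]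
    by (simp add: has_integral_iff)
  have "((\<lambda>x. \<Sum>i\<in>I. c i * g i x) has_integral (\<Sum>i\<in>I. c i * (u i y - u i x))) {x..y}"
  proof (cases "finite I")
    case True
    then show ?thesis by (intro has_integral_sum has_integral_mult_right i)
  qed simp
  then show "(\<Sum>i\<in>I. c i * u i y) - (\<Sum>i\<in>I. c i * u i x) = integral {x..y} (\<lambda>x. \<Sum>i\<in>I. c i * g i x)"
    by (simp add: integral_unique sum_subtractf right_diff_distrib)
qed

lemma primitive_cong:
  assumes "primitive u g" "\<And>x. x \<in> {0..1} \<Longrightarrow> v x = u x"
  shows "primitive v g"
  using assms unfolding primitive_def by auto

lemma primitive_diff:
  assumes "primitive u g" "primitive v h" shows "primitive (\<lambda>x. u x - v x) (\<lambda>x. g x - h x)"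
  unfolding primitive_def
proof (intro conjI allI impI L2_diff primitive_L2[OF assms(1)] primitive_L2[OF assms(2)])
  fix x y :: real assume xy: "0 \<le> x" "x \<le> y" "y \<le> 1"
  have "integral {x..y} (\<lambda>x. g x - h x) = integral {x..y} g - integral {x..y} h"
    by (intro Henstock_Kurzweil_Integration.integral_diff L2_integrable_on(1) primitive_L2[OF assms(1)]
        primitive_L2[OF assms(2)] xy)
  then show "(u y - v y) - (u x - v x) = integral {x..y} (\<lambda>x. g x - h x)"
    using primitiveD[OF assms(1) xy] primitiveD[OF assms(2) xy] by simp
qed

lemma primitive_const: "primitive (\<lambda>x. c) (\<lambda>x. 0)"
  unfolding primitive_def using L2_const by simp

lemma primitive_weak_deriv: "primitive u g \<Longrightarrow> AE x in leb. weak_deriv 1 u x = g x"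
  by (intro has_weak_deriv_imp_weak_deriv primitive_has_weak_deriv)

lemma L2_inner_weak_deriv:
  assumes "primitive u g" "primitive v h"
  shows "L2_inner (weak_deriv 1 u) (weak_deriv 1 v) = L2_inner g h"
  by (intro L2_inner_AE_cong primitive_L2[OF assms(1)] primitive_L2[OF assms(2)]
      primitive_weak_deriv assms)

subsection \<open>The finite element kernel\<close>

lemma fe_space0_subset:
  assumes "\<phi> \<in> fe_space0 p N" shows "\<phi> \<in> fe_space p N" "(LINT x|leb. \<phi> x) = 0"
proof -
  obtain \<psi> where \<psi>: "\<psi> \<in> fe_space p N" "\<phi> = (\<lambda>x. \<psi> x - (LINT t|leb. \<psi> t))"
    using assms by (auto simp: fe_space0_def)
  show "\<phi> \<in> fe_space p N"
    using fe_space_add[OF \<psi>(1) fe_space_const[of "- (LINT t|leb. \<psi> t)"]] \<psi>(2) by simp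
  have "measure leb Omega = 1" by (simp add: measure_restrict_space)
  then show "(LINT x|leb. \<phi> x) = 0"
    using L2_integrable[OF fe_space_L2[OF \<psi>(1)]] finite_measure.integrable_const[OF finite_measure_leb]
    unfolding \<psi>(2) by (subst Bochner_Integration.integral_diff) auto
qed

lemma fe_space0_center:
  "w \<in> fe_space p N \<Longrightarrow> (\<lambda>x. w x - (LINT t|leb. w t)) \<in> fe_space0 p N"
  by (auto simp: fe_space0_def)

context
  fixes p N :: nat and \<psi> :: "nat \<Rightarrow> real \<Rightarrow> real" and \<mu> :: "nat \<Rightarrow> real"
  assumes N: "1 \<le> N" and eb: "fe_eigenbasis p N \<psi> \<mu>"
begin

lemma eigen_0: "x \<in> {0..1} \<Longrightarrow> \<psi> 0 x = 1" "\<mu> 0 = 0"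
  using eb by (auto simp: fe_eigenbasis_def)

lemma eigen_fe_space0: "i \<in> {1..p * N} \<Longrightarrow> \<psi> i \<in> fe_space0 p N"
  using eb by (auto simp: fe_eigenbasis_def)

lemma eigen_fe_space: "i \<le> p * N \<Longrightarrow> \<psi> i \<in> fe_space p N"
proof (cases "i = 0")
  case True
  then show ?thesis using eigen_0(1) by (intro fe_space_cong[OF N fe_space_const[of 1]]) auto
next
  case False
  moreover assume "i \<le> p * N"
  ultimately show ?thesis using fe_space0_subset(1)[OF eigen_fe_space0] by auto
qed

lemma eigen_L2: "i \<le> p * N \<Longrightarrow> \<psi> i \<in> L2_space"
  by (rule fe_space_L2[OF eigen_fe_space])

lemma eigen_weak:
  assumes "i \<in> {1..p * N}" "\<phi> \<in> fe_space0 p N"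
  shows "L2_inner (weak_deriv 1 (\<psi> i)) (weak_deriv 1 \<phi>) = \<mu> i * L2_inner (\<psi> i) \<phi>"
  using eb assms unfolding fe_eigenbasis_def by blast

lemma eigen_span:
  assumes "\<phi> \<in> fe_space0 p N"
  shows "\<exists>c. \<forall>x\<in>{0..1}. \<phi> x = (\<Sum>i=1..p * N. c i * \<psi> i x)"
  using eb assms unfolding fe_eigenbasis_def by blast

lemma L2_inner_eigen_0: "L2_inner (\<psi> 0) w = (LINT x|leb. w x)"
proof -
  have "L2_inner (\<psi> 0) w = L2_inner (\<lambda>x. 1) w"
    using eigen_0(1) by (intro L2_inner_cong) auto
  then show ?thesis by (simp add: L2_inner_def)
qed

lemma eigen_orthonormal:
  assumes "i \<le> p * N" "j \<le> p * N"
  shows "L2_inner (\<psi> i) (\<psi> j) = (if i = j then 1 else 0)"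
proof -
  have 0: "L2_inner (\<psi> 0) (\<psi> j) = (if 0 = j then 1 else 0)" if "j \<le> p * N" for j
  proof (cases "j = 0")
    case True
    have "L2_inner (\<psi> 0) (\<psi> 0) = (LINT x|leb. 1)"
      unfolding L2_inner_eigen_0 using eigen_0(1) by (intro Bochner_Integration.integral_cong) auto
    also have "\<dots> = 1" by (simp add: measure_restrict_space)
    finally show ?thesis using True by simp
  next
    case False
    then show ?thesis using fe_space0_subset(2)[OF eigen_fe_space0[of j]] that
      by (simp add: L2_inner_eigen_0)
  qed
  show ?thesis
  proof (cases "i = 0 \<or> j = 0")
    case True
    then show ?thesis using 0[OF assms(1)] 0[OF assms(2)] L2_inner_commute[of "\<psi> i" "\<psi> j"] by auto
  next
    case False
    then show ?thesis using eb assms by (simp add: fe_eigenbasis_def)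
  qed
qed

lemma eigen_expansion:
  assumes "w \<in> fe_space p N"
  obtains b where "\<And>x. x \<in> {0..1} \<Longrightarrow> w x = (\<Sum>i\<le>p * N. b i * \<psi> i x)"
proof -
  define m where "m = (LINT t|leb. w t)"
  obtain c where c: "\<And>x. x \<in> {0..1} \<Longrightarrow> w x - m = (\<Sum>i=1..p * N. c i * \<psi> i x)"
    using eigen_span[OF fe_space0_center[OF assms]] unfolding m_def by metis
  define b where "b i = (if i = 0 then m else c i)" for i
  have "w x = (\<Sum>i\<le>p * N. b i * \<psi> i x)" if x: "x \<in> {0..1}" for x
  proof -
    have "(\<Sum>i\<le>p * N. b i * \<psi> i x) = b 0 * \<psi> 0 x + (\<Sum>i=1..p * N. b i * \<psi> i x)"
      unfolding atMost_atLeast0 by (subst sum.atLeast_Suc_atMost) auto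
    also have "(\<Sum>i=1..p * N. b i * \<psi> i x) = (\<Sum>i=1..p * N. c i * \<psi> i x)"
      by (intro sum.cong) (auto simp: b_def)
    finally show ?thesis using c[OF x] eigen_0(1)[OF x] by (simp add: b_def)
  qed
  then show ?thesis by (rule that)
qed

lemma L2_inner_eigen_coeff:
  assumes w: "\<And>x. x \<in> {0..1} \<Longrightarrow> w x = (\<Sum>i\<le>p * N. b i * \<psi> i x)" and j: "j \<le> p * N"
  shows "L2_inner w (\<psi> j) = b j"
proof -
  have "L2_inner w (\<psi> j) = L2_inner (\<lambda>x. \<Sum>i\<le>p * N. b i * \<psi> i x) (\<psi> j)"
    using w by (intro L2_inner_cong) auto
  also have "\<dots> = (\<Sum>i\<le>p * N. b i * L2_inner (\<psi> i) (\<psi> j))"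
    using j by (intro L2_inner_sum_left eigen_L2) auto
  also have "\<dots> = (\<Sum>i\<le>p * N. if i = j then b i else 0)"
    using j by (intro sum.cong) (auto simp: eigen_orthonormal)
  finally show ?thesis using j by simp
qed

text \<open>The eigenvalue equation is given for mean-zero functions only. Centering
  \<open>w\<close> leaves its derivative unchanged and, since \<open>\<psi> i\<close> has mean zero
  for positive \<open>i\<close>, also its product with \<open>\<psi> i\<close>.\<close>

lemma L2_inner_eigen_deriv:
  assumes i: "i \<le> p * N" and g: "primitive (\<psi> i) g" and w: "w \<in> fe_space p N" and h: "primitive w h"
  shows "L2_inner g h = \<mu> i * L2_inner (\<psi> i) w"
proof (cases "i = 0")
  case True
  have "primitive (\<psi> 0) (\<lambda>x. 0)"
    using eigen_0(1) by (intro primitive_cong[OF primitive_const[of 1]])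
  then have "AE x in leb. g x = 0"
    using has_weak_deriv_unique[OF primitive_has_weak_deriv primitive_has_weak_deriv] g True by blast
  then have "L2_inner g h = L2_inner (\<lambda>x. 0) h"
    by (intro L2_inner_AE_cong L2_const primitive_L2[OF h]) auto
  then show ?thesis using True eigen_0(2) by (simp add: L2_inner_def)
next
  case False
  define m where "m = (LINT t|leb. w t)"
  have w0: "(\<lambda>x. w x - m) \<in> fe_space0 p N" unfolding m_def by (rule fe_space0_center[OF w])
  have h0: "primitive (\<lambda>x. w x - m) h" using primitive_diff[OF h primitive_const[of m]] by simp
  have "L2_inner g h = L2_inner (weak_deriv 1 (\<psi> i)) (weak_deriv 1 (\<lambda>x. w x - m))"
    by (rule L2_inner_weak_deriv[OF g h0, symmetric])
  also have "\<dots> = \<mu> i * L2_inner (\<psi> i) (\<lambda>x. w x - m)"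
    using i False by (intro eigen_weak w0) auto
  also have "L2_inner (\<psi> i) (\<lambda>x. w x - m) = L2_inner (\<psi> i) w - m * (LINT x|leb. \<psi> i x)"
    unfolding L2_inner_def right_diff_distrib
    using L2_mult_integrable[OF fe_space_L2[OF eigen_fe_space[OF i]] fe_space_L2[OF w]]
      L2_integrable[OF fe_space_L2[OF eigen_fe_space[OF i]]]
    by (subst Bochner_Integration.integral_diff) (auto simp: mult.commute)
  also have "(LINT x|leb. \<psi> i x) = 0"
    using fe_space0_subset(2)[OF eigen_fe_space0[of i]] i False by auto
  finally show ?thesis by simp
qed

text \<open>Rayleigh quotient: \<open>\<mu> i\<close> is the Dirichlet energy of the normalized
  \<open>\<psi> i\<close>.\<close>

lemma eigenvalue_nonneg:
  assumes "i \<le> p * N" shows "0 \<le> \<mu> i"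
proof -
  obtain g where g: "primitive (\<psi> i) g" using fe_space_primitive[OF N eigen_fe_space[OF assms]] .
  have "L2_inner g g = \<mu> i"
    using L2_inner_eigen_deriv[OF assms g eigen_fe_space[OF assms] g] eigen_orthonormal[OF assms assms] by simp
  then show ?thesis
    using L2_inner_self[OF primitive_L2[OF g]] integral_square_nonneg by metis
qed

text \<open>Parseval for the L^2 product and for the Dirichlet form at once. The weights
  \<open>1 + \<mu> i\<close> are the reciprocals of those in the kernel, which identifies its native
  norm as the H^1 norm.\<close>

lemma eigen_energy:
  assumes w: "\<And>x. x \<in> {0..1} \<Longrightarrow> w x = (\<Sum>i\<le>p * N. b i * \<psi> i x)" and g: "primitive w g"
  shows "sq_integral w + sq_integral g = (\<Sum>i\<le>p * N. (1 + \<mu> i) * (b i)\<^sup>2)"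
proof -
  have "(\<lambda>x. \<Sum>i\<le>p * N. b i * \<psi> i x) \<in> fe_space p N"
    by (intro fe_space_sum eigen_fe_space) auto
  from fe_space_cong[OF N this w] have wf: "w \<in> fe_space p N" by blast
  have coeff: "L2_inner w (\<psi> j) = b j" if "j \<le> p * N" for j
    using w that by (rule L2_inner_eigen_coeff)
  have "\<forall>i\<in>{..p * N}. \<exists>h. primitive (\<psi> i) h"
    using fe_space_primitive[OF N eigen_fe_space] by (metis atMost_iff)
  then obtain h where h: "\<And>i. i \<le> p * N \<Longrightarrow> primitive (\<psi> i) (h i)" by (metis atMost_iff)
  have "primitive (\<lambda>x. \<Sum>i\<le>p * N. b i * \<psi> i x) (\<lambda>x. \<Sum>i\<le>p * N. b i * h i x)"
    using h by (intro primitive_sum) auto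
  then have "primitive w (\<lambda>x. \<Sum>i\<le>p * N. b i * h i x)" using w by (rule primitive_cong)
  then have ae: "AE x in leb. g x = (\<Sum>i\<le>p * N. b i * h i x)"
    using has_weak_deriv_unique[OF primitive_has_weak_deriv[OF g] primitive_has_weak_deriv] by blast
  have sL: "(\<lambda>x. \<Sum>i\<le>p * N. b i * h i x) \<in> L2_space"
    using h by (intro L2_sum L2_cmult primitive_L2) auto
  have "L2_inner g g = L2_inner (\<lambda>x. \<Sum>i\<le>p * N. b i * h i x) g"
    using ae by (intro L2_inner_AE_cong sL primitive_L2[OF g]) auto
  also have "\<dots> = (\<Sum>i\<le>p * N. b i * L2_inner (h i) g)"
    using h by (intro L2_inner_sum_left primitive_L2[OF g] primitive_L2) auto
  also have "\<dots> = (\<Sum>i\<le>p * N. \<mu> i * (b i)\<^sup>2)"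
  proof (rule sum.cong[OF refl])
    fix i assume "i \<in> {..p * N}"
    then have i: "i \<le> p * N" by simp
    have "L2_inner (h i) g = \<mu> i * b i"
      using L2_inner_eigen_deriv[OF i h[OF i] wf g] coeff[OF i] by (simp add: L2_inner_commute)
    then show "b i * L2_inner (h i) g = \<mu> i * (b i)\<^sup>2" by (simp add: power2_eq_square)
  qed
  finally have 1: "sq_integral g = (\<Sum>i\<le>p * N. \<mu> i * (b i)\<^sup>2)"
    using L2_inner_self[OF primitive_L2[OF g]] by simp
  have "L2_inner w w = L2_inner (\<lambda>x. \<Sum>i\<le>p * N. b i * \<psi> i x) w"
    using w by (intro L2_inner_cong) auto
  also have "\<dots> = (\<Sum>i\<le>p * N. b i * L2_inner (\<psi> i) w)"
    by (intro L2_inner_sum_left fe_space_L2[OF wf] eigen_L2) auto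
  also have "\<dots> = (\<Sum>i\<le>p * N. (b i)\<^sup>2)"
    using coeff by (intro sum.cong) (auto simp: L2_inner_commute power2_eq_square)
  finally have "sq_integral w = (\<Sum>i\<le>p * N. (b i)\<^sup>2)"
    using L2_inner_self[OF fe_space_L2[OF wf]] by simp
  with 1 show ?thesis by (simp add: sum.distrib distrib_right)
qed

lemma kernel_combination:
  fixes xs :: "real list" and v :: "nat \<Rightarrow> real"
  shows "(\<Sum>j<n. fe_kernel p N \<psi> \<mu> x (xs ! j) * v j)
    = (\<Sum>i\<le>p * N. (inverse (1 + \<mu> i) * (\<Sum>j<n. v j * \<psi> i (xs ! j))) * \<psi> i x)"
proof -
  have "(\<Sum>j<n. fe_kernel p N \<psi> \<mu> x (xs ! j) * v j)
      = (\<Sum>j<n. \<Sum>i\<le>p * N. inverse (1 + \<mu> i) * \<psi> i x * \<psi> i (xs ! j) * v j)"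
    unfolding fe_kernel_def atMost_atLeast0 sum_distrib_right ..
  also have "\<dots> = (\<Sum>i\<le>p * N. \<Sum>j<n. inverse (1 + \<mu> i) * \<psi> i x * \<psi> i (xs ! j) * v j)"
    by (rule sum.swap)
  also have "\<dots> = (\<Sum>i\<le>p * N. (inverse (1 + \<mu> i) * (\<Sum>j<n. v j * \<psi> i (xs ! j))) * \<psi> i x)"
    by (intro sum.cong) (auto simp: sum_distrib_left sum_distrib_right algebra_simps)
  finally show ?thesis .
qed

text \<open>A sum of squares with positive weights: this shows semidefiniteness, and it shows that a
  null vector must annihilate the values of every eigenfunction on the design.\<close>

lemma kernel_quadratic_form:
  fixes xs :: "real list" and v :: "nat \<Rightarrow> real"
  shows "(\<Sum>i<n. v i * (\<Sum>j<n. fe_kernel p N \<psi> \<mu> (xs ! i) (xs ! j) * v j))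
    = (\<Sum>k\<le>p * N. inverse (1 + \<mu> k) * (\<Sum>j<n. v j * \<psi> k (xs ! j))\<^sup>2)"
proof -
  have "(\<Sum>i<n. v i * (\<Sum>j<n. fe_kernel p N \<psi> \<mu> (xs ! i) (xs ! j) * v j))
      = (\<Sum>i<n. \<Sum>k\<le>p * N. (inverse (1 + \<mu> k) * (\<Sum>j<n. v j * \<psi> k (xs ! j))) * (v i * \<psi> k (xs ! i)))"
    unfolding kernel_combination by (intro sum.cong) (auto simp: sum_distrib_left algebra_simps)
  also have "\<dots> = (\<Sum>k\<le>p * N. \<Sum>i<n. (inverse (1 + \<mu> k) * (\<Sum>j<n. v j * \<psi> k (xs ! j))) * (v i * \<psi> k (xs ! i)))"
    by (rule sum.swap)
  also have "\<dots> = (\<Sum>k\<le>p * N. inverse (1 + \<mu> k) * (\<Sum>j<n. v j * \<psi> k (xs ! j))\<^sup>2)"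
    by (intro sum.cong) (simp_all add: sum_distrib_left[symmetric] power2_eq_square mult.assoc)
  finally show ?thesis .
qed

text \<open>Representer theorem: the cross term in \<open>w - v\<close> vanishes by the normal equations.\<close>

lemma kernel_ridge_minimizes:
  fixes xs :: "real list" and \<alpha> Y b :: "nat \<Rightarrow> real" and l :: real and n :: nat
  defines "v \<equiv> \<lambda>x. \<Sum>j<n. fe_kernel p N \<psi> \<mu> x (xs ! j) * \<alpha> j"
    and "a \<equiv> \<lambda>i. inverse (1 + \<mu> i) * (\<Sum>j<n. \<alpha> j * \<psi> i (xs ! j))"
    and "w \<equiv> \<lambda>x. \<Sum>i\<le>p * N. b i * \<psi> i x"
  assumes l: "0 \<le> l" and normal: "\<And>j. j < n \<Longrightarrow> v (xs ! j) + l * \<alpha> j = Y j"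
  shows "(\<Sum>j<n. (v (xs ! j) - Y j)\<^sup>2) + l * (\<Sum>i\<le>p * N. (1 + \<mu> i) * (a i)\<^sup>2)
    \<le> (\<Sum>j<n. (w (xs ! j) - Y j)\<^sup>2) + l * (\<Sum>i\<le>p * N. (1 + \<mu> i) * (b i)\<^sup>2)"
proof -
  have v: "v x = (\<Sum>i\<le>p * N. a i * \<psi> i x)" for x
    unfolding v_def a_def by (rule kernel_combination)
  \<comment> \<open>Reproducing property: \<open>1 + \<mu> i\<close> cancels the inverse in
    \<open>a i\<close>, so the H^1 product of \<open>v\<close> with \<open>w - v\<close> becomes a
    sum of point values weighted by \<open>\<alpha>\<close>.\<close>
  have cross: "(\<Sum>i\<le>p * N. (1 + \<mu> i) * a i * (b i - a i)) = (\<Sum>j<n. \<alpha> j * (w (xs ! j) - v (xs ! j)))"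
  proof -
    have "(\<Sum>i\<le>p * N. (1 + \<mu> i) * a i * (b i - a i)) = (\<Sum>i\<le>p * N. (\<Sum>j<n. \<alpha> j * \<psi> i (xs ! j)) * (b i - a i))"
    proof (rule sum.cong[OF refl])
      fix i assume "i \<in> {..p * N}"
      then have "1 + \<mu> i \<noteq> 0" using eigenvalue_nonneg[of i] by auto
      then show "(1 + \<mu> i) * a i * (b i - a i) = (\<Sum>j<n. \<alpha> j * \<psi> i (xs ! j)) * (b i - a i)"
        by (simp add: a_def)
    qed
    also have "\<dots> = (\<Sum>i\<le>p * N. \<Sum>j<n. \<alpha> j * (b i * \<psi> i (xs ! j) - a i * \<psi> i (xs ! j)))"
      unfolding sum_distrib_right by (intro sum.cong refl) (simp add: algebra_simps)
    also have "\<dots> = (\<Sum>j<n. \<Sum>i\<le>p * N. \<alpha> j * (b i * \<psi> i (xs ! j) - a i * \<psi> i (xs ! j)))"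
      by (rule sum.swap)
    also have "\<dots> = (\<Sum>j<n. \<alpha> j * (w (xs ! j) - v (xs ! j)))"
      unfolding w_def v by (simp add: sum_distrib_left[symmetric] sum_subtractf)
    finally show ?thesis .
  qed
  \<comment> \<open>On the design \<open>v - Y\<close> equals \<open>- l * \<alpha>\<close>, so
    expanding the squares leaves the sum from \<open>cross\<close> with factor
    \<open>- 2 * l\<close>.\<close>
  have "(\<Sum>j<n. (w (xs ! j) - Y j)\<^sup>2) - (\<Sum>j<n. (v (xs ! j) - Y j)\<^sup>2)
      = (\<Sum>j<n. (w (xs ! j) - v (xs ! j))\<^sup>2 - 2 * l * (\<alpha> j * (w (xs ! j) - v (xs ! j))))"
    unfolding sum_subtractf[symmetric]
  proof (rule sum.cong[OF refl])
    fix j assume "j \<in> {..<n}"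
    then have Y: "Y j = v (xs ! j) + l * \<alpha> j" using normal[of j] by simp
    show "(w (xs ! j) - Y j)\<^sup>2 - (v (xs ! j) - Y j)\<^sup>2
        = (w (xs ! j) - v (xs ! j))\<^sup>2 - 2 * l * (\<alpha> j * (w (xs ! j) - v (xs ! j)))"
      unfolding Y by (simp add: power2_eq_square algebra_simps)
  qed
  also have "\<dots> \<ge> - 2 * l * (\<Sum>j<n. \<alpha> j * (w (xs ! j) - v (xs ! j)))"
    unfolding sum_subtractf by (simp add: sum_distrib_left[symmetric] sum_nonneg)
  finally have 1: "- 2 * l * (\<Sum>j<n. \<alpha> j * (w (xs ! j) - v (xs ! j)))
      \<le> (\<Sum>j<n. (w (xs ! j) - Y j)\<^sup>2) - (\<Sum>j<n. (v (xs ! j) - Y j)\<^sup>2)" .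
  \<comment> \<open>Convexity of the penalty, with the square of \<open>b i - a i\<close> dropped;
    multiplied by \<open>l\<close> it contributes the sum from \<open>cross\<close> with factor
    \<open>2 * l\<close>, cancelling the one above.\<close>
  have "2 * (\<Sum>i\<le>p * N. (1 + \<mu> i) * a i * (b i - a i))
      \<le> (\<Sum>i\<le>p * N. (1 + \<mu> i) * (b i)\<^sup>2) - (\<Sum>i\<le>p * N. (1 + \<mu> i) * (a i)\<^sup>2)"
    unfolding sum_distrib_left sum_subtractf[symmetric]
  proof (rule sum_mono)
    fix i assume "i \<in> {..p * N}"
    then have "0 \<le> (1 + \<mu> i) * (b i - a i)\<^sup>2" using eigenvalue_nonneg[of i] by simp
    then show "2 * ((1 + \<mu> i) * a i * (b i - a i)) \<le> (1 + \<mu> i) * (b i)\<^sup>2 - (1 + \<mu> i) * (a i)\<^sup>2"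
      by (simp add: power2_eq_square algebra_simps)
  qed
  then have "l * (2 * (\<Sum>j<n. \<alpha> j * (w (xs ! j) - v (xs ! j))))
      \<le> l * ((\<Sum>i\<le>p * N. (1 + \<mu> i) * (b i)\<^sup>2) - (\<Sum>i\<le>p * N. (1 + \<mu> i) * (a i)\<^sup>2))"
    unfolding cross using l by (rule mult_left_mono)
  with 1 show ?thesis by (simp add: algebra_simps)
qed

end

section \<open>Invertibility of the kernel matrices\<close>

lemma mat_injective_imp_Units:
  fixes A :: "real mat"
  assumes A: "A \<in> carrier_mat n n"
    and inj: "\<And>v. (\<And>i. i < n \<Longrightarrow> (\<Sum>j<n. A $$ (i, j) * v j) = 0) \<Longrightarrow> (\<forall>i<n. v i = (0::real))"
  shows "A \<in> Units (ring_mat TYPE(real) n ())" "invertible_mat A"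
proof -
  have "Determinant.det A \<noteq> 0"
  proof
    assume "Determinant.det A = 0"
    then obtain u where u: "u \<in> carrier_vec n" "u \<noteq> 0\<^sub>v n" "A *\<^sub>v u = 0\<^sub>v n"
      using det_0_iff_vec_prod_zero_field[OF A] by blast
    have "(\<Sum>j<n. A $$ (i, j) * vec_index u j) = 0" if "i < n" for i
    proof -
      have "vec_index (A *\<^sub>v u) i = (\<Sum>j<n. A $$ (i, j) * vec_index u j)"
        using A u(1) that by (simp add: scalar_prod_def lessThan_atLeast0)
      then show ?thesis using u(3) that by simp
    qed
    then have "\<forall>i<n. vec_index u i = 0" by (rule inj)
    then have "u = 0\<^sub>v n" using u(1) by (intro eq_vecI) auto
    then show False using u(2) by simp
  qed
  then show U: "A \<in> Units (ring_mat TYPE(real) n ())" by (rule det_non_zero_imp_unit[OF A])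
  then obtain B where "B \<in> carrier_mat n n" "B * A = 1\<^sub>m n" "A * B = 1\<^sub>m n"
    unfolding Units_def ring_mat_def by auto
  then show "invertible_mat A"
    using A by (auto simp: invertible_mat_def inverts_mat_def intro!: exI[of _ B])
qed

lemma fe_kernel_quadratic_form_nonneg:
  fixes v :: "nat \<Rightarrow> real"
  assumes "1 \<le> N" "fe_eigenbasis p N \<psi> \<mu>"
  shows "0 \<le> (\<Sum>k\<le>p * N. inverse (1 + \<mu> k) * (\<Sum>j<n. v j * \<psi> k (xs ! j))\<^sup>2)"
  using eigenvalue_nonneg[OF assms] by (intro sum_nonneg) auto

lemma kernel_mat_index:
  "i < length xs \<Longrightarrow> j < length xs \<Longrightarrow> kernel_mat \<Phi> xs $$ (i, j) = \<Phi> (xs ! i) (xs ! j)"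
  "kernel_mat \<Phi> xs \<in> carrier_mat (length xs) (length xs)"
  by (auto simp: kernel_mat_def)

text \<open>Pairing a null vector with the system gives a nonnegative quadratic form plus
  \<open>l\<close> times its squared norm, with total 0.\<close>

lemma regularized_kernel_mat_Units:
  assumes N: "1 \<le> N" and eb: "fe_eigenbasis p N \<psi> \<mu>" and l: "0 < l"
  shows "kernel_mat (fe_kernel p N \<psi> \<mu>) xs + l \<cdot>\<^sub>m 1\<^sub>m (length xs)
    \<in> Units (ring_mat TYPE(real) (length xs) ())" (is "?A \<in> _")
proof (rule mat_injective_imp_Units)
  let ?n = "length xs" let ?\<Phi> = "fe_kernel p N \<psi> \<mu>"
  show "?A \<in> carrier_mat ?n ?n" by (simp add: kernel_mat_def)
  fix v :: "nat \<Rightarrow> real" assume v: "\<And>i. i < ?n \<Longrightarrow> (\<Sum>j<?n. ?A $$ (i, j) * v j) = 0"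
  have "(\<Sum>j<?n. ?A $$ (i, j) * v j) = (\<Sum>j<?n. ?\<Phi> (xs ! i) (xs ! j) * v j) + l * v i" if i: "i < ?n" for i
  proof -
    have "(\<Sum>j<?n. ?A $$ (i, j) * v j) = (\<Sum>j<?n. ?\<Phi> (xs ! i) (xs ! j) * v j + (if j = i then l * v i else 0))"
      using i by (intro sum.cong) (auto simp: kernel_mat_def distrib_right)
    then show ?thesis using i by (simp add: sum.distrib)
  qed
  then have "0 = (\<Sum>i<?n. v i * ((\<Sum>j<?n. ?\<Phi> (xs ! i) (xs ! j) * v j) + l * v i))"
    using v by simp
  also have "\<dots> = (\<Sum>i<?n. v i * (\<Sum>j<?n. ?\<Phi> (xs ! i) (xs ! j) * v j)) + l * (\<Sum>i<?n. (v i)\<^sup>2)"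
    by (simp add: distrib_left sum.distrib sum_distrib_left power2_eq_square algebra_simps)
  finally have "l * (\<Sum>i<?n. (v i)\<^sup>2) \<le> 0"
    using fe_kernel_quadratic_form_nonneg[OF N eb, of v xs ?n] unfolding kernel_quadratic_form[OF N eb] by linarith
  then have "(\<Sum>i<?n. (v i)\<^sup>2) \<le> 0" using l by (simp add: mult_le_0_iff)
  then have "(\<Sum>i<?n. (v i)\<^sup>2) = 0" by (intro antisym sum_nonneg) auto
  then show "\<forall>i<?n. v i = 0" by (subst (asm) sum_nonneg_eq_0_iff) auto
qed

text \<open>Because the regularized matrix is a unit, \<open>mat_inverse\<close> returns a genuine
  inverse. The rows of the resulting linear system are the normal equations in the form used by
  \<open>kernel_ridge_minimizes\<close>.\<close>

lemma kernel_interp_representation: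
  assumes N: "1 \<le> N" and eb: "fe_eigenbasis p N \<psi> \<mu>" and l: "0 < l"
  shows "\<exists>\<alpha>.
    (\<forall>x. kernel_interp (fe_kernel p N \<psi> \<mu>) l xs f x = (\<Sum>j<length xs. fe_kernel p N \<psi> \<mu> x (xs ! j) * \<alpha> j)) \<and>
    (\<forall>j<length xs. kernel_interp (fe_kernel p N \<psi> \<mu>) l xs f (xs ! j) + l * \<alpha> j = f (xs ! j))"
proof -
  let ?n = "length xs" let ?\<Phi> = "fe_kernel p N \<psi> \<mu>"
  define A where "A = kernel_mat ?\<Phi> xs + l \<cdot>\<^sub>m 1\<^sub>m ?n"
  have A: "A \<in> carrier_mat ?n ?n" by (simp add: A_def kernel_mat_def)
  have "A \<in> Units (ring_mat TYPE(real) ?n ())"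
    unfolding A_def by (rule regularized_kernel_mat_Units[OF N eb l])
  then have "mat_inverse A \<noteq> None" using mat_inverse(1)[OF A, where b="()"] by blast
  then obtain B where B: "mat_inverse A = Some B" by blast
  have AB: "A * B = 1\<^sub>m ?n" "B \<in> carrier_mat ?n ?n" using mat_inverse(2)[OF A B] by auto
  define Y where "Y = Matrix.vec ?n (\<lambda>i. f (xs ! i))"
  define a where "a = B *\<^sub>v Y"
  have Y: "Y \<in> carrier_vec ?n" by (simp add: Y_def)
  have a: "a \<in> carrier_vec ?n" using AB(2) Y by (simp add: a_def)
  have Aa: "A *\<^sub>v a = Y"
    unfolding a_def using assoc_mult_mat_vec[OF A AB(2) Y] AB(1) Y by simp
  have 1: "kernel_interp ?\<Phi> l xs f x = (\<Sum>j<?n. ?\<Phi> x (xs ! j) * vec_index a j)" for x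
  proof -
    have "kernel_interp ?\<Phi> l xs f x = scalar_prod (kernel_vec ?\<Phi> xs x) a"
      unfolding kernel_interp_def A_def[symmetric] B a_def Y_def by simp
    then show ?thesis using a by (simp add: scalar_prod_def kernel_vec_def lessThan_atLeast0)
  qed
  have "kernel_interp ?\<Phi> l xs f (xs ! j) + l * vec_index a j = f (xs ! j)" if j: "j < ?n" for j
  proof -
    have "f (xs ! j) = vec_index (A *\<^sub>v a) j" using j by (simp add: Aa Y_def)
    also have "\<dots> = (\<Sum>i<?n. A $$ (j, i) * vec_index a i)"
      using A a j by (simp add: scalar_prod_def lessThan_atLeast0)
    also have "\<dots> = (\<Sum>i<?n. ?\<Phi> (xs ! j) (xs ! i) * vec_index a i + (if i = j then l * vec_index a j else 0))"
      using j by (intro sum.cong) (auto simp: A_def kernel_mat_def distrib_right)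
    finally show ?thesis using j by (simp add: 1 sum.distrib)
  qed
  with 1 show ?thesis by blast
qed

text \<open>A hat function is affine on the cells at its node and zero on all others; they serve
  below to isolate single design points.\<close>

lemma tent_fe_space:
  assumes N: "1 \<le> N" and p: "1 \<le> p"
  shows "(\<lambda>y. max 0 (1 - \<bar>real N * y - real k\<bar>)) \<in> fe_space p N"
  unfolding fe_space_def
proof (intro CollectI conjI ballI)
  show "continuous_on {0..1} (\<lambda>y. max 0 (1 - \<bar>real N * y - real k\<bar>))"
    by (intro continuous_intros)
  fix i assume i: "i \<in> {1..N}"
  define P where "P = (if i = k then [:1 - real k, real N:] else if i = k + 1 then [:1 + real k, - real N:] else 0)"
  have "max 0 (1 - \<bar>real N * y - real k\<bar>) = poly P y" if y: "y \<in> cell N i" for y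
  proof -
    have y': "real i - 1 \<le> real N * y" "real N * y \<le> real i" using y unfolding in_cell_iff[OF N] by auto
    consider "i = k" | "i = k + 1" | "i \<le> k - 1" "i \<noteq> k" | "k + 2 \<le> i" by linarith
    then show ?thesis
    proof cases
      case 3
      then have "real i \<le> real k - 1" by auto
      then show ?thesis using 3 y' by (simp add: P_def)
    next
      case 4
      then have "real k + 2 \<le> real i" by auto
      then show ?thesis using 4 y' by (simp add: P_def)
    qed (use y' in \<open>auto simp: P_def algebra_simps\<close>)
  qed
  moreover have "degree P \<le> p" using p by (simp add: P_def)
  ultimately show "\<exists>P. degree P \<le> p \<and> (\<forall>x\<in>cell N i. max 0 (1 - \<bar>real N * x - real k\<bar>) = poly P x)"
    by blast
qed

lemma finite_half_distances:
  fixes xs :: "real list"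
  shows "finite {\<bar>x - z\<bar> / 2 | x z. x \<in> set xs \<and> z \<in> set xs \<and> x \<noteq> z}"
proof (rule finite_subset)
  show "finite {\<bar>x - z\<bar> / 2 | x z. x \<in> set xs \<and> z \<in> set xs}"
    by (rule finite_image_set2) auto
qed blast

lemma separation_le:
  assumes d: "design xs" and xz: "x \<in> set xs" "z \<in> set xs" "x \<noteq> z"
  shows "2 * separation_radius xs \<le> \<bar>x - z\<bar>"
proof -
  let ?S = "{\<bar>x - z\<bar> / 2 | x z. x \<in> set xs \<and> z \<in> set xs \<and> x \<noteq> z}"
  have "finite ?S" by (rule finite_half_distances)
  moreover have "\<bar>x - z\<bar> / 2 \<in> ?S" using xz by blast
  ultimately have "separation_radius xs \<le> \<bar>x - z\<bar> / 2"
    unfolding separation_radius_def by (rule Min_le)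
  then show ?thesis by simp
qed

lemma separation_pos:
  assumes d: "design xs" and n: "2 \<le> length xs"
  shows "0 < separation_radius xs"
proof -
  let ?S = "{\<bar>x - z\<bar> / 2 | x z. x \<in> set xs \<and> z \<in> set xs \<and> x \<noteq> z}"
  have fin: "finite ?S" by (rule finite_half_distances)
  have "xs ! 0 \<noteq> xs ! 1" using d n by (auto simp: design_def nth_eq_iff_index_eq)
  moreover have "xs ! 0 \<in> set xs" "xs ! 1 \<in> set xs" using n by (auto intro!: nth_mem)
  ultimately have "\<bar>xs ! 0 - xs ! 1\<bar> / 2 \<in> ?S" by blast
  then have "?S \<noteq> {}" by blast
  with fin have "Min ?S \<in> ?S" by (rule Min_in)
  then show ?thesis unfolding separation_radius_def by auto
qed

text \<open>A null vector annihilates every eigenfunction, hence every finite element function, on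
  the design. Hat functions are then fine enough to test its components one by one.\<close>

lemma kernel_mat_invertible:
  assumes N: "1 \<le> N" and p: "1 \<le> p" and eb: "fe_eigenbasis p N \<psi> \<mu>"
    and d: "design xs" and q: "1 / real N < separation_radius xs"
  shows "invertible_mat (kernel_mat (fe_kernel p N \<psi> \<mu>) xs)" (is "invertible_mat ?A")
proof (rule mat_injective_imp_Units(2))
  let ?n = "length xs" let ?\<Phi> = "fe_kernel p N \<psi> \<mu>"
  show "?A \<in> carrier_mat ?n ?n" by (rule kernel_mat_index)
  fix v :: "nat \<Rightarrow> real" assume v: "\<And>i. i < ?n \<Longrightarrow> (\<Sum>j<?n. ?A $$ (i, j) * v j) = 0"
  have "(\<Sum>j<?n. ?\<Phi> (xs ! i) (xs ! j) * v j) = 0" if i: "i < ?n" for i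
    using v[OF i] i by (simp add: kernel_mat_index)
  then have "(\<Sum>k\<le>p * N. inverse (1 + \<mu> k) * (\<Sum>j<?n. v j * \<psi> k (xs ! j))\<^sup>2) = 0"
    unfolding kernel_quadratic_form[OF N eb, symmetric] by simp
  then have 0: "(\<Sum>j<?n. v j * \<psi> k (xs ! j)) = 0" if "k \<le> p * N" for k
    using that eigenvalue_nonneg[OF N eb]
    by (subst (asm) sum_nonneg_eq_0_iff) (auto simp: add_nonneg_eq_0_iff)
  have V: "(\<Sum>j<?n. v j * w (xs ! j)) = 0" if w: "w \<in> fe_space p N" for w
  proof -
    obtain b where b: "\<And>x. x \<in> {0..1} \<Longrightarrow> w x = (\<Sum>i\<le>p * N. b i * \<psi> i x)"
      using eigen_expansion[OF N eb w] by metis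
    have "xs ! j \<in> {0..1}" if "j < ?n" for j
      using d nth_mem[OF that] by (force simp: design_def)
    then have "(\<Sum>j<?n. v j * w (xs ! j)) = (\<Sum>j<?n. \<Sum>i\<le>p * N. b i * (v j * \<psi> i (xs ! j)))"
      by (intro sum.cong) (auto simp: b sum_distrib_left algebra_simps)
    also have "\<dots> = (\<Sum>i\<le>p * N. \<Sum>j<?n. b i * (v j * \<psi> i (xs ! j)))" by (rule sum.swap)
    also have "\<dots> = 0" using 0 by (simp add: sum_distrib_left[symmetric])
    finally show ?thesis .
  qed
  show "\<forall>i<?n. v i = 0"
  proof (intro allI impI)
    fix i assume i: "i < ?n"
    define x where "x = xs ! i"
    have x: "x \<in> set xs" "0 < x" using d nth_mem[OF i] by (auto simp: design_def x_def)
    \<comment> \<open>The node at or just to the left of \<open>x\<close>. Its hat is positive at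
      \<open>x\<close>, whereas every other design point is more than 2/N away from
      \<open>x\<close>, hence more than 1/N from the node.\<close>
    define k where "k = nat \<lfloor>real N * x\<rfloor>"
    have "real k = of_int \<lfloor>real N * x\<rfloor>" using x(2) by (simp add: k_def)
    then have k: "real k \<le> real N * x" "real N * x < real k + 1" by linarith+
    define w where "w y = max 0 (1 - \<bar>real N * y - real k\<bar>)" for y
    have w0: "w (xs ! j) = 0" if j: "j < ?n" "j \<noteq> i" for j
    proof -
      have "xs ! j \<noteq> x" using d i j by (auto simp: design_def x_def nth_eq_iff_index_eq)
      then have "2 * separation_radius xs \<le> \<bar>xs ! j - x\<bar>" using j by (intro separation_le[OF d] x) auto
      then have "2 / real N < \<bar>xs ! j - x\<bar>" using q by simp
      then have "2 < real N * \<bar>xs ! j - x\<bar>" using N by (simp add: field_simps)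
      then have "2 < \<bar>real N * xs ! j - real N * x\<bar>"
        by (metis abs_mult abs_of_nat right_diff_distrib)
      then show ?thesis using k unfolding w_def by auto
    qed
    have "(\<Sum>j<?n. v j * w (xs ! j)) = 0"
      unfolding w_def by (rule V[OF tent_fe_space[OF N p]])
    moreover have "(\<Sum>j<?n. v j * w (xs ! j)) = (\<Sum>j<?n. if j = i then v i * w x else 0)"
      using w0 by (intro sum.cong) (auto simp: x_def)
    ultimately have "v i * w x = 0" using i by simp
    moreover have "w x > 0" using k by (auto simp: w_def)
    ultimately show "v i = 0" by simp
  qed
qed

section \<open>From a competitor to the interpolation error\<close>

lemma sum_design_nth:
  assumes "design xs" shows "(\<Sum>z\<in>set xs. \<phi> z) = (\<Sum>j<length xs. \<phi> (xs ! j))"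
proof -
  have "inj_on ((!) xs) {..<length xs}" using assms by (intro inj_on_nth) (auto simp: design_def)
  moreover have "set xs = (!) xs ` {..<length xs}" by (auto simp: set_conv_nth)
  ultimately show ?thesis by (simp add: sum.reindex)
qed

lemma sum_of_squares_bound: "((x::real) - y)\<^sup>2 \<le> 2 * x\<^sup>2 + 2 * y\<^sup>2"
  using zero_le_power2[of "x + y"] by (simp add: power2_eq_square algebra_simps)

abbreviation interp_error where
  "interp_error p N \<psi> \<mu> l xs f \<equiv> \<lambda>x. f x - kernel_interp (fe_kernel p N \<psi> \<mu>) l xs f x"

text \<open>A competitor \<open>w\<close> that is \<open>B\<close>-close to \<open>f\<close> on the design and bounded in \<open>H\<^sup>1\<close> controls the
  minimizer; the sampling inequalities then turn discrete into continuous bounds.\<close>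

lemma kernel_interp_error:
  fixes A B S c1 c2 :: real
  assumes N: "1 \<le> N" and eb: "fe_eigenbasis p N \<psi> \<mu>" and d: "design xs"
    and c: "0 < c1" "0 < c2" and par: "param_choice c1 c2 xs l"
    and F: "primitive F F'" "\<And>x. x \<in> Omega \<Longrightarrow> F x = f x"
    and FS: "sq_integral F' \<le> S"
    and w: "w \<in> fe_space p N" "primitive w g"
    and wB: "(\<Sum>z\<in>set xs. (w z - f z)\<^sup>2) \<le> B * S"
    and wA: "sq_integral w + sq_integral g \<le> A * S"
    and AB: "0 \<le> A" "0 \<le> B" "0 \<le> S"
    and C0: "C0 = 3 + 2 / c1\<^sup>2 + c2\<^sup>2 * A + 2 * A"
  shows "(L2_norm (interp_error p N \<psi> \<mu> l xs f))\<^sup>2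
      \<le> 4 * C0 * fill_distance xs * (B + fill_distance xs) * S"
    and "Linf_norm (interp_error p N \<psi> \<mu> l xs f)
      \<le> ereal (sqrt (2 * C0 * (B + fill_distance xs) * S))"
proof -
  let ?n = "length xs" let ?\<Phi> = "fe_kernel p N \<psi> \<mu>"
  define h where "h = fill_distance xs"
  have h: "0 < h" using fill_distance_pos[OF d] by (simp add: h_def)
  have sl: "c1 * sqrt h \<le> sqrt l" "sqrt l \<le> c2 * sqrt h" "0 \<le> l"
    using par by (auto simp: param_choice_def h_def)
  \<comment> \<open>Squaring gives \<open>c1\<^sup>2 * h \<le> l \<le> c2\<^sup>2 * h\<close>: the
    lower bound controls the energy of \<open>v\<close>, the upper one its misfit.\<close>
  have "(c1 * sqrt h)\<^sup>2 \<le> (sqrt l)\<^sup>2" using sl c h by (intro power_mono) auto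
  then have l1: "c1\<^sup>2 * h \<le> l" using h sl by (simp add: power_mult_distrib)
  have "(sqrt l)\<^sup>2 \<le> (c2 * sqrt h)\<^sup>2" using sl by (intro power_mono) auto
  then have l2: "l \<le> c2\<^sup>2 * h" using h sl by (simp add: power_mult_distrib)
  have "0 < c1\<^sup>2 * h" using c h by simp
  with l1 have l: "0 < l" by linarith
  obtain \<alpha> where \<alpha>: "\<And>x. kernel_interp ?\<Phi> l xs f x = (\<Sum>j<?n. ?\<Phi> x (xs ! j) * \<alpha> j)"
    "\<And>j. j < ?n \<Longrightarrow> kernel_interp ?\<Phi> l xs f (xs ! j) + l * \<alpha> j = f (xs ! j)"
    using kernel_interp_representation[OF N eb l, of xs f] by blast
  define v where "v = kernel_interp ?\<Phi> l xs f"
  define a where "a i = inverse (1 + \<mu> i) * (\<Sum>j<?n. \<alpha> j * \<psi> i (xs ! j))" for i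
  have va: "v x = (\<Sum>i\<le>p * N. a i * \<psi> i x)" for x
    unfolding v_def \<alpha>(1) a_def by (rule kernel_combination[OF N eb])
  have vf: "v \<in> fe_space p N"
    unfolding va[abs_def] by (intro fe_space_sum eigen_fe_space[OF N eb]) auto
  obtain g' where g': "primitive v g'" using fe_space_primitive[OF N vf] .
  obtain b where b: "\<And>x. x \<in> {0..1} \<Longrightarrow> w x = (\<Sum>i\<le>p * N. b i * \<psi> i x)"
    using eigen_expansion[OF N eb w(1)] by metis
  have xs01: "xs ! j \<in> {0<..<1}" if "j < ?n" for j
    using d nth_mem[OF that] unfolding design_def by blast
  have wx: "w (xs ! j) = (\<Sum>i\<le>p * N. b i * \<psi> i (xs ! j))" if "j < ?n" for j
    using xs01[OF that] by (intro b) auto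
  have Fx: "F (xs ! j) = f (xs ! j)" if "j < ?n" for j
    using xs01[OF that] by (rule F(2))
  define X where "X = (\<Sum>z\<in>set xs. (F z - v z)\<^sup>2)"
  have min: "X + l * (sq_integral v + sq_integral g') \<le> B * S + l * (A * S)"
  proof -
    have "(\<Sum>j<?n. ((\<Sum>i<?n. ?\<Phi> (xs ! j) (xs ! i) * \<alpha> i) - f (xs ! j))\<^sup>2) + l * (\<Sum>i\<le>p * N. (1 + \<mu> i) * (a i)\<^sup>2)
      \<le> (\<Sum>j<?n. ((\<Sum>i\<le>p * N. b i * \<psi> i (xs ! j)) - f (xs ! j))\<^sup>2) + l * (\<Sum>i\<le>p * N. (1 + \<mu> i) * (b i)\<^sup>2)"
      unfolding a_def
      by (rule kernel_ridge_minimizes[OF N eb]) (use l \<alpha>(2) in \<open>auto simp: \<alpha>(1)\<close>)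
    also have "(\<Sum>j<?n. ((\<Sum>i\<le>p * N. b i * \<psi> i (xs ! j)) - f (xs ! j))\<^sup>2) = (\<Sum>z\<in>set xs. (w z - f z)\<^sup>2)"
      unfolding sum_design_nth[OF d] by (intro sum.cong) (auto simp: wx)
    also have "(\<Sum>i\<le>p * N. (1 + \<mu> i) * (b i)\<^sup>2) = sq_integral w + sq_integral g"
      using eigen_energy[OF N eb _ w(2)] b by simp
    also have "(\<Sum>j<?n. ((\<Sum>i<?n. ?\<Phi> (xs ! j) (xs ! i) * \<alpha> i) - f (xs ! j))\<^sup>2) = X"
      unfolding X_def sum_design_nth[OF d] \<alpha>(1)[symmetric] v_def[symmetric]
      by (intro sum.cong) (auto simp: Fx power2_commute)
    also have "(\<Sum>i\<le>p * N. (1 + \<mu> i) * (a i)\<^sup>2) = sq_integral v + sq_integral g'"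
      using eigen_energy[OF N eb _ g'] va by simp
    also have "(\<Sum>z\<in>set xs. (w z - f z)\<^sup>2) + l * (sq_integral w + sq_integral g)
        \<le> B * S + l * (A * S)"
      using wB wA l by (intro add_mono mult_left_mono) auto
    finally show ?thesis .
  qed
  define V where "V = sq_integral g'"
  have v0: "0 \<le> sq_integral v" "0 \<le> V" unfolding V_def by (rule integral_square_nonneg)+
  have X0: "0 \<le> X" unfolding X_def by (intro sum_nonneg) auto
  have "X \<le> B * S + l * (A * S)"
    using min l v0 unfolding V_def[symmetric] by (smt (verit) mult_nonneg_nonneg)
  also have "\<dots> \<le> B * S + (c2\<^sup>2 * h) * (A * S)"
    using l2 AB by (intro add_left_mono mult_right_mono) auto
  finally have X: "X \<le> (B + c2\<^sup>2 * h * A) * S" by (simp add: algebra_simps)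
  have "l * V \<le> B * S + l * (A * S)"
    using min l v0 X0 unfolding V_def[symmetric] by (simp add: distrib_left) (smt (verit) mult_nonneg_nonneg)
  then have "l * (V - A * S) \<le> B * S" by (simp add: algebra_simps)
  have "c1\<^sup>2 * (h * (V - A * S)) \<le> B * S"
  \<comment> \<open>Replacing \<open>l\<close> by its lower bound needs the sign of
    \<open>V - A * S\<close>; if it is not positive the claim is immediate.\<close>
  proof (cases "V - A * S \<le> 0")
    case True
    then have "c1\<^sup>2 * (h * (V - A * S)) \<le> 0" using h by (simp add: mult_nonneg_nonpos)
    also have "0 \<le> B * S" using AB by simp
    finally show ?thesis .
  next
    case False
    then have "(c1\<^sup>2 * h) * (V - A * S) \<le> l * (V - A * S)" using l1 by (intro mult_right_mono) auto
    then show ?thesis using \<open>l * (V - A * S) \<le> B * S\<close> by (simp add: mult.assoc)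
  qed
  then have "h * (V - A * S) \<le> B * S / c1\<^sup>2" using c by (simp add: field_simps)
  then have hV: "h * V \<le> (B / c1\<^sup>2 + h * A) * S" by (simp add: algebra_simps)
  define e where "e x = F x - v x" for x
  define e' where "e' x = F' x - g' x" for x
  have e: "primitive e e'" unfolding e_def e'_def by (rule primitive_diff[OF F(1) g'])
  define Z where "Z = sq_integral e'"
  have "Z \<le> integral {0..1} (\<lambda>x. 2 * (F' x)\<^sup>2 + 2 * (g' x)\<^sup>2)"
    unfolding Z_def
    using L2_integrable_on(2)[OF primitive_L2[OF e]] L2_integrable_on(2)[OF primitive_L2[OF F(1)]]
      L2_integrable_on(2)[OF primitive_L2[OF g']]
    by (intro integral_le integrable_add integrable_on_mult_right) (auto simp: e'_def sum_of_squares_bound)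
  also have "\<dots> = 2 * sq_integral F' + 2 * V"
    unfolding V_def using L2_integrable_on(2)[OF primitive_L2[OF F(1)]]
      L2_integrable_on(2)[OF primitive_L2[OF g']]
    by (intro integral_unique has_integral_add has_integral_mult_right integrable_integral) auto
  also have "\<dots> \<le> 2 * S + 2 * V" using FS by simp
  finally have "h * Z \<le> h * (2 * S + 2 * V)" using h by (intro mult_left_mono) auto
  also have "\<dots> = 2 * h * S + 2 * (h * V)" by (simp add: algebra_simps)
  also have "\<dots> \<le> 2 * h * S + 2 * ((B / c1\<^sup>2 + h * A) * S)" using hV by (intro add_left_mono mult_left_mono) auto
  finally have Z: "h * Z \<le> 2 * h * S + 2 * ((B / c1\<^sup>2 + h * A) * S)" .
  have "X + h * Z \<le> (B + c2\<^sup>2 * h * A) * S + (2 * h * S + 2 * ((B / c1\<^sup>2 + h * A) * S))"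
    using X Z by (rule add_mono)
  also have "\<dots> = (B * (1 + 2 / c1\<^sup>2) + h * (2 + c2\<^sup>2 * A + 2 * A)) * S"
    by (simp add: algebra_simps)
  \<comment> \<open>\<open>C0\<close> is the sum of the two coefficients, of \<open>B\<close> and of
    \<open>h\<close>, and so bounds each of them.\<close>
  also have "\<dots> \<le> (B * C0 + h * C0) * S"
  proof -
    have "0 \<le> c2\<^sup>2 * A" "0 \<le> 2 / c1\<^sup>2" using AB by auto
    then have "1 + 2 / c1\<^sup>2 \<le> C0" "2 + c2\<^sup>2 * A + 2 * A \<le> C0" using AB(1) unfolding C0 by linarith+
    then show ?thesis using AB h by (intro mult_right_mono add_mono mult_left_mono) auto
  qed
  finally have XZ: "X + h * Z \<le> C0 * (B + h) * S" by (simp add: algebra_simps)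
  have ef: "f x - kernel_interp ?\<Phi> l xs f x = e x" if "x \<in> Omega" for x
    using F(2)[OF that] by (simp add: e_def v_def)
  have Xe: "(\<Sum>z\<in>set xs. (e z)\<^sup>2) = X" by (simp add: X_def e_def)
  have eL: "e \<in> L2_space" by (intro continuous_L2 primitive_continuous[OF e])
  have "L2_inner (interp_error p N \<psi> \<mu> l xs f) (interp_error p N \<psi> \<mu> l xs f) = L2_inner e e"
    using ef by (intro L2_inner_cong) auto
  then have "(L2_norm (interp_error p N \<psi> \<mu> l xs f))\<^sup>2 = sq_integral e"
    using integral_square_nonneg[of "{0..1}" e] by (simp add: L2_norm_def L2_inner_self[OF eL])
  also have "\<dots> \<le> 4 * h * X + 4 * h\<^sup>2 * Z"
    using sampling_L2[OF e d h_def] unfolding Xe Z_def .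
  also have "\<dots> = 4 * h * (X + h * Z)" by (simp add: power2_eq_square algebra_simps)
  also have "\<dots> \<le> 4 * h * (C0 * (B + h) * S)" using XZ h by (intro mult_left_mono) auto
  finally show "(L2_norm (interp_error p N \<psi> \<mu> l xs f))\<^sup>2 \<le> 4 * C0 * fill_distance xs * (B + fill_distance xs) * S"
    by (simp add: h_def algebra_simps)
  have "\<bar>e x\<bar> \<le> sqrt (2 * C0 * (B + h) * S)" if x: "x \<in> Omega" for x
  proof -
    have "(e x)\<^sup>2 \<le> 2 * X + 2 * h * Z"
      using sampling_sup[OF e d x] unfolding Xe Z_def h_def[symmetric] .
    also have "\<dots> \<le> 2 * C0 * (B + h) * S" using XZ by (simp add: algebra_simps)
    finally have "sqrt ((e x)\<^sup>2) \<le> sqrt (2 * C0 * (B + h) * S)" by (rule real_sqrt_le_mono)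
    then show ?thesis by simp
  qed
  then have bd: "AE x in leb. ereal \<bar>f x - kernel_interp ?\<Phi> l xs f x\<bar> \<le> ereal (sqrt (2 * C0 * (B + h) * S))"
    using ef by (intro AE_I2) auto
  \<comment> \<open>The essential supremum asks for a measurable error, which continuity on the open
    interval provides.\<close>
  have "continuous_on Omega e"
    by (rule continuous_on_subset[OF primitive_continuous[OF e]]) auto
  then have "continuous_on Omega (interp_error p N \<psi> \<mu> l xs f)"
    by (rule continuous_on_eq) (use ef in auto)
  then have "(interp_error p N \<psi> \<mu> l xs f) \<in> borel_measurable leb"
    by (rule continuous_imp_leb_measurable)
  then have "(\<lambda>x. ereal \<bar>f x - kernel_interp ?\<Phi> l xs f x\<bar>) \<in> borel_measurable leb"
    by (intro borel_measurable_ereal borel_measurable_abs)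
  then show "Linf_norm (interp_error p N \<psi> \<mu> l xs f) \<le> ereal (sqrt (2 * C0 * (B + fill_distance xs) * S))"
    unfolding Linf_norm_def using bd unfolding h_def by (rule esssup_I)
qed

subsection \<open>Error estimates\<close>

lemma power2_sum_le_sum_power2: "0 \<le> x \<Longrightarrow> 0 \<le> y \<Longrightarrow> (x::real)\<^sup>2 + y\<^sup>2 \<le> (x + y)\<^sup>2"
  by (simp add: power2_sum)

lemma has_integral_const_unit: "((\<lambda>x. k) has_integral k) {0..1::real}" for k :: real
  using has_integral_const_real[of k 0 1] by simp

text \<open>The piecewise Taylor competitor has misfit at most \<open>4 * \<epsilon> * S\<close> at
  each of the \<open>n\<close> design points, so \<open>kernel_interp_error\<close> applies with
  \<open>B = n * (4 * \<epsilon>)\<close>.\<close>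

lemma kernel_interp_rate:
  fixes c1 c2 :: real and p s0 :: nat
  assumes p: "1 \<le> p" and s0: "1 \<le> s0" and c: "0 < c1" "0 < c2"
    and N: "1 \<le> N" and d: "design xs" and eb: "fe_eigenbasis p N \<psi> \<mu>"
    and f: "f \<in> Sobolev_cont s0" and par: "param_choice c1 c2 xs l"
    and C: "C = 4 * sqrt (41 + 2 / c1\<^sup>2 + 19 * c2\<^sup>2)"
    and r: "r = real N powr (- (real (min (p + 1) s0) - 1 / 2))"
  shows "L2_norm (interp_error p N \<psi> \<mu> l xs f)
      \<le> C * (sqrt (real (length xs) * fill_distance xs) * r + fill_distance xs) * Sobolev_norm s0 f"
    and "Linf_norm (interp_error p N \<psi> \<mu> l xs f)
      \<le> ereal (C * (sqrt (real (length xs)) * r + sqrt (fill_distance xs)) * Sobolev_norm s0 f)"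
proof -
  \<comment> \<open>The largest degree that fits the elements and leaves \<open>m + 1\<close>
    derivatives of \<open>f\<close> available; m + 1/2 is the exponent in \<open>r\<close>.\<close>
  define m where "m = min (p + 1) s0 - 1"
  have m: "Suc m = min (p + 1) s0" using s0 by (simp add: m_def)
  then have mp: "m \<le> p" "Suc m \<le> s0" by auto
  define s where "s = Sobolev_norm s0 f"
  define S where "S = s\<^sup>2"
  have s: "0 \<le> s" unfolding s_def by (rule Sobolev_norm_nonneg)
  have S: "0 \<le> S" by (simp add: S_def)
  obtain F where F: "\<And>k. k < Suc m \<Longrightarrow> primitive (F k) (F (Suc k))"
    "\<And>x. x \<in> Omega \<Longrightarrow> F 0 x = f x"
    "\<And>k. k \<le> Suc m \<Longrightarrow> sq_integral (F k) \<le> S"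
    using Sobolev_cont_chain[OF f _ mp(2)] unfolding S_def s_def by (metis One_nat_def Suc_le_mono le0)
  have Fp: "primitive (F k) (F (Suc k))" if "k \<le> m" for k using F(1) that by simp
  define \<epsilon> where "\<epsilon> = (1 / real N) ^ (2 * m + 1)"
  have \<epsilon>: "0 \<le> \<epsilon>" "\<epsilon> \<le> 1" using N unfolding \<epsilon>_def by (simp, intro power_le_one) auto
  obtain w g where w: "w \<in> fe_space p N" "primitive w g"
    "\<And>x. x \<in> {0..1} \<Longrightarrow> (F 0 x - w x)\<^sup>2 \<le> 4 * \<epsilon> * sq_integral (F (Suc m))"
    "sq_integral g \<le> 3 * sq_integral (F 1) + 6 * sq_integral (F (Suc m))"
    using fe_taylor_approx[where F=F, OF N mp(1) p Fp] unfolding \<epsilon>_def by blast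
  have gS: "sq_integral g \<le> 9 * S" using w(4) F(3)[of 1] F(3)[of "Suc m"] by auto
  have err: "(F 0 x - w x)\<^sup>2 \<le> 4 * \<epsilon> * S" if "x \<in> {0..1}" for x
  proof -
    have "4 * \<epsilon> * sq_integral (F (Suc m)) \<le> 4 * \<epsilon> * S"
      using \<epsilon> F(3)[of "Suc m"] by (intro mult_left_mono) auto
    then show ?thesis using w(3)[OF that] by linarith
  qed
  \<comment> \<open>Splitting the square gives 2 for \<open>F 0\<close> and 2 times 4 for the error,
    using \<open>\<epsilon> \<le> 1\<close>. Together with the 9 for \<open>g\<close> this is the 19
    below.\<close>
  have wS: "sq_integral w \<le> 10 * S"
  proof -
    have iF: "(\<lambda>x. (F 0 x)\<^sup>2) integrable_on {0..1}"
      by (intro integrable_continuous_real continuous_intros primitive_continuous[OF Fp]) simp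
    have iw: "(\<lambda>x. (w x)\<^sup>2) integrable_on {0..1}"
      by (intro integrable_continuous_real continuous_intros primitive_continuous[OF w(2)])
    have "(w x)\<^sup>2 \<le> 2 * (F 0 x)\<^sup>2 + 8 * S" if "x \<in> {0..1}" for x
    proof -
      have "4 * \<epsilon> * S \<le> 4 * 1 * S" using \<epsilon> S by (intro mult_right_mono mult_left_mono) auto
      then have "(F 0 x - w x)\<^sup>2 \<le> 4 * S" using err[OF that] by linarith
      moreover have "(w x)\<^sup>2 \<le> 2 * (F 0 x)\<^sup>2 + 2 * (F 0 x - w x)\<^sup>2"
        using sum_of_squares_bound[of "F 0 x" "F 0 x - w x"] by simp
      ultimately show ?thesis by linarith
    qed
    moreover have R: "((\<lambda>x. 2 * (F 0 x)\<^sup>2 + 8 * S) has_integral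
        (2 * sq_integral (F 0) + 8 * S)) {0..1}"
      by (rule has_integral_add[OF has_integral_mult_right[OF integrable_integral[OF iF]] has_integral_const_unit])
    ultimately have "sq_integral w \<le> 2 * sq_integral (F 0) + 8 * S"
      by (intro has_integral_le[OF integrable_integral[OF iw] R]) auto
    then show ?thesis using F(3)[of 0] by linarith
  qed
  define n where "n = real (length xs)"
  define h where "h = fill_distance xs"
  have h: "0 \<le> h" using fill_distance_pos[OF d] by (simp add: h_def)
  \<comment> \<open>\<open>A = 19\<close>, and 3 + 2 * 19 = 41. The factor 4 in \<open>C\<close> is
    the root of 16, the product of the 4 from sampling and the 4 from the misfit.\<close>
  define C0 where "C0 = 3 + 2 / c1\<^sup>2 + c2\<^sup>2 * 19 + 2 * (19::real)"
  have C0: "0 \<le> C0" by (simp add: C0_def)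
  have CC: "C = 4 * sqrt C0" by (simp add: C C0_def algebra_simps)
  have "real (min (p + 1) s0) - 1 / 2 = real m + 1 / 2" unfolding m[symmetric] by simp
  then have "r = real N powr (- (real m + 1 / 2))" unfolding r by (rule arg_cong)
  then have "r\<^sup>2 = real N powr (- (real m + 1 / 2)) * real N powr (- (real m + 1 / 2))"
    by (simp add: power2_eq_square)
  also have "\<dots> = real N powr (- (real m + 1 / 2) + - (real m + 1 / 2))"
    by (rule powr_add[symmetric])
  also have "- (real m + 1 / 2) + - (real m + 1 / 2) = - real (2 * m + 1)" by simp
  also have "real N powr \<dots> = \<epsilon>"
    using N unfolding \<epsilon>_def powr_minus by (subst powr_realpow) (auto simp: power_one_over inverse_eq_divide)
  finally have r2: "r\<^sup>2 = \<epsilon>" .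
  have r0: "0 \<le> r" by (simp add: r)
  have wB: "(\<Sum>z\<in>set xs. (w z - f z)\<^sup>2) \<le> (n * (4 * \<epsilon>)) * S"
  proof -
    have "(w z - f z)\<^sup>2 \<le> 4 * \<epsilon> * S" if "z \<in> set xs" for z
    proof -
      have z: "z \<in> {0<..<1}" using that d unfolding design_def by blast
      then show ?thesis using err[of z] F(2)[OF z] by (simp add: power2_commute)
    qed
    then have "(\<Sum>z\<in>set xs. (w z - f z)\<^sup>2) \<le> real (card (set xs)) * (4 * \<epsilon> * S)"
      by (intro sum_bounded_above) auto
    also have "real (card (set xs)) = n" using d by (simp add: n_def design_def distinct_card)
    finally show ?thesis by (simp add: algebra_simps)
  qed
  have wA: "sq_integral w + sq_integral g \<le> 19 * S"
    using wS gS by linarith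
  have F1S: "sq_integral (F (Suc 0)) \<le> S" using F(3)[of "Suc 0"] by simp
  have n0: "0 \<le> n" "0 \<le> n * (4 * \<epsilon>)" using \<epsilon> by (auto simp: n_def)
  note E = kernel_interp_error[OF N eb d c par Fp[OF le0] F(2) F1S w(1,2) wB wA _ n0(2) S C0_def]
  have "(L2_norm (interp_error p N \<psi> \<mu> l xs f))\<^sup>2 \<le> 4 * C0 * h * (n * (4 * \<epsilon>) + h) * S"
    using E(1) by (simp add: h_def)
  also have "\<dots> \<le> 16 * C0 * ((sqrt (n * h) * r)\<^sup>2 + h\<^sup>2) * S"
  proof -
    have "4 * C0 * h * (n * (4 * \<epsilon>) + h) * S = 16 * C0 * (n * h * r\<^sup>2) * S + 4 * C0 * h\<^sup>2 * S"
      unfolding r2 by (simp add: power2_eq_square algebra_simps)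
    also have "\<dots> \<le> 16 * C0 * (n * h * r\<^sup>2) * S + 16 * C0 * h\<^sup>2 * S"
      using C0 S by (intro add_left_mono mult_right_mono) auto
    finally show ?thesis using n0 h by (simp add: power_mult_distrib algebra_simps)
  qed
  also have "\<dots> \<le> 16 * C0 * (sqrt (n * h) * r + h)\<^sup>2 * S"
    using C0 S n0 h r0 by (intro mult_right_mono mult_left_mono power2_sum_le_sum_power2) auto
  also have "\<dots> = (C * (sqrt (n * h) * r + h) * s)\<^sup>2"
    unfolding CC S_def power_mult_distrib using C0 by simp
  finally show "L2_norm (interp_error p N \<psi> \<mu> l xs f)
      \<le> C * (sqrt (real (length xs) * fill_distance xs) * r + fill_distance xs) * Sobolev_norm s0 f"
    unfolding n_def h_def s_def
    by (rule power2_le_imp_le) (use CC C0 n0 h r0 s in \<open>simp add: n_def h_def s_def\<close>)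
  have "2 * C0 * (n * (4 * \<epsilon>) + h) * S \<le> 16 * C0 * ((sqrt n * r)\<^sup>2 + (sqrt h)\<^sup>2) * S"
  proof -
    have "2 * (n * (4 * \<epsilon>) + h) \<le> 16 * (n * \<epsilon> + h)" using n0 h \<epsilon> by simp
    then have "(2 * (n * (4 * \<epsilon>) + h)) * (C0 * S) \<le> (16 * (n * \<epsilon> + h)) * (C0 * S)"
      using C0 S by (intro mult_right_mono) auto
    then show ?thesis using n0 h by (simp add: power_mult_distrib r2 mult_ac)
  qed
  also have "\<dots> \<le> 16 * C0 * (sqrt n * r + sqrt h)\<^sup>2 * S"
    using C0 S n0 h r0 by (intro mult_right_mono mult_left_mono power2_sum_le_sum_power2) auto
  also have "\<dots> = (C * (sqrt n * r + sqrt h) * s)\<^sup>2"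
    unfolding CC S_def power_mult_distrib using C0 by simp
  finally have "sqrt (2 * C0 * (n * (4 * \<epsilon>) + h) * S) \<le> C * (sqrt n * r + sqrt h) * s"
    by (rule real_le_lsqrt[rotated]) (use CC C0 n0 h r0 s in simp)
  then have "ereal (sqrt (2 * C0 * (n * (4 * \<epsilon>) + h) * S)) \<le> ereal (C * (sqrt n * r + sqrt h) * s)" by simp
  with E(2) show "Linf_norm (interp_error p N \<psi> \<mu> l xs f)
      \<le> ereal (C * (sqrt (real (length xs)) * r + sqrt (fill_distance xs)) * Sobolev_norm s0 f)"
    unfolding n_def h_def s_def by (simp add: order_trans)
qed

section \<open>Quasi-uniform designs resolved by the mesh\<close>

lemma fill_distance_lower:
  assumes "design xs" shows "1 \<le> 4 * fill_distance xs * real (length xs)"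
proof -
  have "card (set xs) = length xs" using assms by (simp add: design_def distinct_card)
  \<comment> \<open>For the constant 1 the derivative term vanishes and the sum over the design is
    the number of points.\<close>
  then show ?thesis using sampling_L2[OF primitive_const[of 1] assms refl] by simp
qed

text \<open>Pigeonhole: a bin of length \<open>2 * q\<close> holds at most one design point, so n -
  1 is at most 1/(2q), and n is at most 2(n - 1) for n at least 2.\<close>

lemma separation_upper:
  assumes d: "design xs" and n: "2 \<le> length xs"
  shows "separation_radius xs * real (length xs) \<le> 1"
proof -
  define q where "q = separation_radius xs"
  have q: "0 < q" unfolding q_def by (rule separation_pos[OF d n])
  define \<phi> where "\<phi> z = nat \<lfloor>z / (2 * q)\<rfloor>" for z
  have fl: "real (\<phi> z) \<le> z / (2 * q) \<and> z / (2 * q) < real (\<phi> z) + 1" if "z \<in> set xs" for z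
  proof -
    have "0 \<le> z / (2 * q)" using that d q by (force simp: design_def)
    then have "real (\<phi> z) = of_int \<lfloor>z / (2 * q)\<rfloor>" by (simp add: \<phi>_def)
    then show ?thesis by linarith
  qed
  have "inj_on \<phi> (set xs)"
  proof (rule inj_onI, rule ccontr)
    fix x z assume xz: "x \<in> set xs" "z \<in> set xs" "\<phi> x = \<phi> z" "x \<noteq> z"
    have "\<bar>x / (2 * q) - z / (2 * q)\<bar> < 1" using fl[OF xz(1)] fl[OF xz(2)] xz(3) by linarith
    then have "\<bar>x - z\<bar> / (2 * q) < 1" using q by (simp add: diff_divide_distrib[symmetric])
    then have "\<bar>x - z\<bar> < 2 * q" using q by (simp add: field_simps)
    then show False using separation_le[OF d xz(1,2,4)] by (simp add: q_def)
  qed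
  then have "length xs = card (\<phi> ` set xs)" using d by (simp add: card_image design_def distinct_card)
  also have "\<dots> \<le> card {..nat \<lfloor>1 / (2 * q)\<rfloor>}"
  proof (rule card_mono)
    show "\<phi> ` set xs \<subseteq> {..nat \<lfloor>1 / (2 * q)\<rfloor>}"
    proof
      fix y assume "y \<in> \<phi> ` set xs"
      then obtain z where z: "z \<in> set xs" "y = \<phi> z" by blast
      have "z / (2 * q) \<le> 1 / (2 * q)" using z d q by (intro divide_right_mono) (auto simp: design_def)
      then show "y \<in> {..nat \<lfloor>1 / (2 * q)\<rfloor>}" unfolding z \<phi>_def by (auto intro!: nat_mono floor_mono)
    qed
  qed simp
  finally have "length xs \<le> nat \<lfloor>1 / (2 * q)\<rfloor> + 1" by simp
  moreover have "real (nat \<lfloor>1 / (2 * q)\<rfloor>) \<le> 1 / (2 * q)" using q by simp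
  ultimately have "real (length xs) - 1 \<le> 1 / (2 * q)" by linarith
  then have "(real (length xs) - 1) * (2 * q) \<le> 1" using q by (simp add: field_simps)
  moreover have "real (length xs) * q \<le> ((real (length xs) - 1) * 2) * q"
    using n q by (intro mult_right_mono) auto
  ultimately show ?thesis by (simp add: q_def[symmetric] mult_ac)
qed

text \<open>Compare \<open>F x\<close> with \<open>F y\<close> for every \<open>y\<close> and
  integrate over \<open>y\<close>, which turns the unknown value into the L^2 norm.\<close>

lemma primitive_sup_sq:
  assumes F: "primitive F F'" and x: "x \<in> {0..1}"
    and S: "sq_integral F \<le> S" "sq_integral F' \<le> S"
  shows "(F x)\<^sup>2 \<le> 4 * S"
proof -
  have "(F x)\<^sup>2 \<le> 2 * (F y)\<^sup>2 + 2 * S" if y: "y \<in> {0..1}" for y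
  proof -
    have "(F x - F y)\<^sup>2 \<le> \<bar>x - y\<bar> * (cum_square F' 1 - cum_square F' 0)"
      using x y by (intro primitive_diff_sq_le_cum[OF F]) auto
    also have "\<dots> = \<bar>x - y\<bar> * sq_integral F'" by (simp add: cum_square_def)
    also have "\<dots> \<le> 1 * sq_integral F'"
      using x y by (intro mult_right_mono integral_square_nonneg) auto
    also have "\<dots> \<le> S" using S by simp
    finally have "(F x - F y)\<^sup>2 \<le> S" .
    moreover have "(F x)\<^sup>2 \<le> 2 * (F y)\<^sup>2 + 2 * (F x - F y)\<^sup>2"
      using sum_of_squares_bound[of "F x - F y" "- F y"] by simp
    ultimately show ?thesis by linarith
  qed
  moreover have iF: "(\<lambda>x. (F x)\<^sup>2) integrable_on {0..1}"
    by (intro integrable_continuous_real continuous_intros primitive_continuous[OF F])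
  moreover have R: "((\<lambda>y. 2 * (F y)\<^sup>2 + 2 * S) has_integral (2 * sq_integral F + 2 * S)) {0..1}"
    by (rule has_integral_add[OF has_integral_mult_right[OF integrable_integral[OF iF]] has_integral_const_unit])
  moreover have "((\<lambda>y::real. (F x)\<^sup>2) has_integral (F x)\<^sup>2) {0..1}"
    by (rule has_integral_const_unit)
  ultimately have "(F x)\<^sup>2 \<le> 2 * sq_integral F + 2 * S"
    using has_integral_le by blast
  then show ?thesis using S by linarith
qed

text \<open>If \<open>1 / N\<close> is below the separation radius, no node is within \<open>1 / N\<close> of two design points,
  so the nodal values around each design point can be frozen to the value of \<open>f\<close> there.\<close>

lemma fe_interpolant:
  assumes N: "1 \<le> N" and p: "1 \<le> p" and d: "design xs" and q: "1 / real N < separation_radius xs"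
    and F: "primitive F F'" and S: "sq_integral F \<le> S" "sq_integral F' \<le> S"
  obtains w g where "w \<in> fe_space p N" "primitive w g" "\<And>z. z \<in> set xs \<Longrightarrow> w z = F z"
    "sq_integral w + sq_integral g \<le> 35 * S"
proof -
  define Q where "Q k z \<longleftrightarrow> z \<in> set xs \<and> \<bar>z - real k / real N\<bar> \<le> 1 / real N" for k z
  define t where "t k = (if \<exists>z. Q k z then SOME z. Q k z else real k / real N)" for k
  have Qt: "Q k (t k)" if "Q k z" for k z
    using someI[of "Q k", OF that] that by (auto simp: t_def)
  have tz: "t k = z" if Qz: "Q k z" for k z
  proof (rule ccontr)
    assume "t k \<noteq> z"
    then have "2 * separation_radius xs \<le> \<bar>t k - z\<bar>"
      using Qt[OF Qz] Qz by (intro separation_le[OF d]) (auto simp: Q_def)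
    moreover have "\<bar>t k - z\<bar> \<le> 1 / real N + 1 / real N"
      using Qt[OF Qz] Qz unfolding Q_def by linarith
    ultimately show False using q by linarith
  qed
  have t: "t k \<in> {0..1}" "\<bar>t k - real k / real N\<bar> \<le> 1 / real N" if "k \<le> N" for k
  proof -
    have "t k \<in> {0..1} \<and> \<bar>t k - real k / real N\<bar> \<le> 1 / real N"
    proof (cases "\<exists>z. Q k z")
      case True
      then have "Q k (t k)" using Qt by blast
      then show ?thesis using d by (force simp: Q_def design_def)
    next
      case False
      then show ?thesis using that N by (auto simp: t_def)
    qed
    then show "t k \<in> {0..1}" "\<bar>t k - real k / real N\<bar> \<le> 1 / real N" by auto
  qed
  obtain w g where w: "w \<in> fe_space p N" "primitive w g"
    "\<And>i x. i \<in> {1..N} \<Longrightarrow> x \<in> cell N i \<Longrightarrow> t (i - 1) = t i \<Longrightarrow> w x = F (t i)"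
    "w 0 = F (t 0)"
    "sq_integral g \<le> 9 * sq_integral F'"
    using fe_quasi_interpolant[OF N p F t] by blast
  have gS: "sq_integral g \<le> 9 * S" using w(5) S by linarith
  have wz: "w z = F z" if z: "z \<in> set xs" for z
  proof -
    have "z \<in> {0..1}" using z d by (force simp: design_def)
    then obtain i where i: "i \<in> {1..N}" "z \<in> cell N i" using cell_cover[OF N] by metis
    have ri: "real (i - 1) = real i - 1" using i by auto
    have "(real i - 1) / real N = real i / real N - 1 / real N" by (simp add: diff_divide_distrib)
    then have "\<bar>z - real i / real N\<bar> \<le> 1 / real N" "\<bar>z - (real i - 1) / real N\<bar> \<le> 1 / real N"
      using i(2) by auto
    \<comment> \<open>Both nodes of the cell containing \<open>z\<close> are within 1/N of it, so
      both sample points equal \<open>z\<close> and \<open>w\<close> is constant on that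
      cell.\<close>
    then have "Q i z" "Q (i - 1) z" using z unfolding Q_def ri by blast+
    then have "t i = z" "t (i - 1) = z" by (blast intro: tz)+
    then show ?thesis using w(3)[OF i] by simp
  qed
  \<comment> \<open>26 is 2 * 9 for the increment from 0 plus 2 * 4 for the value at 0; the energy
    of \<open>g\<close> adds 9 more, giving 35.\<close>
  have "(w x)\<^sup>2 \<le> 26 * S" if x: "x \<in> {0..1}" for x
  proof -
    have "(w x - w 0)\<^sup>2 \<le> \<bar>x - 0\<bar> * (cum_square g 1 - cum_square g 0)"
      using x by (intro primitive_diff_sq_le_cum[OF w(2)]) auto
    also have "\<dots> = \<bar>x\<bar> * sq_integral g" by (simp add: cum_square_def)
    also have "\<dots> \<le> 1 * sq_integral g"
      using x by (intro mult_right_mono integral_square_nonneg) auto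
    finally have 1: "(w x - w 0)\<^sup>2 \<le> 9 * S" using gS by simp
    have 2: "(w 0)\<^sup>2 \<le> 4 * S" unfolding w(4) by (rule primitive_sup_sq[OF F t(1) S]) simp
    have "(w x)\<^sup>2 \<le> 2 * (w x - w 0)\<^sup>2 + 2 * (w 0)\<^sup>2"
      using sum_of_squares_bound[of "w x - w 0" "- w 0"] by simp
    with 1 2 show ?thesis by linarith
  qed
  moreover have "(\<lambda>x. (w x)\<^sup>2) integrable_on {0..1}"
    by (intro integrable_continuous_real continuous_intros primitive_continuous[OF w(2)])
  ultimately have "sq_integral w \<le> integral {0..1} (\<lambda>x::real. 26 * S)"
    by (intro integral_le) auto
  then have "sq_integral w + sq_integral g \<le> 35 * S" using gS by simp
  with w(1,2) wz show ?thesis by (rule that)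
qed

text \<open>The competitor now interpolates \<open>f\<close> on the design, so \<open>B = 0\<close>
  in \<open>kernel_interp_error\<close> and only powers of the fill distance survive.\<close>

lemma kernel_interp_rate_resolved:
  fixes c1 c2 :: real
  assumes p: "1 \<le> p" and c: "0 < c1" "0 < c2"
    and N: "1 \<le> N" and d: "design xs" and eb: "fe_eigenbasis p N \<psi> \<mu>"
    and q: "1 / real N < separation_radius xs"
    and f: "f \<in> Sobolev_cont 1" and par: "param_choice c1 c2 xs l"
    and C: "C = 2 * sqrt (73 + 2 / c1\<^sup>2 + 35 * c2\<^sup>2)"
  shows "L2_norm (interp_error p N \<psi> \<mu> l xs f)
      \<le> C * fill_distance xs * Sobolev_norm 1 f"
    and "Linf_norm (interp_error p N \<psi> \<mu> l xs f)
      \<le> ereal (C * sqrt (fill_distance xs) * Sobolev_norm 1 f)"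
proof -
  define s where "s = Sobolev_norm 1 f"
  define S where "S = s\<^sup>2"
  have s: "0 \<le> s" unfolding s_def by (rule Sobolev_norm_nonneg)
  have S: "0 \<le> S" by (simp add: S_def)
  obtain F where F: "\<And>k. k < 1 \<Longrightarrow> primitive (F k) (F (Suc k))"
    "\<And>x. x \<in> Omega \<Longrightarrow> F 0 x = f x"
    "\<And>k. k \<le> 1 \<Longrightarrow> sq_integral (F k) \<le> S"
    using Sobolev_cont_chain[OF f order_refl order_refl] unfolding S_def s_def by metis
  have F0: "primitive (F 0) (F (Suc 0))" "sq_integral (F 0) \<le> S"
    "sq_integral (F (Suc 0)) \<le> S" using F(1)[of 0] F(3)[of 0] F(3)[of 1] by auto
  obtain w g where w: "w \<in> fe_space p N" "primitive w g" "\<And>z. z \<in> set xs \<Longrightarrow> w z = F 0 z"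
    "sq_integral w + sq_integral g \<le> 35 * S"
    using fe_interpolant[OF N p d q F0] by blast
  have "w z - f z = 0" if "z \<in> set xs" for z
    using w(3)[OF that] F(2)[of z] that d by (force simp: design_def)
  then have wB: "(\<Sum>z\<in>set xs. (w z - f z)\<^sup>2) \<le> 0 * S" by simp
  define h where "h = fill_distance xs"
  have h: "0 \<le> h" using fill_distance_pos[OF d] by (simp add: h_def)
  \<comment> \<open>\<open>A = 35\<close>, and 3 + 2 * 35 = 73; the factor 2 in \<open>C\<close> is
    the root of the 4 in the L^2 bound.\<close>
  define C0 where "C0 = 3 + 2 / c1\<^sup>2 + c2\<^sup>2 * 35 + 2 * (35::real)"
  have C0: "0 \<le> C0" by (simp add: C0_def)
  have CC: "C = 2 * sqrt C0" by (simp add: C C0_def algebra_simps)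
  note E = kernel_interp_error[OF N eb d c par F0(1) F(2) F0(3) w(1,2) wB w(4) _ order_refl S C0_def]
  have "(L2_norm (interp_error p N \<psi> \<mu> l xs f))\<^sup>2 \<le> 4 * C0 * h\<^sup>2 * S"
    using E(1) by (simp add: h_def power2_eq_square mult_ac)
  also have "\<dots> = (C * h * s)\<^sup>2"
    unfolding CC S_def power_mult_distrib using C0 by simp
  finally show "L2_norm (interp_error p N \<psi> \<mu> l xs f)
      \<le> C * fill_distance xs * Sobolev_norm 1 f"
    unfolding h_def s_def by (rule power2_le_imp_le) (use CC C0 h s in \<open>simp add: h_def s_def\<close>)
  have "2 * C0 * h * S \<le> 4 * C0 * h * S" using C0 h S by (intro mult_right_mono) auto
  also have "\<dots> = (C * sqrt h * s)\<^sup>2"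
    unfolding CC S_def power_mult_distrib using C0 h by simp
  finally have "sqrt (2 * C0 * h * S) \<le> C * sqrt h * s"
    by (rule real_le_lsqrt[rotated]) (use CC C0 h s in simp)
  then have "ereal (sqrt (2 * C0 * h * S)) \<le> ereal (C * sqrt h * s)" by simp
  with E(2) show "Linf_norm (interp_error p N \<psi> \<mu> l xs f)
      \<le> ereal (C * sqrt (fill_distance xs) * Sobolev_norm 1 f)"
    unfolding h_def s_def by (simp add: order_trans)
qed

theorem theorem4p14:
  fixes p s0 :: nat
  assumes "p \<ge> 1" and "s0 \<ge> 1"
  shows "(\<exists>h0>0. \<forall>c1>0. \<forall>c2>0. \<exists>C>0.
            \<forall>N xs \<psi> \<mu> l f.
              N \<ge> 1 \<and> design xs \<and> fe_eigenbasis p N \<psi> \<mu> \<and>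
              invertible_mat (kernel_mat (fe_kernel p N \<psi> \<mu>) xs) \<and>
              f \<in> Sobolev_cont s0 \<and> fill_distance xs \<le> h0 \<and> param_choice c1 c2 xs l \<longrightarrow>
              L2_norm (\<lambda>x. f x - kernel_interp (fe_kernel p N \<psi> \<mu>) l xs f x)
                \<le> C * (sqrt (real (length xs) * fill_distance xs)
                          * real N powr (- (real (min (p + 1) s0) - 1 / 2))
                        + fill_distance xs) * Sobolev_norm s0 f \<and>
              Linf_norm (\<lambda>x. f x - kernel_interp (fe_kernel p N \<psi> \<mu>) l xs f x)
                \<le> ereal (C * (sqrt (real (length xs))
                                 * real N powr (- (real (min (p + 1) s0) - 1 / 2))
                               + sqrt (fill_distance xs)) * Sobolev_norm s0 f))
       \<and>
         (\<forall>D. (\<forall>xs\<in>D. design xs \<and> length xs \<ge> 2) \<and> quasi_uniform D \<longrightarrow>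
            (\<exists>c0>0. \<forall>xs\<in>D. \<forall>N::nat. c0 * real (length xs) \<le> real N \<longrightarrow>
               1 / real N < separation_radius xs) \<and>
            (\<forall>c>0. \<forall>c1>0. \<forall>c2>0. \<exists>C>0.
               \<forall>xs\<in>D. \<forall>N \<psi> \<mu>.
                 N \<ge> 1 \<and> c * real (length xs) \<le> real N \<and> 1 / real N < separation_radius xs \<and>
                 fe_eigenbasis p N \<psi> \<mu> \<longrightarrow>
                 invertible_mat (kernel_mat (fe_kernel p N \<psi> \<mu>) xs) \<and>
                 (\<forall>l f. f \<in> Sobolev_cont 1 \<and> param_choice c1 c2 xs l \<longrightarrow>
                    L2_norm (\<lambda>x. f x - kernel_interp (fe_kernel p N \<psi> \<mu>) l xs f x)
                      \<le> C * real (length xs) powr (- 1) * Sobolev_norm 1 f \<and>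
                    Linf_norm (\<lambda>x. f x - kernel_interp (fe_kernel p N \<psi> \<mu>) l xs f x)
                      \<le> ereal (C * real (length xs) powr (- 1 / 2) * Sobolev_norm 1 f))))"
proof (intro conjI allI impI)
  show "\<exists>h0>0. \<forall>c1>0. \<forall>c2>0. \<exists>C>0.
            \<forall>N xs \<psi> \<mu> l f.
              N \<ge> 1 \<and> design xs \<and> fe_eigenbasis p N \<psi> \<mu> \<and>
              invertible_mat (kernel_mat (fe_kernel p N \<psi> \<mu>) xs) \<and>
              f \<in> Sobolev_cont s0 \<and> fill_distance xs \<le> h0 \<and> param_choice c1 c2 xs l \<longrightarrow>
              L2_norm (interp_error p N \<psi> \<mu> l xs f)
                \<le> C * (sqrt (real (length xs) * fill_distance xs)
                          * real N powr (- (real (min (p + 1) s0) - 1 / 2))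
                        + fill_distance xs) * Sobolev_norm s0 f \<and>
              Linf_norm (interp_error p N \<psi> \<mu> l xs f)
                \<le> ereal (C * (sqrt (real (length xs))
                                 * real N powr (- (real (min (p + 1) s0) - 1 / 2))
                               + sqrt (fill_distance xs)) * Sobolev_norm s0 f)"
  proof (rule exI[of _ "1::real"], intro conjI allI impI)
    fix c1 c2 :: real assume c: "0 < c1" "0 < c2"
    define C where "C = 4 * sqrt (41 + 2 / c1\<^sup>2 + 19 * c2\<^sup>2)"
    have "0 < 41 + 2 / c1\<^sup>2 + 19 * c2\<^sup>2" by (intro add_pos_nonneg) auto
    then have "0 < C" by (simp add: C_def)
    with kernel_interp_rate[OF assms c _ _ _ _ _ C_def refl]
    show "\<exists>C>0. \<forall>N xs \<psi> \<mu> l f.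
              N \<ge> 1 \<and> design xs \<and> fe_eigenbasis p N \<psi> \<mu> \<and>
              invertible_mat (kernel_mat (fe_kernel p N \<psi> \<mu>) xs) \<and>
              f \<in> Sobolev_cont s0 \<and> fill_distance xs \<le> 1 \<and> param_choice c1 c2 xs l \<longrightarrow>
              L2_norm (interp_error p N \<psi> \<mu> l xs f)
                \<le> C * (sqrt (real (length xs) * fill_distance xs)
                          * real N powr (- (real (min (p + 1) s0) - 1 / 2))
                        + fill_distance xs) * Sobolev_norm s0 f \<and>
              Linf_norm (interp_error p N \<psi> \<mu> l xs f)
                \<le> ereal (C * (sqrt (real (length xs))
                                 * real N powr (- (real (min (p + 1) s0) - 1 / 2))
                               + sqrt (fill_distance xs)) * Sobolev_norm s0 f)"
      by (intro exI[of _ C]) blast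
  qed simp
next
  fix D :: "real list set"
  assume D: "(\<forall>xs\<in>D. design xs \<and> length xs \<ge> 2) \<and> quasi_uniform D"
  then obtain \<rho>0 where \<rho>0: "\<And>xs. xs \<in> D \<Longrightarrow> fill_distance xs / separation_radius xs \<le> \<rho>0"
    unfolding quasi_uniform_def by blast
  \<comment> \<open>At least 1, so that \<open>\<rho>\<close> also bounds its square root in the
    supremum estimate.\<close>
  define \<rho> where "\<rho> = max \<rho>0 1"
  have \<rho>: "1 \<le> \<rho>" by (simp add: \<rho>_def)
  have hq: "fill_distance xs \<le> \<rho> * separation_radius xs" if "xs \<in> D" for xs
  proof -
    have q: "0 < separation_radius xs" using D that separation_pos by blast
    have "fill_distance xs / separation_radius xs \<le> \<rho>" using \<rho>0[OF that] by (simp add: \<rho>_def)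
    then show ?thesis using q by (simp add: field_simps)
  qed
  \<comment> \<open>With separation radius q, the bounds 1 <= 4 h n and h <= \<rho> q give 1 <= 4
    \<rho> q n; the added 1 makes the resulting inequality strict.\<close>
  define c0 where "c0 = 4 * \<rho> + 1"
  have c0: "0 < c0" using \<rho> by (simp add: c0_def)
  have "1 / real N < separation_radius xs" if xs: "xs \<in> D" and N: "c0 * real (length xs) \<le> real N" for xs N
  proof -
    define n where "n = real (length xs)"
    have "2 \<le> length xs" using D xs by blast
    then have n: "0 < n" unfolding n_def by linarith
    have q: "0 < separation_radius xs" using D xs separation_pos by blast
    have "1 \<le> 4 * fill_distance xs * n" unfolding n_def using D xs fill_distance_lower by blast
    also have "\<dots> \<le> 4 * (\<rho> * separation_radius xs) * n" using hq[OF xs] n by (intro mult_right_mono) auto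
    also have "\<dots> < (c0 * n) * separation_radius xs" using n q by (simp add: c0_def algebra_simps)
    also have "\<dots> \<le> real N * separation_radius xs" using N q unfolding n_def by (intro mult_right_mono) auto
    finally have "1 < real N * separation_radius xs" .
    moreover have "0 < real N" using N mult_pos_pos[OF c0 n] unfolding n_def by linarith
    ultimately show ?thesis by (simp add: field_simps)
  qed
  then show "\<exists>c0>0. \<forall>xs\<in>D. \<forall>N::nat. c0 * real (length xs) \<le> real N \<longrightarrow> 1 / real N < separation_radius xs"
    using c0 by blast
  fix c c1 c2 :: real assume c: "0 < c" "0 < c1" "0 < c2"
  define C1 where "C1 = 2 * sqrt (73 + 2 / c1\<^sup>2 + 35 * c2\<^sup>2)"
  have "0 < 73 + 2 / c1\<^sup>2 + 35 * c2\<^sup>2" by (intro add_pos_nonneg) auto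
  then have C1: "0 < C1" by (simp add: C1_def)
  have main: "invertible_mat (kernel_mat (fe_kernel p N \<psi> \<mu>) xs) \<and>
                 (\<forall>l f. f \<in> Sobolev_cont 1 \<and> param_choice c1 c2 xs l \<longrightarrow>
                    L2_norm (interp_error p N \<psi> \<mu> l xs f)
                      \<le> (C1 * \<rho>) * real (length xs) powr (- 1) * Sobolev_norm 1 f \<and>
                    Linf_norm (interp_error p N \<psi> \<mu> l xs f)
                      \<le> ereal ((C1 * \<rho>) * real (length xs) powr (- 1 / 2) * Sobolev_norm 1 f))"
    if xs: "xs \<in> D" and N: "1 \<le> N" and q: "1 / real N < separation_radius xs"
      and eb: "fe_eigenbasis p N \<psi> \<mu>" for xs N \<psi> \<mu>
  proof (intro conjI allI impI)
    have d: "design xs" and n2: "2 \<le> length xs" using D xs by auto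
    show "invertible_mat (kernel_mat (fe_kernel p N \<psi> \<mu>) xs)"
      by (rule kernel_mat_invertible[OF N assms(1) eb d q])
    fix l f assume fl: "f \<in> Sobolev_cont 1 \<and> param_choice c1 c2 xs l"
    note E = kernel_interp_rate_resolved[OF assms(1) c(2,3) N d eb q conjunct1[OF fl] conjunct2[OF fl] C1_def]
    define n where "n = real (length xs)"
    have n: "0 < n" using n2 unfolding n_def by linarith
    \<comment> \<open>Packing bounds the separation radius by 1/n and quasi-uniformity passes this
      on to the fill distance, turning rates in h into rates in n.\<close>
    have "separation_radius xs \<le> 1 / n"
      using separation_upper[OF d n2] n by (simp add: n_def field_simps)
    then have "\<rho> * separation_radius xs \<le> \<rho> * (1 / n)" using \<rho> by (intro mult_left_mono) auto
    with hq[OF xs] have h: "fill_distance xs \<le> \<rho> * (1 / n)" by linarith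
    have n1: "n powr (- 1) = 1 / n" using n by (simp add: powr_minus inverse_eq_divide)
    have n12: "n powr (- 1 / 2) = sqrt (1 / n)" using n by (simp add: powr_minus powr_half_sqrt real_sqrt_divide inverse_eq_divide)
    have "C1 * fill_distance xs * Sobolev_norm 1 f \<le> C1 * (\<rho> * (1 / n)) * Sobolev_norm 1 f"
      using h C1 by (intro mult_right_mono mult_left_mono Sobolev_norm_nonneg) auto
    with E(1) show "L2_norm (interp_error p N \<psi> \<mu> l xs f)
        \<le> (C1 * \<rho>) * real (length xs) powr (- 1) * Sobolev_norm 1 f"
      unfolding n_def[symmetric] n1 by (simp add: mult.assoc)
    have "sqrt (fill_distance xs) \<le> sqrt (\<rho> * (1 / n))" using h by simp
    also have "\<dots> = sqrt \<rho> * sqrt (1 / n)" by (rule real_sqrt_mult)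
    also have "\<dots> \<le> \<rho> * sqrt (1 / n)"
    proof (rule mult_right_mono)
      show "sqrt \<rho> \<le> \<rho>" using \<rho> by (intro real_le_lsqrt) (auto simp: power2_eq_square)
    qed (use n in simp)
    finally have "C1 * sqrt (fill_distance xs) * Sobolev_norm 1 f \<le> C1 * (\<rho> * sqrt (1 / n)) * Sobolev_norm 1 f"
      using C1 by (intro mult_right_mono mult_left_mono Sobolev_norm_nonneg) auto
    then have "ereal (C1 * sqrt (fill_distance xs) * Sobolev_norm 1 f) \<le> ereal ((C1 * \<rho>) * n powr (- 1 / 2) * Sobolev_norm 1 f)"
      unfolding n12 by (simp add: mult.assoc)
    with E(2) show "Linf_norm (interp_error p N \<psi> \<mu> l xs f)
        \<le> ereal ((C1 * \<rho>) * real (length xs) powr (- 1 / 2) * Sobolev_norm 1 f)"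
      unfolding n_def[symmetric] by (rule order_trans)
  qed
  have "0 < C1 * \<rho>" using C1 \<rho> by simp
  with main
  show "\<exists>C>0. \<forall>xs\<in>D. \<forall>N \<psi> \<mu>.
                 N \<ge> 1 \<and> c * real (length xs) \<le> real N \<and> 1 / real N < separation_radius xs \<and>
                 fe_eigenbasis p N \<psi> \<mu> \<longrightarrow>
                 invertible_mat (kernel_mat (fe_kernel p N \<psi> \<mu>) xs) \<and>
                 (\<forall>l f. f \<in> Sobolev_cont 1 \<and> param_choice c1 c2 xs l \<longrightarrow>
                    L2_norm (interp_error p N \<psi> \<mu> l xs f)
                      \<le> C * real (length xs) powr (- 1) * Sobolev_norm 1 f \<and>
                    Linf_norm (interp_error p N \<psi> \<mu> l xs f)
                      \<le> ereal (C * real (length xs) powr (- 1 / 2) * Sobolev_norm 1 f))"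
    by (intro exI[of _ "C1 * \<rho>"]) blast
qed

end
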